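(* Let $(M,L)$ be a Finsler manifold, $A$ a scalar 1-form on $\pi^{-1}(TM)$, $\overline{D}$ the HRF-connection with h-recurrence form $A$, and $\overline{a}$ the $\pi$-vector field defined by $g(\overline a,\overline X)=A(\overline X)$. Then: (a) The spray $\overline{G}$ associated with $\overline{D}$ is related to the canonical spray $G$ of $(M,L)$ by $$\overline{G}=G+A(\overline\eta)\,\mathcal{C}-\tfrac12L^2\,\gamma\overline a .$$ (b) The nonlinear connection $\overline\Gamma$ associated with $\overline D$ is related to the Barthel connection $\Gamma$ of $(M,L)$ by $$\overline\Gamma(X)=\Gamma(X)+\{A(\rho X)\,\mathcal{C}+A(\overline\eta)\,JX-g(\rho X,\overline\eta)\,\gamma\overline a+L^2\,\gamma T(\overline a,\rho X)\}$$ for all vector fields $X$ on $\mathcal{T}M$, where $T$ is the (h)hv-torsion of the Cartan connection of $(M,L)$.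
   Context: $M$ is a smooth manifold, $\pi:\mathcal{T}M\to M$ its slit tangent bundle (nonzero tangent vectors), $\pi^{-1}(TM)$ the pullback of $TM$ to $\mathcal{T}M$, and $\mathfrak{X}(\pi(M))$ the module of its smooth sections ($\pi$-vector fields, written with bars). $\overline\eta(u)=(u,u)$. The bundle maps $\gamma:\pi^{-1}(TM)\to T(\mathcal{T}M)$ and $\rho:T(\mathcal{T}M)\to\pi^{-1}(TM)$ are $\gamma(u,v)=\frac{d}{dt}\big|_{t=0}(u+tv)$ and $\rho(X)=(u,d\pi(X))$ for $X\in T_u(\mathcal{T}M)$; $J=\gamma\circ\rho$, $\mathcal{C}=\gamma\overline\eta$. A scalar 1-form on $\pi^{-1}(TM)$ is a smooth section of its dual bundle. Finsler structure: $L:TM\to[0,\infty)$ is smooth and positive on $\mathcal{T}M$, positively 1-homogeneous on fibres, and $g_u(v,w)=\frac12\frac{\partial^2}{\partial s\,\partial t}\big|_{s=t=0}L^2(u+sv+tw)$ is a metric on $\pi^{-1}(TM)$. Let $D$ be a linear connection on $\pi^{-1}(TM)$. Its connection map is $K(X)=D_X\overline\eta$; $H_u=\ker K|_u$, $V_u=\ker d\pi|_u$. $D$ is regular if $T_u(\mathcal{T}M)=V_u\oplus H_u$ for all $u$; its horizontal map is then $\beta=(\rho|_H)^{-1}$. Torsion: $\mathbf{T}(X,Y)=D_X\rho Y-D_Y\rho X-\rho[X,Y]$; (h)h-torsion $Q(\overline X,\overline Y)=\mathbf{T}(\beta\overline X,\beta\overline Y)$; (h)hv-torsion $T(\overline X,\overline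 Y)=\mathbf{T}(\gamma\overline X,\beta\overline Y)$. The semispray (here a spray) associated with $D$ is $\beta\overline\eta$, and the nonlinear connection associated with $D$ is $2\beta\circ\rho-I$. The Cartan connection $\nabla$ is the unique regular connection with $\nabla g=0$, $Q=0$ and $g(T(\overline X,\overline Y),\overline Z)=g(T(\overline X,\overline Z),\overline Y)$. The HRF-connection with h-recurrence form $A$ is the unique regular connection $\overline D$, with horizontal map $\bar\beta$, (h)h-torsion $\overline Q$ and (h)hv-torsion $\overline T$, such that $\overline D_{\bar\beta\overline X}g=A(\overline X)g$, $\overline D_{\gamma\overline X}g=0$, $\overline Q=0$ and $g(\overline T(\overline X,\overline Y),\overline Z)=g(\overline T(\overline X,\overline Z),\overline Y)$. The canonical spray $G$ is defined by $i_G\Omega=-dE$, where $E=\frac12L^2$, $\Omega=dd_JE$ and $d_JE=dE\circ J$. The Barthel connection is $\Gamma=[J,G]$, i.e. $\Gamma(X)=[JX,G]-J[X,G]$; it is the unique conservative homogeneous torsion-free nonlinear connection of $(M,L)$. *)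

theory Defs
  imports "HOL-Analysis.Analysis" "HOL-Library.Function_Algebras"
begin

section \<open>Functions as real vectors\<close>

instantiation "fun" :: (type, real_vector) real_vector
begin

definition scaleR_fun :: "real \<Rightarrow> ('a \<Rightarrow> 'b) \<Rightarrow> 'a \<Rightarrow> 'b"
  where "scaleR_fun r f = (\<lambda>x. r *\<^sub>R f x)"

instance
  by standard (simp_all add: scaleR_fun_def fun_eq_iff scaleR_add_right scaleR_add_left)

end

lemma scaleR_fun_apply [simp]: "(r *\<^sub>R f) x = r *\<^sub>R f x"
  by (simp add: scaleR_fun_def)

definition linear_on_fibre :: "'v::real_vector set \<Rightarrow> ('v \<Rightarrow> 'w::real_vector) \<Rightarrow> bool" where
  "linear_on_fibre V f \<longleftrightarrow>
     (\<forall>v\<in>V. \<forall>w\<in>V. f (v + w) = f v + f w) \<and> (\<forall>v\<in>V. \<forall>r. f (r *\<^sub>R v) = r *\<^sub>R f v)"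


section \<open>Smooth maps between Euclidean spaces\<close>

text \<open>On an open set, \<open>k_smooth_on k\<close> is the usual class of \<open>k\<close> times continuously differentiable maps.\<close>

primrec k_smooth_on ::
  "nat \<Rightarrow> 'e::euclidean_space set \<Rightarrow> ('e \<Rightarrow> 'f::real_normed_vector) \<Rightarrow> bool" where
  "k_smooth_on 0 = (\<lambda>S f. continuous_on S f)"
| "k_smooth_on (Suc k) = (\<lambda>S f. (\<forall>x\<in>S. f differentiable (at x)) \<and>
     (\<forall>e. k_smooth_on k S (\<lambda>x. frechet_derivative f (at x) e)))"

definition smooth_on :: "'e::euclidean_space set \<Rightarrow> ('e \<Rightarrow> 'f::real_normed_vector) \<Rightarrow> bool" where
  "smooth_on S f \<longleftrightarrow> (\<forall>k. k_smooth_on k S f)"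


section \<open>Manifolds and tangent vectors\<close>

text \<open>A chart is a pair of its domain and its coordinate map; only the values of the map on the
  domain matter.\<close>

type_synonym ('a, 'e) chart = "'a set \<times> ('a \<Rightarrow> 'e)"

abbreviation inv_chart :: "('a, 'e) chart \<Rightarrow> 'e \<Rightarrow> 'a" where
  "inv_chart c \<equiv> inv_into (fst c) (snd c)"

definition smooth_manifold :: "'a topology \<Rightarrow> ('a, 'e::euclidean_space) chart set \<Rightarrow> bool" where
  "smooth_manifold M atl \<longleftrightarrow>
     Hausdorff_space M \<and> second_countable M \<and>
     topspace M = (\<Union>c\<in>atl. fst c) \<and>
     (\<forall>c\<in>atl. openin M (fst c) \<and> open (snd c ` fst c) \<and>
        homeomorphic_map (subtopology M (fst c)) (top_of_set (snd c ` fst c)) (snd c)) \<and>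
     (\<forall>c\<in>atl. \<forall>d\<in>atl. smooth_on (snd c ` (fst c \<inter> fst d)) (snd d \<circ> inv_chart c))"

text \<open>A tangent vector at \<open>p\<close> is the family of its coordinate representations in all charts around
  \<open>p\<close>, related to each other by the derivatives of the transition maps, and extended by \<open>0\<close> to the
  remaining charts.  The vector space structure is the pointwise one.\<close>

type_synonym ('a, 'e) tvec = "('a, 'e) chart \<Rightarrow> 'e"

definition tangent_space ::
  "('a, 'e::euclidean_space) chart set \<Rightarrow> 'a \<Rightarrow> ('a, 'e) tvec set" where
  "tangent_space atl p = {v.
     (\<forall>c. \<not> (c \<in> atl \<and> p \<in> fst c) \<longrightarrow> v c = 0) \<and>
     (\<forall>c\<in>atl. \<forall>d\<in>atl. p \<in> fst c \<and> p \<in> fst d \<longrightarrow>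
        v d = frechet_derivative (snd d \<circ> inv_chart c) (at (snd c p)) (v c))}"

text \<open>The tangent vector at \<open>p\<close> with coordinates \<open>e\<close> in the chart \<open>c\<close>.\<close>

definition coord_vec ::
  "('a, 'e::euclidean_space) chart set \<Rightarrow> ('a, 'e) chart \<Rightarrow> 'e \<Rightarrow> 'a \<Rightarrow> ('a, 'e) tvec" where
  "coord_vec atl c e p = (\<lambda>d. if d \<in> atl \<and> p \<in> fst d
     then frechet_derivative (snd d \<circ> inv_chart c) (at (snd c p)) e else 0)"

definition smooth_in_chart ::
  "('a, 'e::euclidean_space) chart \<Rightarrow> ('a \<Rightarrow> 'f::real_normed_vector) \<Rightarrow> bool" where
  "smooth_in_chart c f \<longleftrightarrow> smooth_on (snd c ` fst c) (f \<circ> inv_chart c)"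

definition smooth_fun ::
  "('a, 'e::euclidean_space) chart set \<Rightarrow> ('a \<Rightarrow> 'f::real_normed_vector) \<Rightarrow> bool" where
  "smooth_fun atl f \<longleftrightarrow> (\<forall>c\<in>atl. smooth_in_chart c f)"

text \<open>The derivatives below are computed in one chart around \<open>p\<close>; by the chain rule its choice does
  not matter.\<close>

definition chart_at :: "('a, 'e) chart set \<Rightarrow> 'a \<Rightarrow> ('a, 'e) chart" where
  "chart_at atl p = (SOME c. c \<in> atl \<and> p \<in> fst c)"

definition dfun ::
  "('a, 'e::euclidean_space) chart set \<Rightarrow> ('a \<Rightarrow> real) \<Rightarrow> 'a \<Rightarrow> ('a, 'e) tvec \<Rightarrow> real" where
  "dfun atl f p \<xi> = (let c = chart_at atl p in
     frechet_derivative (f \<circ> inv_chart c) (at (snd c p)) (\<xi> c))"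

definition tangent_map ::
  "('a, 'e::euclidean_space) chart set \<Rightarrow> ('b, 'f::euclidean_space) chart set \<Rightarrow> ('a \<Rightarrow> 'b) \<Rightarrow>
   'a \<Rightarrow> ('a, 'e) tvec \<Rightarrow> ('b, 'f) tvec" where
  "tangent_map atl btl F p \<xi> = (\<lambda>d. if d \<in> btl \<and> F p \<in> fst d
     then (let c = chart_at atl p in
       frechet_derivative (snd d \<circ> F \<circ> inv_chart c) (at (snd c p)) (\<xi> c))
     else 0)"

definition velocity ::
  "('a, 'e::euclidean_space) chart set \<Rightarrow> (real \<Rightarrow> 'a) \<Rightarrow> real \<Rightarrow> ('a, 'e) tvec" where
  "velocity atl \<sigma> t = (\<lambda>c. if c \<in> atl \<and> \<sigma> t \<in> fst c
     then vector_derivative (snd c \<circ> \<sigma>) (at t) else 0)"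

definition vector_field ::
  "('a, 'e::euclidean_space) chart set \<Rightarrow> ('a \<Rightarrow> ('a, 'e) tvec) \<Rightarrow> bool" where
  "vector_field atl X \<longleftrightarrow> (\<forall>c\<in>atl. \<forall>p\<in>fst c. X p \<in> tangent_space atl p) \<and>
     (\<forall>c\<in>atl. smooth_in_chart c (\<lambda>p. X p c))"

definition lie_bracket ::
  "('a, 'e::euclidean_space) chart set \<Rightarrow> ('a \<Rightarrow> ('a, 'e) tvec) \<Rightarrow> ('a \<Rightarrow> ('a, 'e) tvec) \<Rightarrow>
   'a \<Rightarrow> ('a, 'e) tvec" where
  "lie_bracket atl X Y p = (\<lambda>c. if c \<in> atl \<and> p \<in> fst c
     then frechet_derivative ((\<lambda>q. Y q c) \<circ> inv_chart c) (at (snd c p)) (X p c)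
        - frechet_derivative ((\<lambda>q. X q c) \<circ> inv_chart c) (at (snd c p)) (Y p c)
     else 0)"

definition ext_deriv ::
  "('a, 'e::euclidean_space) chart set \<Rightarrow> ('a \<Rightarrow> ('a, 'e) tvec \<Rightarrow> real) \<Rightarrow>
   ('a \<Rightarrow> ('a, 'e) tvec) \<Rightarrow> ('a \<Rightarrow> ('a, 'e) tvec) \<Rightarrow> 'a \<Rightarrow> real" where
  "ext_deriv atl \<omega> X Y p =
     dfun atl (\<lambda>q. \<omega> q (Y q)) p (X p) - dfun atl (\<lambda>q. \<omega> q (X q)) p (Y p)
     - \<omega> p (lie_bracket atl X Y p)"


section \<open>The slit tangent bundle and the pullback bundle\<close>

type_synonym ('a, 'e) tpoint = "'a \<times> ('a, 'e) tvec"

text \<open>Tangent vectors of the slit tangent bundle.\<close>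

type_synonym ('a, 'e) ttvec = "(('a, 'e) tpoint, 'e \<times> 'e) tvec"

definition tangent_bundle :: "('a, 'e::euclidean_space) chart set \<Rightarrow> ('a, 'e) tpoint set" where
  "tangent_bundle atl = (SIGMA p:(\<Union>c\<in>atl. fst c). tangent_space atl p)"

definition slit :: "('a, 'e::euclidean_space) chart set \<Rightarrow> ('a, 'e) tpoint set" where
  "slit atl = {u \<in> tangent_bundle atl. snd u \<noteq> 0}"

definition slit_chart ::
  "('a, 'e::euclidean_space) chart set \<Rightarrow> ('a, 'e) chart \<Rightarrow> (('a, 'e) tpoint, 'e \<times> 'e) chart" where
  "slit_chart atl c = ({u \<in> slit atl. fst u \<in> fst c}, \<lambda>u. (snd c (fst u), snd u c))"

definition slit_atlas ::
  "('a, 'e::euclidean_space) chart set \<Rightarrow> (('a, 'e) tpoint, 'e \<times> 'e) chart set" where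
  "slit_atlas atl = slit_chart atl ` atl"

text \<open>The fibre of the pullback bundle over a point \<open>u\<close> of the slit tangent bundle consists of the
  pairs \<open>(u, v)\<close> with \<open>v\<close> tangent to the manifold at the base point \<open>fst u\<close>.  The redundant first
  component is dropped: the fibre is \<open>tangent_space atl (fst u)\<close>.  In all that follows, the values
  of fields, forms and functions outside of \<open>slit atl\<close> are irrelevant.\<close>

definition pi_field ::
  "('a, 'e::euclidean_space) chart set \<Rightarrow> (('a, 'e) tpoint \<Rightarrow> ('a, 'e) tvec) \<Rightarrow> bool" where
  "pi_field atl Y \<longleftrightarrow> (\<forall>u\<in>slit atl. Y u \<in> tangent_space atl (fst u)) \<and>
     (\<forall>c\<in>atl. smooth_in_chart (slit_chart atl c) (\<lambda>u. Y u c))"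

definition pi_one_form ::
  "('a, 'e::euclidean_space) chart set \<Rightarrow> (('a, 'e) tpoint \<Rightarrow> ('a, 'e) tvec \<Rightarrow> real) \<Rightarrow> bool" where
  "pi_one_form atl A \<longleftrightarrow> (\<forall>u\<in>slit atl. linear_on_fibre (tangent_space atl (fst u)) (A u)) \<and>
     (\<forall>c\<in>atl. \<forall>e. smooth_in_chart (slit_chart atl c) (\<lambda>u. A u (coord_vec atl c e (fst u))))"

definition pi_metric ::
  "('a, 'e::euclidean_space) chart set \<Rightarrow>
   (('a, 'e) tpoint \<Rightarrow> ('a, 'e) tvec \<Rightarrow> ('a, 'e) tvec \<Rightarrow> real) \<Rightarrow> bool" where
  "pi_metric atl h \<longleftrightarrow>
     (\<forall>u\<in>slit atl.
        (\<forall>v\<in>tangent_space atl (fst u). linear_on_fibre (tangent_space atl (fst u)) (h u v)) \<and>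
        (\<forall>v\<in>tangent_space atl (fst u). \<forall>w\<in>tangent_space atl (fst u). h u v w = h u w v) \<and>
        (\<forall>v\<in>tangent_space atl (fst u). v \<noteq> 0 \<longrightarrow> h u v v > 0)) \<and>
     (\<forall>c\<in>atl. \<forall>e e'. smooth_in_chart (slit_chart atl c)
        (\<lambda>u. h u (coord_vec atl c e (fst u)) (coord_vec atl c e' (fst u))))"

definition eta :: "('a, 'e) tpoint \<Rightarrow> ('a, 'e) tvec" where
  "eta u = snd u"

definition gam ::
  "('a, 'e::euclidean_space) chart set \<Rightarrow> ('a, 'e) tpoint \<Rightarrow> ('a, 'e) tvec \<Rightarrow> ('a, 'e) ttvec" where
  "gam atl u v = velocity (slit_atlas atl) (\<lambda>t. (fst u, snd u + t *\<^sub>R v)) 0"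

definition rho ::
  "('a, 'e::euclidean_space) chart set \<Rightarrow> ('a, 'e) tpoint \<Rightarrow> ('a, 'e) ttvec \<Rightarrow> ('a, 'e) tvec" where
  "rho atl u \<xi> = tangent_map (slit_atlas atl) atl fst u \<xi>"

definition JJ ::
  "('a, 'e::euclidean_space) chart set \<Rightarrow> ('a, 'e) tpoint \<Rightarrow> ('a, 'e) ttvec \<Rightarrow> ('a, 'e) ttvec" where
  "JJ atl u \<xi> = gam atl u (rho atl u \<xi>)"

definition liouville ::
  "('a, 'e::euclidean_space) chart set \<Rightarrow> ('a, 'e) tpoint \<Rightarrow> ('a, 'e) ttvec" where
  "liouville atl u = gam atl u (eta u)"


section \<open>Finsler structures, the canonical spray and the Barthel connection\<close>

definition finsler_metric ::
  "(('a, 'e::euclidean_space) tpoint \<Rightarrow> real) \<Rightarrow>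
   ('a, 'e) tpoint \<Rightarrow> ('a, 'e) tvec \<Rightarrow> ('a, 'e) tvec \<Rightarrow> real" where
  "finsler_metric L u v w =
     (1/2) * deriv (\<lambda>s. deriv (\<lambda>t. (L (fst u, snd u + s *\<^sub>R v + t *\<^sub>R w))\<^sup>2) 0) 0"

definition finsler_structure ::
  "('a, 'e::euclidean_space) chart set \<Rightarrow> (('a, 'e) tpoint \<Rightarrow> real) \<Rightarrow> bool" where
  "finsler_structure atl L \<longleftrightarrow>
     (\<forall>u\<in>tangent_bundle atl. L u \<ge> 0) \<and>
     (\<forall>u\<in>slit atl. L u > 0) \<and>
     smooth_fun (slit_atlas atl) L \<and>
     (\<forall>u\<in>tangent_bundle atl. \<forall>r>0. L (fst u, r *\<^sub>R snd u) = r * L u) \<and>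
     pi_metric atl (finsler_metric L)"

definition energy :: "(('a, 'e) tpoint \<Rightarrow> real) \<Rightarrow> ('a, 'e) tpoint \<Rightarrow> real" where
  "energy L u = (1/2) * (L u)\<^sup>2"

definition dJ_energy ::
  "('a, 'e::euclidean_space) chart set \<Rightarrow> (('a, 'e) tpoint \<Rightarrow> real) \<Rightarrow>
   ('a, 'e) tpoint \<Rightarrow> ('a, 'e) ttvec \<Rightarrow> real" where
  "dJ_energy atl L u \<xi> = dfun (slit_atlas atl) (energy L) u (JJ atl u \<xi>)"

definition canonical_spray ::
  "('a, 'e::euclidean_space) chart set \<Rightarrow> (('a, 'e) tpoint \<Rightarrow> real) \<Rightarrow>
   (('a, 'e) tpoint \<Rightarrow> ('a, 'e) ttvec) \<Rightarrow> bool" where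
  "canonical_spray atl L G \<longleftrightarrow> vector_field (slit_atlas atl) G \<and>
     (\<forall>X. vector_field (slit_atlas atl) X \<longrightarrow>
        (\<forall>u\<in>slit atl. ext_deriv (slit_atlas atl) (dJ_energy atl L) G X u
           = - dfun (slit_atlas atl) (energy L) u (X u)))"

text \<open>\<open>G\<close> is meant to be the canonical spray.\<close>

definition barthel ::
  "('a, 'e::euclidean_space) chart set \<Rightarrow> (('a, 'e) tpoint \<Rightarrow> ('a, 'e) ttvec) \<Rightarrow>
   (('a, 'e) tpoint \<Rightarrow> ('a, 'e) ttvec) \<Rightarrow> ('a, 'e) tpoint \<Rightarrow> ('a, 'e) ttvec" where
  "barthel atl G X u =
     lie_bracket (slit_atlas atl) (\<lambda>w. JJ atl w (X w)) G u
     - JJ atl u (lie_bracket (slit_atlas atl) X G u)"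


section \<open>Linear connections on the pullback bundle\<close>

text \<open>\<open>D u \<xi> Y\<close> is the covariant derivative of the section \<open>Y\<close> at \<open>u\<close> in the direction of the tangent
  vector \<open>\<xi>\<close> at \<open>u\<close>; thus tensoriality in the direction is built into the type, and the field
  \<open>D\<^sub>X Y\<close> is \<open>\<lambda>u. D u (X u) Y\<close>.  The last clause says that \<open>DY\<close> is a smooth one-form with values in
  the pullback bundle.  Since the Leibniz rule covers functions that are \<open>1\<close> on \<open>slit atl\<close> and \<open>0\<close>
  elsewhere, \<open>D u \<xi> Y\<close> depends on \<open>Y\<close> through its restriction to \<open>slit atl\<close> only.\<close>

type_synonym ('a, 'e) pi_conn =
  "('a, 'e) tpoint \<Rightarrow> ('a, 'e) ttvec \<Rightarrow> (('a, 'e) tpoint \<Rightarrow> ('a, 'e) tvec) \<Rightarrow> ('a, 'e) tvec"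

definition linear_connection ::
  "('a, 'e::euclidean_space) chart set \<Rightarrow> ('a, 'e) pi_conn \<Rightarrow> bool" where
  "linear_connection atl D \<longleftrightarrow>
     (\<forall>Y. pi_field atl Y \<longrightarrow> (\<forall>u\<in>slit atl.
        (\<forall>\<xi>\<in>tangent_space (slit_atlas atl) u. D u \<xi> Y \<in> tangent_space atl (fst u)) \<and>
        linear_on_fibre (tangent_space (slit_atlas atl) u) (\<lambda>\<xi>. D u \<xi> Y))) \<and>
     (\<forall>Y Z. pi_field atl Y \<and> pi_field atl Z \<longrightarrow>
        (\<forall>u\<in>slit atl. \<forall>\<xi>\<in>tangent_space (slit_atlas atl) u.
           D u \<xi> (\<lambda>w. Y w + Z w) = D u \<xi> Y + D u \<xi> Z)) \<and>
     (\<forall>f Y. smooth_fun (slit_atlas atl) f \<and> pi_field atl Y \<longrightarrow>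
        (\<forall>u\<in>slit atl. \<forall>\<xi>\<in>tangent_space (slit_atlas atl) u.
           D u \<xi> (\<lambda>w. f w *\<^sub>R Y w) = dfun (slit_atlas atl) f u \<xi> *\<^sub>R Y u + f u *\<^sub>R D u \<xi> Y)) \<and>
     (\<forall>Y. pi_field atl Y \<longrightarrow> (\<forall>c\<in>atl. \<forall>e. smooth_in_chart (slit_chart atl c)
        (\<lambda>u. D u (coord_vec (slit_atlas atl) (slit_chart atl c) e u) Y c)))"

definition connection_map ::
  "('a, 'e) pi_conn \<Rightarrow> ('a, 'e) tpoint \<Rightarrow> ('a, 'e) ttvec \<Rightarrow> ('a, 'e) tvec" where
  "connection_map D u \<xi> = D u \<xi> eta"

definition hor_space ::
  "('a, 'e::euclidean_space) chart set \<Rightarrow> ('a, 'e) pi_conn \<Rightarrow> ('a, 'e) tpoint \<Rightarrow> ('a, 'e) ttvec set" where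
  "hor_space atl D u = {\<xi> \<in> tangent_space (slit_atlas atl) u. connection_map D u \<xi> = 0}"

definition ver_space ::
  "('a, 'e::euclidean_space) chart set \<Rightarrow> ('a, 'e) tpoint \<Rightarrow> ('a, 'e) ttvec set" where
  "ver_space atl u = {\<xi> \<in> tangent_space (slit_atlas atl) u. rho atl u \<xi> = 0}"

definition regular_connection ::
  "('a, 'e::euclidean_space) chart set \<Rightarrow> ('a, 'e) pi_conn \<Rightarrow> bool" where
  "regular_connection atl D \<longleftrightarrow> linear_connection atl D \<and>
     (\<forall>u\<in>slit atl. ver_space atl u \<inter> hor_space atl D u = {0} \<and>
        tangent_space (slit_atlas atl) u = {v + h |v h. v \<in> ver_space atl u \<and> h \<in> hor_space atl D u})"

definition hor_map ::
  "('a, 'e::euclidean_space) chart set \<Rightarrow> ('a, 'e) pi_conn \<Rightarrow>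
   ('a, 'e) tpoint \<Rightarrow> ('a, 'e) tvec \<Rightarrow> ('a, 'e) ttvec" where
  "hor_map atl D u = inv_into (hor_space atl D u) (rho atl u)"

definition torsion ::
  "('a, 'e::euclidean_space) chart set \<Rightarrow> ('a, 'e) pi_conn \<Rightarrow>
   (('a, 'e) tpoint \<Rightarrow> ('a, 'e) ttvec) \<Rightarrow> (('a, 'e) tpoint \<Rightarrow> ('a, 'e) ttvec) \<Rightarrow>
   ('a, 'e) tpoint \<Rightarrow> ('a, 'e) tvec" where
  "torsion atl D X Y u =
     D u (X u) (\<lambda>w. rho atl w (Y w)) - D u (Y u) (\<lambda>w. rho atl w (X w))
     - rho atl u (lie_bracket (slit_atlas atl) X Y u)"

definition h_torsion ::
  "('a, 'e::euclidean_space) chart set \<Rightarrow> ('a, 'e) pi_conn \<Rightarrow>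
   (('a, 'e) tpoint \<Rightarrow> ('a, 'e) tvec) \<Rightarrow> (('a, 'e) tpoint \<Rightarrow> ('a, 'e) tvec) \<Rightarrow>
   ('a, 'e) tpoint \<Rightarrow> ('a, 'e) tvec" where
  "h_torsion atl D X Y =
     torsion atl D (\<lambda>w. hor_map atl D w (X w)) (\<lambda>w. hor_map atl D w (Y w))"

definition hv_torsion ::
  "('a, 'e::euclidean_space) chart set \<Rightarrow> ('a, 'e) pi_conn \<Rightarrow>
   (('a, 'e) tpoint \<Rightarrow> ('a, 'e) tvec) \<Rightarrow> (('a, 'e) tpoint \<Rightarrow> ('a, 'e) tvec) \<Rightarrow>
   ('a, 'e) tpoint \<Rightarrow> ('a, 'e) tvec" where
  "hv_torsion atl D X Y =
     torsion atl D (\<lambda>w. gam atl w (X w)) (\<lambda>w. hor_map atl D w (Y w))"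

text \<open>\<open>(D\<^sub>\<xi> h)(Y, Z)\<close> for a metric \<open>h\<close>.\<close>

definition cov_metric ::
  "('a, 'e::euclidean_space) chart set \<Rightarrow> ('a, 'e) pi_conn \<Rightarrow>
   (('a, 'e) tpoint \<Rightarrow> ('a, 'e) tvec \<Rightarrow> ('a, 'e) tvec \<Rightarrow> real) \<Rightarrow>
   ('a, 'e) tpoint \<Rightarrow> ('a, 'e) ttvec \<Rightarrow>
   (('a, 'e) tpoint \<Rightarrow> ('a, 'e) tvec) \<Rightarrow> (('a, 'e) tpoint \<Rightarrow> ('a, 'e) tvec) \<Rightarrow> real" where
  "cov_metric atl D h u \<xi> Y Z =
     dfun (slit_atlas atl) (\<lambda>w. h w (Y w) (Z w)) u \<xi> - h u (D u \<xi> Y) (Z u) - h u (Y u) (D u \<xi> Z)"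

definition associated_spray ::
  "('a, 'e::euclidean_space) chart set \<Rightarrow> ('a, 'e) pi_conn \<Rightarrow> ('a, 'e) tpoint \<Rightarrow> ('a, 'e) ttvec" where
  "associated_spray atl D u = hor_map atl D u (eta u)"

definition associated_nonlinear_connection ::
  "('a, 'e::euclidean_space) chart set \<Rightarrow> ('a, 'e) pi_conn \<Rightarrow>
   (('a, 'e) tpoint \<Rightarrow> ('a, 'e) ttvec) \<Rightarrow> ('a, 'e) tpoint \<Rightarrow> ('a, 'e) ttvec" where
  "associated_nonlinear_connection atl D X u = 2 *\<^sub>R hor_map atl D u (rho atl u (X u)) - X u"

definition hv_torsion_symmetric ::
  "('a, 'e::euclidean_space) chart set \<Rightarrow> (('a, 'e) tpoint \<Rightarrow> real) \<Rightarrow> ('a, 'e) pi_conn \<Rightarrow> bool" where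
  "hv_torsion_symmetric atl L D \<longleftrightarrow>
     (\<forall>X Y Z. pi_field atl X \<and> pi_field atl Y \<and> pi_field atl Z \<longrightarrow>
        (\<forall>u\<in>slit atl. finsler_metric L u (hv_torsion atl D X Y u) (Z u)
           = finsler_metric L u (hv_torsion atl D X Z u) (Y u)))"

definition cartan_connection ::
  "('a, 'e::euclidean_space) chart set \<Rightarrow> (('a, 'e) tpoint \<Rightarrow> real) \<Rightarrow> ('a, 'e) pi_conn \<Rightarrow> bool" where
  "cartan_connection atl L D \<longleftrightarrow> regular_connection atl D \<and>
     (\<forall>X Y Z. vector_field (slit_atlas atl) X \<and> pi_field atl Y \<and> pi_field atl Z \<longrightarrow>
        (\<forall>u\<in>slit atl. cov_metric atl D (finsler_metric L) u (X u) Y Z = 0)) \<and>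
     (\<forall>X Y. pi_field atl X \<and> pi_field atl Y \<longrightarrow> (\<forall>u\<in>slit atl. h_torsion atl D X Y u = 0)) \<and>
     hv_torsion_symmetric atl L D"

definition hrf_connection ::
  "('a, 'e::euclidean_space) chart set \<Rightarrow> (('a, 'e) tpoint \<Rightarrow> real) \<Rightarrow>
   (('a, 'e) tpoint \<Rightarrow> ('a, 'e) tvec \<Rightarrow> real) \<Rightarrow> ('a, 'e) pi_conn \<Rightarrow> bool" where
  "hrf_connection atl L A D \<longleftrightarrow> regular_connection atl D \<and>
     (\<forall>X Y Z. pi_field atl X \<and> pi_field atl Y \<and> pi_field atl Z \<longrightarrow>
        (\<forall>u\<in>slit atl. cov_metric atl D (finsler_metric L) u (hor_map atl D u (X u)) Y Z
           = A u (X u) * finsler_metric L u (Y u) (Z u))) \<and>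
     (\<forall>X Y Z. pi_field atl X \<and> pi_field atl Y \<and> pi_field atl Z \<longrightarrow>
        (\<forall>u\<in>slit atl. cov_metric atl D (finsler_metric L) u (gam atl u (X u)) Y Z = 0)) \<and>
     (\<forall>X Y. pi_field atl X \<and> pi_field atl Y \<longrightarrow> (\<forall>u\<in>slit atl. h_torsion atl D X Y u = 0)) \<and>
     hv_torsion_symmetric atl L D"

end

(*
  Over a chart, a linear connection is given by its Christoffel symbols (cutoff functions make it local),
  and the horizontal lift of v is (v, - N v), where N solves a linear system that regularity makes
  invertible. Vanishing (h)h-torsion says that the horizontal symbols S are symmetric, K(beta v) = 0 says
  S(v, y) = N v, and recurrence of g is the metric equation for S; Koszul's trick then determines S.
  Contracting with y kills the vertical derivatives of g (Euler) and yields N, hence both the spray and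
  the nonlinear connection, in terms of the energy E, of A and of the vertical derivative of g in the
  direction of the spray. The canonical spray (y, G2) satisfies g(G2, w) = d_w E - d_y (d'_w E), with d
  and d' the derivatives in base and fibre directions; differentiating this along the fibre gives the
  Barthel connection (v1, v2) -> (v1, d'_{v1} G2 - v2). Comparing the two, the only term left besides
  those in A is the vertical derivative of g along a, which is twice the (h)hv-torsion T(a, .) lowered by g.
*)

theory Submission
  imports Defs
begin

section \<open>Smooth maps\<close>

text \<open>The obstacle is regularity. A horizontal lift is chosen by \<open>inv_into\<close>,
  pointwise, yet the (h)h-torsion contains the Lie bracket of two lifts, and
  \<open>frechet_derivative\<close> carries no information where no derivative exists. So lifts are
  first shown to be differentiable; after that all derivatives of fields cancel in the torsion and
  only Christoffel symbols remain. A second obstacle is that connections act on fields over the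
  whole slit bundle. A local frame can be made global because, M being Hausdorff, a compact set
  inside a chart is closed in M. In the contracted Koszul formula N y still stands on the right-hand
  side of the equation for N v. Contracting once more removes it, so the spray is found first and
  then substituted. Constants: g(y, y) = 2E = L^2, and Koszul's formula computes 2N, so a enters the
  spray with the factor E = L^2/2. Substituting the spray back produces E times the vertical
  derivative of g along a. As the lowered torsion is half of that derivative, the torsion gets the
  factor 2E = L^2.\<close>

abbreviation dir_deriv :: "('e::euclidean_space \<Rightarrow> 'f::real_normed_vector) \<Rightarrow> 'e \<Rightarrow> 'e \<Rightarrow> 'f" where
  "dir_deriv f x v \<equiv> frechet_derivative f (at x) v"

lemma dir_deriv_eqI: "(f has_derivative f') (at x) \<Longrightarrow> dir_deriv f x = f'"
  by (rule frechet_derivative_at[symmetric])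

lemma has_dir_deriv: "f differentiable (at x) \<Longrightarrow> (f has_derivative dir_deriv f x) (at x)"
  by (simp add: frechet_derivative_works)

lemma linear_dir_deriv: "f differentiable (at x) \<Longrightarrow> linear (dir_deriv f x)"
  by (simp add: linear_frechet_derivative)

text \<open>\<open>frechet_derivative\<close> picks some map that satisfies
  \<open>has_derivative\<close>, and the same maps qualify for f and for g. Hence no
  differentiability is assumed, and the rule also applies to functions not yet known to be
  differentiable.\<close>

lemma dir_deriv_cong:
  assumes "open S" "x \<in> S" "\<And>y. y \<in> S \<Longrightarrow> f y = g y"
  shows "dir_deriv f x v = dir_deriv g x v"
proof -
  have "(f has_derivative F) (at x) \<longleftrightarrow> (g has_derivative F) (at x)" for F
    using assms has_derivative_transform_within_open[of f F x UNIV S g]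
      has_derivative_transform_within_open[of g F x UNIV S f] by auto
  then show ?thesis
    by (simp add: frechet_derivative_def)
qed

lemma differentiable_cong_open:
  assumes "open S" "x \<in> S" "\<And>y. y \<in> S \<Longrightarrow> f y = g y" "f differentiable (at x)"
  shows "g differentiable (at x)"
  using assms has_derivative_transform_within_open[of f _ x UNIV S g]
  unfolding differentiable_def by blast

lemma linear_eq_sum_Basis:
  fixes f :: "'e::euclidean_space \<Rightarrow> 'f::real_vector"
  assumes "linear f"
  shows "f x = (\<Sum>b\<in>Basis. (x \<bullet> b) *\<^sub>R f b)"
proof -
  have "f x = f (\<Sum>b\<in>Basis. (x \<bullet> b) *\<^sub>R b)" by (simp add: euclidean_representation)
  also have "\<dots> = (\<Sum>b\<in>Basis. (x \<bullet> b) *\<^sub>R f b)"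
    using assms by (simp add: linear_sum linear_cmul)
  finally show ?thesis .
qed

lemma k_smooth_on_cong:
  assumes "open S" "\<And>x. x \<in> S \<Longrightarrow> f x = g x" "k_smooth_on k S f"
  shows "k_smooth_on k S g"
  using assms(2,3)
proof (induction k arbitrary: f g)
  case 0
  then show ?case using continuous_on_cong[of S S f g] by simp
next
  case (Suc k)
  have "dir_deriv f x e = dir_deriv g x e" if "x \<in> S" for x e
    by (rule dir_deriv_cong[OF assms(1) that Suc.prems(1)])
  then have "k_smooth_on k S (\<lambda>x. dir_deriv g x e)" for e
    using Suc.prems(2) by (rule_tac Suc.IH[of "\<lambda>x. dir_deriv f x e"]) simp_all
  moreover have "g differentiable (at x)" if "x \<in> S" for x
    using differentiable_cong_open[OF assms(1) that, of f g] Suc.prems that by simp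
  ultimately show ?case by simp
qed

lemma k_smooth_on_subset: "k_smooth_on k T f \<Longrightarrow> S \<subseteq> T \<Longrightarrow> k_smooth_on k S f"
  by (induction k arbitrary: f) (auto intro: continuous_on_subset)

lemma k_smooth_on_Suc_imp: "k_smooth_on (Suc k) S f \<Longrightarrow> k_smooth_on k S f"
proof (induction k arbitrary: f)
  case 0
  then show ?case
    by (auto intro!: continuous_at_imp_continuous_on differentiable_imp_continuous_within)
next
  case (Suc k)
  then show ?case by (metis k_smooth_on.simps(2))
qed

lemma k_smooth_on_local:
  assumes "\<And>x. x \<in> S \<Longrightarrow> \<exists>T. open T \<and> x \<in> T \<and> k_smooth_on k T f"
  shows "k_smooth_on k S f"
  using assms
proof (induction k arbitrary: f)
  case 0
  have "isCont f x" if "x \<in> S" for x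
    using 0[OF that] continuous_on_eq_continuous_at by auto
  then show ?case
    by (auto intro: continuous_at_imp_continuous_on)
next
  case (Suc k)
  have "k_smooth_on k S (\<lambda>x. dir_deriv f x e)" for e
    by (rule Suc.IH) (use Suc.prems in fastforce)
  moreover have "f differentiable (at x)" if "x \<in> S" for x
    using Suc.prems[OF that] by auto
  ultimately show ?case by simp
qed

lemma k_smooth_on_const: "k_smooth_on k S (\<lambda>x. c)"
  by (induction k arbitrary: c) auto

lemma k_smooth_on_bounded_linear: "bounded_linear f \<Longrightarrow> k_smooth_on k S f"
proof (cases k)
  case (Suc j)
  assume f: "bounded_linear f"
  then have "dir_deriv f x = f" for x
    by (intro dir_deriv_eqI bounded_linear_imp_has_derivative)
  then show ?thesis using f
    by (simp add: Suc k_smooth_on_const bounded_linear_imp_differentiable)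
qed (simp add: linear_continuous_on)

lemma k_smooth_on_add:
  "k_smooth_on k S f \<Longrightarrow> k_smooth_on k S g \<Longrightarrow> open S \<Longrightarrow> k_smooth_on k S (\<lambda>x. f x + g x)"
proof (induction k arbitrary: f g)
  case 0 then show ?case by (simp add: continuous_on_add)
next
  case (Suc k)
  have D: "dir_deriv (\<lambda>x. f x + g x) x = (\<lambda>e. dir_deriv f x e + dir_deriv g x e)" if "x \<in> S" for x
    using Suc.prems that by (intro dir_deriv_eqI has_derivative_add has_dir_deriv) auto
  have "k_smooth_on k S (\<lambda>x. dir_deriv (\<lambda>x. f x + g x) x e)" for e
    by (rule k_smooth_on_cong[of _ "\<lambda>x. dir_deriv f x e + dir_deriv g x e"])
      (use Suc D in auto)
  then show ?case using Suc.prems by (simp add: differentiable_add)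
qed

text \<open>Each term of the product rule keeps one factor undifferentiated;
  \<open>k_smooth_on_Suc_imp\<close> lowers its order so that the induction hypothesis fits.\<close>

lemma k_smooth_on_bilinear:
  assumes h: "bounded_bilinear h"
  shows "k_smooth_on k S f \<Longrightarrow> k_smooth_on k S g \<Longrightarrow> open S \<Longrightarrow> k_smooth_on k S (\<lambda>x. h (f x) (g x))"
proof (induction k arbitrary: f g)
  case 0 then show ?case by (simp add: bounded_bilinear.continuous_on[OF h])
next
  case (Suc k)
  have H: "((\<lambda>x. h (f x) (g x)) has_derivative
      (\<lambda>e. h (f x) (dir_deriv g x e) + h (dir_deriv f x e) (g x))) (at x)" if "x \<in> S" for x
    using Suc.prems that by (intro bounded_bilinear.FDERIV[OF h] has_dir_deriv) auto
  have "k_smooth_on k S (\<lambda>x. dir_deriv (\<lambda>x. h (f x) (g x)) x e)" for e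
    by (rule k_smooth_on_cong[of _ "\<lambda>x. h (f x) (dir_deriv g x e) + h (dir_deriv f x e) (g x)"])
      (use Suc.IH[OF k_smooth_on_Suc_imp] Suc.IH[OF _ k_smooth_on_Suc_imp] Suc.prems
        dir_deriv_eqI[OF H] in \<open>auto intro!: k_smooth_on_add\<close>)
  moreover have "(\<lambda>x. h (f x) (g x)) differentiable (at x)" if "x \<in> S" for x
    using H[OF that] by (rule differentiableI)
  ultimately show ?case by simp
qed

lemma k_smooth_on_compose_linear:
  assumes h: "bounded_linear h"
  shows "k_smooth_on k S f \<Longrightarrow> open S \<Longrightarrow> k_smooth_on k S (\<lambda>x. h (f x))"
proof (induction k arbitrary: f)
  case 0 then show ?case by (simp add: bounded_linear.continuous_on[OF h])
next
  case (Suc k)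
  have H: "((\<lambda>x. h (f x)) has_derivative (\<lambda>e. h (dir_deriv f x e))) (at x)" if "x \<in> S" for x
    using Suc.prems that by (intro bounded_linear.has_derivative[OF h] has_dir_deriv) auto
  have "k_smooth_on k S (\<lambda>x. dir_deriv (\<lambda>x. h (f x)) x e)" for e
    by (rule k_smooth_on_cong[of _ "\<lambda>x. h (dir_deriv f x e)"])
      (use Suc dir_deriv_eqI[OF H] in auto)
  moreover have "(\<lambda>x. h (f x)) differentiable (at x)" if "x \<in> S" for x
    using H[OF that] by (rule differentiableI)
  ultimately show ?case by simp
qed

lemma k_smooth_on_sum:
  "(\<And>i. i \<in> I \<Longrightarrow> k_smooth_on k S (f i)) \<Longrightarrow> open S \<Longrightarrow> k_smooth_on k S (\<lambda>x. \<Sum>i\<in>I. f i x)"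
  by (induction I rule: infinite_finite_induct) (auto simp: k_smooth_on_const k_smooth_on_add)

text \<open>\<open>k_smooth_on\<close> controls derivatives in fixed directions only, whereas the
  chain rule differentiates g in the moving direction \<open>dir_deriv f x e\<close>. Expanding that
  direction in a basis leaves fixed directions, to which the induction hypothesis applies.\<close>

lemma k_smooth_on_compose:
  fixes f :: "'e::euclidean_space \<Rightarrow> 'f::euclidean_space"
  assumes "open S" "open T" "f ` S \<subseteq> T"
  shows "k_smooth_on k S f \<Longrightarrow> k_smooth_on k T g \<Longrightarrow> k_smooth_on k S (\<lambda>x. g (f x))"
proof (induction k arbitrary: g)
  case 0 then show ?case
    using assms by (auto intro: continuous_on_compose2)
next
  case (Suc k)
  have H: "((\<lambda>x. g (f x)) has_derivative (\<lambda>e. dir_deriv g (f x) (dir_deriv f x e))) (at x)"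
    if "x \<in> S" for x
    by (rule has_derivative_compose[OF has_dir_deriv has_dir_deriv])
      (use Suc.prems that assms in auto)
  have D: "dir_deriv (\<lambda>x. g (f x)) x e
      = (\<Sum>b\<in>Basis. (dir_deriv f x e \<bullet> b) *\<^sub>R dir_deriv g (f x) b)" if "x \<in> S" for x e
    unfolding dir_deriv_eqI[OF H[OF that]]
    using Suc.prems that assms by (intro linear_eq_sum_Basis linear_dir_deriv) auto
  have "k_smooth_on k S (\<lambda>x. dir_deriv (\<lambda>x. g (f x)) x e)" for e
  proof (rule k_smooth_on_cong[OF assms(1)])
    show "k_smooth_on k S (\<lambda>x. \<Sum>b\<in>Basis. (dir_deriv f x e \<bullet> b) *\<^sub>R dir_deriv g (f x) b)"
    proof (intro k_smooth_on_sum k_smooth_on_bilinear[OF bounded_bilinear_scaleR]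
          k_smooth_on_bilinear[OF bounded_bilinear_inner] k_smooth_on_const assms(1))
      show "k_smooth_on k S (\<lambda>x. dir_deriv g (f x) b)" for b
        using Suc.prems(2) by (intro Suc.IH[OF k_smooth_on_Suc_imp[OF Suc.prems(1)]]) simp
      show "k_smooth_on k S (\<lambda>x. dir_deriv f x e)"
        using Suc.prems(1) by simp
    qed
  qed (simp add: D)
  moreover have "(\<lambda>x. g (f x)) differentiable (at x)" if "x \<in> S" for x
    using H[OF that] by (rule differentiableI)
  ultimately show ?case by simp
qed

lemma smooth_on_cong:
  "open S \<Longrightarrow> (\<And>x. x \<in> S \<Longrightarrow> f x = g x) \<Longrightarrow> smooth_on S f \<Longrightarrow> smooth_on S g"
  using k_smooth_on_cong unfolding smooth_on_def by blast

lemma smooth_on_subset: "smooth_on T f \<Longrightarrow> S \<subseteq> T \<Longrightarrow> smooth_on S f"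
  using k_smooth_on_subset unfolding smooth_on_def by blast

lemma smooth_on_local:
  "(\<And>x. x \<in> S \<Longrightarrow> \<exists>T. open T \<and> x \<in> T \<and> smooth_on T f) \<Longrightarrow> smooth_on S f"
  unfolding smooth_on_def by (intro allI k_smooth_on_local) meson

lemma smooth_on_const: "smooth_on S (\<lambda>x. c)"
  by (simp add: smooth_on_def k_smooth_on_const)

lemma smooth_on_bounded_linear: "bounded_linear f \<Longrightarrow> smooth_on S f"
  by (simp add: smooth_on_def k_smooth_on_bounded_linear)

lemma smooth_on_compose_linear:
  "bounded_linear h \<Longrightarrow> smooth_on S f \<Longrightarrow> open S \<Longrightarrow> smooth_on S (\<lambda>x. h (f x))"
  by (simp add: smooth_on_def k_smooth_on_compose_linear)

lemma smooth_on_add: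
  "smooth_on S f \<Longrightarrow> smooth_on S g \<Longrightarrow> open S \<Longrightarrow> smooth_on S (\<lambda>x. f x + g x)"
  by (simp add: smooth_on_def k_smooth_on_add)

lemma smooth_on_sum:
  "(\<And>i. i \<in> I \<Longrightarrow> smooth_on S (f i)) \<Longrightarrow> open S \<Longrightarrow> smooth_on S (\<lambda>x. \<Sum>i\<in>I. f i x)"
  by (simp add: smooth_on_def k_smooth_on_sum)

lemma smooth_on_bilinear:
  "bounded_bilinear h \<Longrightarrow> smooth_on S f \<Longrightarrow> smooth_on S g \<Longrightarrow> open S \<Longrightarrow>
     smooth_on S (\<lambda>x. h (f x) (g x))"
  by (simp add: smooth_on_def k_smooth_on_bilinear)

lemma smooth_on_compose:
  fixes f :: "'e::euclidean_space \<Rightarrow> 'f::euclidean_space"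
  shows "smooth_on S f \<Longrightarrow> smooth_on T g \<Longrightarrow> open S \<Longrightarrow> open T \<Longrightarrow> f ` S \<subseteq> T \<Longrightarrow>
     smooth_on S (\<lambda>x. g (f x))"
  unfolding smooth_on_def
  by (rule allI, rule k_smooth_on_compose[of S T f]) auto

lemma smooth_on_Pair:
  assumes "smooth_on S f" "smooth_on S g" "open S"
  shows "smooth_on S (\<lambda>x. (f x, g x))"
proof -
  have "smooth_on S (\<lambda>x. (f x, 0) + (0, g x))"
    using assms by (intro smooth_on_add smooth_on_compose_linear[of "\<lambda>a. (a, 0)"]
        smooth_on_compose_linear[of "\<lambda>a. (0, a)"])
      (auto intro!: bounded_linear_Pair bounded_linear_ident bounded_linear_zero)
  then show ?thesis by simp
qed

lemma smooth_on_fst: "smooth_on S f \<Longrightarrow> open S \<Longrightarrow> smooth_on S (\<lambda>x. fst (f x))"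
  by (rule smooth_on_compose_linear[OF bounded_linear_fst])

lemma smooth_on_imp_differentiable: "smooth_on S f \<Longrightarrow> x \<in> S \<Longrightarrow> f differentiable (at x)"
  unfolding smooth_on_def by (metis k_smooth_on.simps(2))

lemma smooth_on_imp_continuous: "smooth_on S f \<Longrightarrow> continuous_on S f"
  unfolding smooth_on_def by (metis k_smooth_on.simps(1))

lemma smooth_on_dir_deriv: "smooth_on S f \<Longrightarrow> smooth_on S (\<lambda>x. dir_deriv f x v)"
  unfolding smooth_on_def by (metis k_smooth_on.simps(2))

subsection \<open>Symmetry of second derivatives\<close>

lemma mean_value_along:
  fixes f :: "'e::euclidean_space \<Rightarrow> real"
  assumes "t > 0" "\<And>s. 0 \<le> s \<Longrightarrow> s \<le> t \<Longrightarrow> f differentiable (at (p + s *\<^sub>R v))"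
  obtains s where "0 < s" "s < t" "f (p + t *\<^sub>R v) - f p = t * dir_deriv f (p + s *\<^sub>R v) v"
proof -
  have "((\<lambda>s. f (p + s *\<^sub>R v)) has_derivative (\<lambda>r. dir_deriv f (p + s *\<^sub>R v) (r *\<^sub>R v))) (at s)"
    if "0 \<le> s" "s \<le> t" for s
    by (rule has_derivative_compose[of "\<lambda>s. p + s *\<^sub>R v" "\<lambda>r. r *\<^sub>R v" s UNIV f, OF _ has_dir_deriv[OF assms(2)[OF that]]])
      (auto intro!: derivative_eq_intros)
  moreover have "(\<lambda>r. dir_deriv f (p + s *\<^sub>R v) (r *\<^sub>R v)) = (*) (dir_deriv f (p + s *\<^sub>R v) v)"
    if "0 \<le> s" "s \<le> t" for s
    by (rule ext) (simp add: linear_cmul[OF linear_dir_deriv[OF assms(2)[OF that]]])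
  ultimately have "((\<lambda>s. f (p + s *\<^sub>R v)) has_real_derivative dir_deriv f (p + s *\<^sub>R v) v) (at s)"
    if "0 \<le> s" "s \<le> t" for s
    using that unfolding has_field_derivative_def by metis
  from MVT2[OF assms(1) this] show ?thesis
    using that by auto
qed

text \<open>The mean value theorem is applied along v to the map sending z to f (z + t w) - f z, and
  then along w to the derivative of f in direction v. The second difference itself does not change
  when v and w are swapped.\<close>

lemma second_difference:
  fixes f :: "'e::euclidean_space \<Rightarrow> real"
  assumes f: "smooth_on S f"
    and t: "t > 0" "\<And>r s. 0 \<le> r \<Longrightarrow> r \<le> t \<Longrightarrow> 0 \<le> s \<Longrightarrow> s \<le> t \<Longrightarrow> x + r *\<^sub>R v + s *\<^sub>R w \<in> S"
  obtains r s where "0 < r" "r < t" "0 < s" "s < t"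
    "f (x + t *\<^sub>R v + t *\<^sub>R w) - f (x + t *\<^sub>R v) - f (x + t *\<^sub>R w) + f x
      = t * t * dir_deriv (\<lambda>z. dir_deriv f z v) (x + r *\<^sub>R v + s *\<^sub>R w) w"
proof -
  let ?h = "\<lambda>z. f (z + t *\<^sub>R w) - f z"
  have df: "f differentiable (at (x + r *\<^sub>R v + s *\<^sub>R w))"
    if "0 \<le> r" "r \<le> t" "0 \<le> s" "s \<le> t" for r s
    using smooth_on_imp_differentiable[OF f t(2)[OF that]] .
  have H: "(?h has_derivative (\<lambda>e. dir_deriv f (x + r *\<^sub>R v + t *\<^sub>R w) e - dir_deriv f (x + r *\<^sub>R v) e))
      (at (x + r *\<^sub>R v))" if "0 \<le> r" "r \<le> t" for r
  proof (rule has_derivative_diff)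
    have "((\<lambda>z. z + t *\<^sub>R w) has_derivative (\<lambda>e. e)) (at (x + r *\<^sub>R v))"
      by (auto intro!: derivative_eq_intros)
    then show "((\<lambda>z. f (z + t *\<^sub>R w)) has_derivative dir_deriv f (x + r *\<^sub>R v + t *\<^sub>R w))
        (at (x + r *\<^sub>R v))"
      by (rule has_derivative_compose[OF _ has_dir_deriv]) (use df[OF that, of t] t(1) in simp)
    show "(f has_derivative dir_deriv f (x + r *\<^sub>R v)) (at (x + r *\<^sub>R v))"
      by (rule has_dir_deriv) (use df[OF that, of 0] t(1) in simp)
  qed
  have h: "?h differentiable (at (x + r *\<^sub>R v))" if "0 \<le> r" "r \<le> t" for r
    using H[OF that] by (rule differentiableI)
  obtain r where r: "0 < r" "r < t" "?h (x + t *\<^sub>R v) - ?h x = t * dir_deriv ?h (x + r *\<^sub>R v) v"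
    by (rule mean_value_along[of t ?h x v, OF t(1) h])
  obtain s where s: "0 < s" "s < t"
    "dir_deriv f (x + r *\<^sub>R v + t *\<^sub>R w) v - dir_deriv f (x + r *\<^sub>R v) v
      = t * dir_deriv (\<lambda>z. dir_deriv f z v) (x + r *\<^sub>R v + s *\<^sub>R w) w"
    by (rule mean_value_along[of t "\<lambda>z. dir_deriv f z v" "x + r *\<^sub>R v" w, OF t(1)
          smooth_on_imp_differentiable[OF smooth_on_dir_deriv[OF f] t(2)]]) (use r in auto)
  show ?thesis
    using that[OF r(1,2) s(1,2)] r s dir_deriv_eqI[OF H, of r] by (simp add: algebra_simps)
qed

text \<open>Evaluating one second difference in both orders shows that one mixed derivative at some
  point near x equals the other one at another point near x. If the values at x differed, continuity
  would keep the two apart.\<close>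

lemma dir_deriv_commute_real:
  fixes f :: "'e::euclidean_space \<Rightarrow> real"
  assumes f: "smooth_on S f" and S: "open S" "x \<in> S"
  shows "dir_deriv (\<lambda>z. dir_deriv f z v) x w = dir_deriv (\<lambda>z. dir_deriv f z w) x v"
proof (rule ccontr)
  let ?A = "\<lambda>z. dir_deriv (\<lambda>z. dir_deriv f z v) z w" and ?B = "\<lambda>z. dir_deriv (\<lambda>z. dir_deriv f z w) z v"
  assume neq: "?A x \<noteq> ?B x"
  define e where "e = \<bar>?A x - ?B x\<bar> / 2"
  have e: "e > 0" using neq by (simp add: e_def)
  have "isCont ?A x" "isCont ?B x"
    using smooth_on_imp_continuous[OF smooth_on_dir_deriv[OF smooth_on_dir_deriv[OF f]]] S
      continuous_on_eq_continuous_at by blast+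
  then obtain d1 d2 where d: "d1 > 0" "\<And>z. dist z x < d1 \<Longrightarrow> dist (?A z) (?A x) < e"
      "d2 > 0" "\<And>z. dist z x < d2 \<Longrightarrow> dist (?B z) (?B x) < e"
    using e unfolding continuous_at_eps_delta by (metis dist_norm)
  obtain d3 where d3: "d3 > 0" "ball x d3 \<subseteq> S" using S open_contains_ball by blast
  define d where "d = min d1 (min d2 d3)"
  have d0: "d > 0" using d d3 by (simp add: d_def)
  \<comment> \<open>Keeps the parallelogram spanned by t v and t w within d/2 of x; the summand 1
    covers the case that both vectors vanish.\<close>
  define t where "t = d / (2 * (norm v + norm w + 1))"
  have den: "norm v + norm w + 1 > 0" by (simp add: add_nonneg_pos)
  have t: "t > 0" using d0 den by (simp add: t_def)
  have close: "dist (x + r *\<^sub>R v + s *\<^sub>R w) x < d" if "0 \<le> r" "r \<le> t" "0 \<le> s" "s \<le> t" for r s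
  proof -
    have "dist (x + r *\<^sub>R v + s *\<^sub>R w) x = norm (r *\<^sub>R v + s *\<^sub>R w)" by (simp add: dist_norm algebra_simps)
    also have "\<dots> \<le> norm (r *\<^sub>R v) + norm (s *\<^sub>R w)" by (rule norm_triangle_ineq)
    also have "\<dots> \<le> t * norm v + t * norm w" using that by (simp add: add_mono mult_right_mono)
    also have "\<dots> \<le> t * (norm v + norm w + 1)" using t by (simp add: algebra_simps)
    also have "\<dots> = d / 2" using den by (simp only: t_def) (simp add: divide_simps)
    also have "\<dots> < d" using d0 by simp
    finally show ?thesis .
  qed
  have inS: "x + r *\<^sub>R v + s *\<^sub>R w \<in> S" if "0 \<le> r" "r \<le> t" "0 \<le> s" "s \<le> t" for r s
    using close[OF that] d3 by (auto simp: d_def dist_commute subset_iff)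
  have inS': "x + s *\<^sub>R w + r *\<^sub>R v \<in> S" if "0 \<le> s" "s \<le> t" "0 \<le> r" "r \<le> t" for r s
    using inS[OF that(3,4,1,2)] by (simp add: ac_simps)
  obtain r s where rs: "0 < r" "r < t" "0 < s" "s < t"
    "f (x + t *\<^sub>R v + t *\<^sub>R w) - f (x + t *\<^sub>R v) - f (x + t *\<^sub>R w) + f x = t * t * ?A (x + r *\<^sub>R v + s *\<^sub>R w)"
    using second_difference[OF f t inS] by blast
  obtain r' s' where rs': "0 < r'" "r' < t" "0 < s'" "s' < t"
    "f (x + t *\<^sub>R w + t *\<^sub>R v) - f (x + t *\<^sub>R w) - f (x + t *\<^sub>R v) + f x = t * t * ?B (x + r' *\<^sub>R w + s' *\<^sub>R v)"
    using second_difference[OF f t inS'] by blast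
  have "t * t * ?A (x + r *\<^sub>R v + s *\<^sub>R w) = t * t * ?B (x + s' *\<^sub>R v + r' *\<^sub>R w)"
    using rs(5) rs'(5) by (simp add: add.commute add.left_commute diff_diff_eq)
  then have "?A (x + r *\<^sub>R v + s *\<^sub>R w) = ?B (x + s' *\<^sub>R v + r' *\<^sub>R w)" using t by simp
  moreover have "dist (?A (x + r *\<^sub>R v + s *\<^sub>R w)) (?A x) < e" "dist (?B (x + s' *\<^sub>R v + r' *\<^sub>R w)) (?B x) < e"
    using close[of r s] close[of s' r'] rs rs' d by (auto simp: d_def)
  moreover have False if "\<bar>c - a\<bar> < \<bar>a - b\<bar> / 2" "\<bar>c - b\<bar> < \<bar>a - b\<bar> / 2" for a b c :: real
    using that by (simp add: abs_if split: if_splits)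
  ultimately show False unfolding e_def dist_real_def by metis
qed

lemma dir_deriv_linear:
  assumes "bounded_linear h" "f differentiable (at x)"
  shows "dir_deriv (\<lambda>z. h (f z)) x v = h (dir_deriv f x v)"
  using bounded_linear.has_derivative[OF assms(1) has_dir_deriv[OF assms(2)]]
  by (simp add: dir_deriv_eqI)

lemma dir_deriv_commute:
  fixes f :: "'e::euclidean_space \<Rightarrow> 'f::euclidean_space"
  assumes f: "smooth_on S f" and S: "open S" "x \<in> S"
  shows "dir_deriv (\<lambda>z. dir_deriv f z v) x w = dir_deriv (\<lambda>z. dir_deriv f z w) x v"
proof (rule euclidean_eqI)
  fix b :: 'f assume "b \<in> Basis"
  let ?h = "\<lambda>y::'f. y \<bullet> b"
  have h: "bounded_linear ?h" by (rule bounded_linear_inner_left)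
  have "dir_deriv (\<lambda>z. dir_deriv f z v) x w \<bullet> b = dir_deriv (\<lambda>z. dir_deriv (\<lambda>z. f z \<bullet> b) z v) x w" for v w
  proof -
    have "dir_deriv (\<lambda>z. dir_deriv f z v) x w \<bullet> b = dir_deriv (\<lambda>z. dir_deriv f z v \<bullet> b) x w"
      using smooth_on_imp_differentiable[OF smooth_on_dir_deriv[OF f] S(2)]
      by (simp add: dir_deriv_linear[OF h])
    also have "\<dots> = dir_deriv (\<lambda>z. dir_deriv (\<lambda>z. f z \<bullet> b) z v) x w"
      using smooth_on_imp_differentiable[OF f]
      by (intro dir_deriv_cong[OF S]) (simp add: dir_deriv_linear[OF h])
    finally show ?thesis .
  qed
  then show "dir_deriv (\<lambda>z. dir_deriv f z v) x w \<bullet> b = dir_deriv (\<lambda>z. dir_deriv f z w) x v \<bullet> b"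
    using dir_deriv_commute_real[OF smooth_on_compose_linear[OF h f S(1)] S] by simp
qed

subsection \<open>Families of linear maps\<close>

text \<open>A product rule for a family of linear maps of which only the values on fixed vectors are
  known to be differentiable. It serves below for metrics, Christoffel symbols and derivatives of
  transition maps alike.\<close>

lemma has_derivative_linear_family:
  fixes y :: "'e::euclidean_space \<Rightarrow> 'g::euclidean_space"
  assumes S: "open S" "x \<in> S" "\<And>z. z \<in> S \<Longrightarrow> linear (B z)"
    and B: "\<And>b. (\<lambda>z. B z b) differentiable (at x)" and y: "y differentiable (at x)"
  shows "((\<lambda>z. B z (y z)) has_derivative
    (\<lambda>e. dir_deriv (\<lambda>z. B z (y x)) x e + B x (dir_deriv y x e))) (at x)"
proof -
  have expand: "((\<lambda>z. B z (w z)) has_derivative (\<lambda>e. \<Sum>b\<in>Basis.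
      (w x \<bullet> b) *\<^sub>R dir_deriv (\<lambda>z. B z b) x e + (dir_deriv w x e \<bullet> b) *\<^sub>R B x b)) (at x)"
    if "w differentiable (at x)" for w
  proof (rule has_derivative_transform_within_open[OF _ S(1,2)])
    show "((\<lambda>z. \<Sum>b\<in>Basis. (w z \<bullet> b) *\<^sub>R B z b) has_derivative (\<lambda>e. \<Sum>b\<in>Basis.
      (w x \<bullet> b) *\<^sub>R dir_deriv (\<lambda>z. B z b) x e + (dir_deriv w x e \<bullet> b) *\<^sub>R B x b)) (at x)"
      by (intro has_derivative_sum has_derivative_scaleR has_derivative_inner_left
          has_dir_deriv[OF that] has_dir_deriv[OF B])
  qed (use linear_eq_sum_Basis[OF S(3)] in metis)
  have "dir_deriv (\<lambda>z. B z (y x)) x e = (\<Sum>b\<in>Basis. (y x \<bullet> b) *\<^sub>R dir_deriv (\<lambda>z. B z b) x e)" for e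
    using dir_deriv_eqI[OF expand[of "\<lambda>_. y x"]] by simp
  moreover have "B x (dir_deriv y x e) = (\<Sum>b\<in>Basis. (dir_deriv y x e \<bullet> b) *\<^sub>R B x b)" for e
    by (rule linear_eq_sum_Basis[OF S(3)[OF S(2)]])
  ultimately show ?thesis
    using expand[OF y] by (simp add: sum.distrib)
qed

lemma dir_deriv_compose:
  assumes "f differentiable (at x)" "g differentiable (at (f x))"
  shows "dir_deriv (\<lambda>z. g (f z)) x v = dir_deriv g (f x) (dir_deriv f x v)"
  using has_derivative_compose[OF has_dir_deriv[OF assms(1)] has_dir_deriv[OF assms(2)]]
  by (simp add: dir_deriv_eqI)

text \<open>g is merely continuous and tends to 0, but f (x + h) is O(h), so the product is o(h).
  This handles products in which one factor, an unknown solution, is so far only known to be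
  continuous.\<close>

lemma has_derivative_zero_product:
  fixes g :: "'e::euclidean_space \<Rightarrow> real"
  assumes f: "f differentiable (at x)" "f x = 0" and g: "isCont g x" "g x = 0"
  shows "((\<lambda>z. g z *\<^sub>R f z) has_derivative (\<lambda>_. 0)) (at x)"
  unfolding has_derivative_at
proof (intro conjI)
  let ?D = "dir_deriv f x"
  have D: "bounded_linear ?D" "((\<lambda>h. norm (f (x + h) - f x - ?D h) / norm h) \<longlongrightarrow> 0) (at 0)"
    using has_dir_deriv[OF f(1)] by (auto simp: has_derivative_at)
  obtain K where K: "\<And>h. norm (?D h) \<le> norm h * K"
    using bounded_linear.bounded[OF D(1)] by blast
  have "((\<lambda>h. \<bar>g (x + h)\<bar> * (norm (f (x + h) - f x - ?D h) / norm h + K)) \<longlongrightarrow> \<bar>0\<bar> * (0 + K)) (at 0)"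
    using g D(2) by (intro tendsto_intros) (auto simp: isCont_iff)
  then have lim: "((\<lambda>h. \<bar>g (x + h)\<bar> * (norm (f (x + h) - f x - ?D h) / norm h + K)) \<longlongrightarrow> 0) (at 0)"
    by simp
  have "norm (g (x + h) *\<^sub>R f (x + h) - g x *\<^sub>R f x - 0) / norm h
      \<le> \<bar>g (x + h)\<bar> * (norm (f (x + h) - f x - ?D h) / norm h + K)" if "h \<noteq> 0" for h
  proof -
    have "norm (f (x + h)) \<le> norm (f (x + h) - f x - ?D h) + norm (?D h)"
      using norm_triangle_ineq[of "f (x + h) - f x - ?D h" "?D h"] f(2) by simp
    then have "norm (f (x + h)) \<le> norm (f (x + h) - f x - ?D h) + norm h * K"
      using K[of h] by simp
    then have "norm (f (x + h)) / norm h \<le> norm (f (x + h) - f x - ?D h) / norm h + K"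
      using that by (simp add: field_simps)
    then show ?thesis
      using mult_left_mono[OF _ abs_ge_zero[of "g (x + h)"]] f(2) by fastforce
  qed
  then have ev: "eventually (\<lambda>h. norm (norm (g (x + h) *\<^sub>R f (x + h) - g x *\<^sub>R f x - 0) / norm h)
      \<le> \<bar>g (x + h)\<bar> * (norm (f (x + h) - f x - ?D h) / norm h + K)) (at 0)"
    by (auto simp: eventually_at intro!: exI[of _ 1])
  show "((\<lambda>h. norm (g (x + h) *\<^sub>R f (x + h) - g x *\<^sub>R f x - 0) / norm h) \<longlongrightarrow> 0) (at 0)"
    by (rule Lim_null_comparison[OF ev lim])
qed simp

text \<open>A solution of a linear system is differentiable if the system is and its matrix is invertible.
  Continuity comes from bounding the inverse; then \<open>B x (n z - n x)\<close> differs from the differentiable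
  function \<open>r z - B z (n x)\<close> by products of two functions vanishing at \<open>x\<close>.\<close>

lemma linear_solution_differentiable:
  fixes B :: "'e::euclidean_space \<Rightarrow> 'g::euclidean_space \<Rightarrow> 'g"
  assumes S: "open S" "x \<in> S" "\<And>z. z \<in> S \<Longrightarrow> linear (B z)" "inj (B x)"
    and B: "\<And>b. (\<lambda>z. B z b) differentiable (at x)" and r: "r differentiable (at x)"
    and sol: "\<And>z. z \<in> S \<Longrightarrow> B z (n z) = r z"
  shows "n differentiable (at x)"
proof -
  let ?m = "\<lambda>z. n z - n x" and ?q = "\<lambda>z. r z - B z (n x)"
  let ?\<epsilon> = "\<lambda>z. \<Sum>b\<in>Basis. norm (B z b - B x b)"
  have lin: "linear (B x)" using S by blast
  have q: "?q differentiable (at x)" "?q x = 0"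
    using differentiable_diff[OF r B] sol[OF S(2)] by auto
  have Bm: "B z (?m z) = ?q z" if "z \<in> S" for z
    using sol[OF that] by (simp add: linear_diff[OF S(3)[OF that]])
  have diff: "B z w - B x w = (\<Sum>b\<in>Basis. (w \<bullet> b) *\<^sub>R (B z b - B x b))" if "z \<in> S" for z w
    using linear_eq_sum_Basis[OF S(3)[OF that], of w] linear_eq_sum_Basis[OF lin, of w]
    by (simp add: scaleR_diff_right sum_subtractf)
  have diff_le: "norm (B z w - B x w) \<le> ?\<epsilon> z * norm w" if "z \<in> S" for z w
  proof -
    have "norm (B z w - B x w) \<le> (\<Sum>b\<in>Basis. \<bar>w \<bullet> b\<bar> * norm (B z b - B x b))"
      by (subst diff[OF that], rule order_trans[OF norm_sum]) simp
    also have "\<dots> \<le> (\<Sum>b\<in>Basis. norm w * norm (B z b - B x b))"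
      by (intro sum_mono mult_right_mono Basis_le_norm) auto
    finally show ?thesis by (simp add: sum_distrib_left mult.commute)
  qed
  \<comment> \<open>\<open>B x\<close> stretches every vector by at least some k > 0. Near x the map
    \<open>B z\<close> differs from it by less than k/2, so it still stretches by at least k/2,
    which bounds n z - n x.\<close>
  obtain k where k: "k > 0" "\<And>w. k * norm w \<le> norm (B x w)"
    using linear_inj_bounded_below_pos[OF lin S(4)] by blast
  have contB: "isCont (\<lambda>z. B z b) x" for b
    using differentiable_imp_continuous_within[OF B] by simp
  have "isCont ?\<epsilon> x" by (intro continuous_intros contB)
  then have "(?\<epsilon> \<longlongrightarrow> 0) (at x)" by (simp add: isCont_def)
  then have "eventually (\<lambda>z. ?\<epsilon> z < k / 2) (at x)"
    using order_tendstoD(2) k(1) half_gt_zero by blast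
  moreover have "eventually (\<lambda>z. z \<in> S) (at x)"
    using S by (rule_tac eventually_at_in_open')
  ultimately have "eventually (\<lambda>z. norm (?m z) \<le> (2 / k) * norm (?q z)) (at x)"
  proof eventually_elim
    case (elim z)
    have "k * norm (?m z) \<le> norm (B x (?m z))" by (rule k)
    also have "\<dots> \<le> norm (B z (?m z)) + norm (B z (?m z) - B x (?m z))"
      by (metis norm_minus_commute norm_triangle_sub)
    also have "\<dots> \<le> norm (?q z) + ?\<epsilon> z * norm (?m z)"
      using diff_le[OF elim(2), of "?m z"] unfolding Bm[OF elim(2)] by simp
    also have "\<dots> \<le> norm (?q z) + k / 2 * norm (?m z)"
      using elim(1) by (intro add_left_mono mult_right_mono) auto
    finally show ?case using k(1) by (simp add: field_simps)
  qed
  moreover have "((\<lambda>z. (2 / k) * norm (?q z)) \<longlongrightarrow> 0) (at x)"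
    using differentiable_imp_continuous_within[OF q(1)] q(2)
    by (intro tendsto_mult_right_zero tendsto_norm_zero) (auto simp: continuous_within)
  ultimately have "(?m \<longlongrightarrow> 0) (at x)" by (rule Lim_null_comparison)
  then have contm: "isCont (\<lambda>z. ?m z \<bullet> b) x" for b
    by (intro continuous_intros) (simp add: isCont_def LIM_zero_cancel)
  have "((\<lambda>z. \<Sum>b\<in>Basis. (?m z \<bullet> b) *\<^sub>R (B z b - B x b)) has_derivative (\<lambda>_. \<Sum>b\<in>(Basis::'g set). 0)) (at x)"
    by (intro has_derivative_sum has_derivative_zero_product contm differentiable_diff B) auto
  then have "(\<lambda>z. ?q z - (\<Sum>b\<in>Basis. (?m z \<bullet> b) *\<^sub>R (B z b - B x b))) differentiable (at x)"
    by (intro differentiable_diff[OF q(1)] differentiableI)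
  then have "(\<lambda>z. B x (?m z)) differentiable (at x)"
  proof (rule differentiable_cong_open[OF S(1,2), rotated])
    show "?q z - (\<Sum>b\<in>Basis. (?m z \<bullet> b) *\<^sub>R (B z b - B x b)) = B x (?m z)" if "z \<in> S" for z
      using diff[OF that, of "?m z", symmetric] Bm[OF that, symmetric] by simp
  qed
  \<comment> \<open>A left inverse of \<open>B x\<close> recovers n z - n x from its image.\<close>
  moreover obtain C where C: "linear C" "C \<circ> B x = id"
    using linear_injective_left_inverse[OF lin S(4)] by blast
  ultimately have "(\<lambda>z. C (B x (?m z)) + n x) differentiable (at x)"
    using bounded_linear.has_derivative[OF linear_conv_bounded_linear[THEN iffD1, OF C(1)] has_dir_deriv]
    by (intro differentiable_add differentiable_const) (rule differentiableI)
  then show ?thesis using C(2) by (simp add: pointfree_idE)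
qed

lemma sum_fun_value: "(\<Sum>i\<in>I. f i) x = (\<Sum>i\<in>I. f i x)" for f :: "'i \<Rightarrow> 'a \<Rightarrow> 'b::comm_monoid_add"
  by (induction I rule: infinite_finite_induct) auto

subsection \<open>A plateau function\<close>

lemma k_smooth_on_real:
  fixes f f' :: "real \<Rightarrow> real"
  assumes "open S" "\<And>x. x \<in> S \<Longrightarrow> (f has_real_derivative f' x) (at x)" "k_smooth_on k S f'"
  shows "k_smooth_on (Suc k) S f"
proof -
  have "dir_deriv f x = (*) (f' x)" if "x \<in> S" for x
    using assms(2)[OF that] by (intro dir_deriv_eqI) (simp add: has_field_derivative_def)
  then have "k_smooth_on k S (\<lambda>x. dir_deriv f x e)" for e
    by (rule_tac k_smooth_on_cong[of S "\<lambda>x. f' x * e"])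
      (auto intro!: assms k_smooth_on_bilinear[OF bounded_bilinear_mult] k_smooth_on_const)
  then show ?thesis
    using assms(2) by (auto simp: has_field_derivative_def differentiable_def)
qed

text \<open>The powers of x in the denominator make the family closed under differentiation up to
  linear combinations. One induction over the order, with n arbitrary, then proves all members
  smooth.\<close>

definition flat_exp :: "nat \<Rightarrow> real \<Rightarrow> real" where
  "flat_exp n x = (if x > 0 then exp (- (1/x)) / x ^ n else 0)"

text \<open>With y = 1/x this is the decay of y^n / exp y at infinity.\<close>

lemma flat_exp_tendsto: "((\<lambda>x. flat_exp n x) \<longlongrightarrow> 0) (at_right 0)"
proof -
  have "((\<lambda>y. y ^ n / exp y) \<longlongrightarrow> (0::real)) at_top"
    by (rule tendsto_power_div_exp_0)
  then have "((\<lambda>x. (inverse x) ^ n / exp (inverse x)) \<longlongrightarrow> (0::real)) (at_right 0)"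
    by (rule filterlim_compose[OF _ filterlim_inverse_at_top_right])
  moreover have "eventually (\<lambda>x. (inverse x) ^ n / exp (inverse x) = flat_exp n x) (at_right (0::real))"
    by (auto simp: eventually_at_right_field flat_exp_def exp_minus field_simps intro!: exI[of _ 1])
  ultimately show ?thesis by (rule Lim_transform_eventually)
qed

lemma flat_exp_derivative:
  "(flat_exp n has_real_derivative flat_exp (n + 2) x - real n * flat_exp (n + 1) x) (at x)"
proof (cases x "0::real" rule: linorder_cases)
  case greater
  have "((\<lambda>x. exp (- (1/x)) / x ^ n) has_real_derivative flat_exp (n + 2) x - real n * flat_exp (n + 1) x) (at x)"
  proof -
    have "((\<lambda>x. exp (- (1/x))) has_real_derivative exp (- (1/x)) / x\<^sup>2) (at x)"
      using greater by (auto intro!: derivative_eq_intros simp: field_simps power2_eq_square)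
    then show ?thesis
      by (rule DERIV_cong[OF DERIV_divide[OF _ DERIV_pow[of n x]]])
        (use greater in \<open>cases n; auto simp: flat_exp_def field_simps power2_eq_square\<close>)+
  qed
  then show ?thesis
    by (rule has_field_derivative_transform_within_open[of _ _ _ "{0<..}"])
      (use greater in \<open>auto simp: flat_exp_def\<close>)
next
  case less
  have "((\<lambda>x. 0) has_real_derivative 0) (at x)" by simp
  then have "(flat_exp n has_real_derivative 0) (at x)"
    by (rule has_field_derivative_transform_within_open[of _ _ _ "{..<0}"])
      (use less in \<open>auto simp: flat_exp_def\<close>)
  then show ?thesis using less by (simp add: flat_exp_def)
next
  case equal
  \<comment> \<open>At 0 the difference quotient from the right is the next member
    \<open>flat_exp (Suc n)\<close>, which tends to 0; from the left it is 0 throughout.\<close>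
  have "((\<lambda>h. (flat_exp n (0 + h) - flat_exp n 0) / h) \<longlongrightarrow> 0) (at_right 0)"
    by (rule Lim_transform_eventually[OF flat_exp_tendsto[of "Suc n"]])
      (auto simp: eventually_at_right_field flat_exp_def field_simps intro!: exI[of _ 1])
  moreover have "((\<lambda>h. (flat_exp n (0 + h) - flat_exp n 0) / h) \<longlongrightarrow> 0) (at_left 0)"
    by (rule Lim_transform_eventually[OF tendsto_const])
      (auto simp: eventually_at_left_field flat_exp_def intro!: exI[of _ "-1"])
  ultimately have "((\<lambda>h. (flat_exp n (0 + h) - flat_exp n 0) / h) \<longlongrightarrow> 0) (at 0)"
    by (simp add: filterlim_split_at)
  then show ?thesis using equal by (simp add: DERIV_def flat_exp_def)
qed

lemma smooth_on_flat_exp: "smooth_on UNIV (flat_exp n)"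
proof -
  have "k_smooth_on k UNIV (flat_exp n)" for k
  proof (induction k arbitrary: n)
    case 0
    have "continuous_on UNIV (flat_exp n)"
      using flat_exp_derivative[of n] DERIV_isCont by (blast intro: continuous_at_imp_continuous_on)
    then show ?case by simp
  next
    case (Suc k)
    have "k_smooth_on k UNIV (\<lambda>x. flat_exp (n + 2) x + (- real n) * flat_exp (n + 1) x)"
      by (intro k_smooth_on_add k_smooth_on_bilinear[OF bounded_bilinear_mult] k_smooth_on_const Suc) auto
    then show ?case
      by (rule_tac k_smooth_on_real[OF _ flat_exp_derivative]) auto
  qed
  then show ?thesis by (simp add: smooth_on_def)
qed

lemma smooth_on_inverse: "smooth_on (- {0::real}) inverse"
proof -
  have "k_smooth_on k (- {0::real}) inverse" for k
  proof (induction k)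
    case 0
    then show ?case by (auto intro!: continuous_intros)
  next
    case (Suc k)
    have "k_smooth_on k (- {0::real}) (\<lambda>x. (- 1) * (inverse x * inverse x))"
      by (intro k_smooth_on_bilinear[OF bounded_bilinear_mult] k_smooth_on_const Suc) auto
    then show ?case
      by (rule_tac k_smooth_on_real[of _ _ "\<lambda>x. (- 1) * (inverse x * inverse x)"])
        (auto intro!: derivative_eq_intros simp: power2_eq_square)
  qed
  then show ?thesis by (simp add: smooth_on_def)
qed

text \<open>The standard smooth transition from 0 (for t \<le> 0) to 1 (for t \<ge> 1). Its
  denominator never vanishes, because t or 1 - t is positive.\<close>

definition smooth_step :: "real \<Rightarrow> real" where
  "smooth_step t = flat_exp 0 t * inverse (flat_exp 0 t + flat_exp 0 (1 - t))"

lemma smooth_on_step: "smooth_on UNIV smooth_step"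
proof -
  have lin: "smooth_on UNIV (\<lambda>t::real. 1 + (- t))"
    by (intro smooth_on_add smooth_on_const smooth_on_bounded_linear bounded_linear_minus) auto
  have "smooth_on UNIV (\<lambda>t. flat_exp 0 (1 + - t))"
    by (rule smooth_on_compose[OF lin smooth_on_flat_exp]) auto
  then have den: "smooth_on UNIV (\<lambda>t. flat_exp 0 t + flat_exp 0 (1 - t))"
    by (intro smooth_on_add smooth_on_flat_exp) auto
  have "smooth_on UNIV (\<lambda>t. inverse (flat_exp 0 t + flat_exp 0 (1 - t)))"
  proof (rule smooth_on_compose[OF den smooth_on_inverse])
    have "flat_exp 0 t + flat_exp 0 (1 - t) > 0" for t
      by (cases "t > 0") (auto simp: flat_exp_def add_pos_pos)
    then show "range (\<lambda>t. flat_exp 0 t + flat_exp 0 (1 - t)) \<subseteq> - {0}"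
      by (auto simp: less_le)
  qed (auto simp: open_Compl)
  then have "smooth_on UNIV (\<lambda>t. flat_exp 0 t * inverse (flat_exp 0 t + flat_exp 0 (1 - t)))"
    by (intro smooth_on_bilinear[OF bounded_bilinear_mult] smooth_on_flat_exp) auto
  then show ?thesis by (simp add: smooth_step_def[abs_def])
qed

lemma plateau_function:
  fixes x :: "'e::euclidean_space"
  assumes "r > 0"
  obtains f :: "'e \<Rightarrow> real" where "smooth_on UNIV f" "\<And>y. dist y x < r \<Longrightarrow> f y = 1"
    "\<And>y. dist y x \<ge> 2 * r \<Longrightarrow> f y = 0"
proof
  \<comment> \<open>This is 2 - (dist y x / r)^2. The squared distance is smooth also at x; the
    expression exceeds 1 inside radius r and is negative from radius 2r on.\<close>
  let ?q = "\<lambda>y. 2 + (- inverse (r\<^sup>2)) * ((y + - x) \<bullet> (y + - x))"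
  have q: "smooth_on UNIV ?q"
    by (intro smooth_on_add smooth_on_bilinear[OF bounded_bilinear_mult]
        smooth_on_bilinear[OF bounded_bilinear_inner] smooth_on_const smooth_on_bounded_linear
        bounded_linear_ident) auto
  show "smooth_on UNIV (\<lambda>y. smooth_step (?q y))"
    by (rule smooth_on_compose[OF q smooth_on_step]) auto
  have qe: "?q y = 2 - (dist y x)\<^sup>2 / r\<^sup>2" for y
    by (simp add: dist_norm power2_norm_eq_inner field_simps)
  show "smooth_step (?q y) = 1" if "dist y x < r" for y
  proof -
    have "(dist y x)\<^sup>2 < r\<^sup>2" using that by (intro power_strict_mono) auto
    then have "?q y > 1" unfolding qe using assms by (simp add: field_simps)
    then show ?thesis by (simp add: smooth_step_def flat_exp_def)
  qed
  show "smooth_step (?q y) = 0" if "dist y x \<ge> 2 * r" for y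
  proof -
    have "(dist y x)\<^sup>2 \<ge> (2 * r)\<^sup>2" using that assms by (intro power_mono) auto
    then have "2 * r\<^sup>2 \<le> (dist y x)\<^sup>2"
      by (auto simp: power_mult_distrib intro: order_trans[of _ "4 * r\<^sup>2"])
    then have "?q y \<le> 0" unfolding qe using assms by (simp add: field_simps)
    then show ?thesis by (simp add: smooth_step_def flat_exp_def)
  qed
qed

section \<open>Charts and tangent vectors\<close>

text \<open>What computations with tangent vectors require, without any topology on the space. The
  slit tangent bundle, on which no topology is defined, is thus an instance as well.\<close>

locale smooth_atlas =
  fixes atl :: "('a, 'e::euclidean_space) chart set"
  assumes inj_chart: "c \<in> atl \<Longrightarrow> inj_on (snd c) (fst c)"
    and open_overlap: "c \<in> atl \<Longrightarrow> d \<in> atl \<Longrightarrow> open (snd c ` (fst c \<inter> fst d))"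
    and smooth_transition: "c \<in> atl \<Longrightarrow> d \<in> atl \<Longrightarrow>
      smooth_on (snd c ` (fst c \<inter> fst d)) (snd d \<circ> inv_chart c)"
begin

lemma open_chart: "c \<in> atl \<Longrightarrow> open (snd c ` fst c)"
  using open_overlap[of c c] by simp

lemma inv_chart_chart: "c \<in> atl \<Longrightarrow> p \<in> fst c \<Longrightarrow> inv_chart c (snd c p) = p"
  using inj_chart by (simp add: inv_into_f_f)

text \<open>The chain rule through the transition map. It makes derivatives that are defined by an
  arbitrarily chosen chart, as in \<open>dfun\<close>, available in every chart around p.\<close>

lemma change_chart:
  assumes c: "c \<in> atl" "p \<in> fst c" and d: "d \<in> atl" "p \<in> fst d"
    and f: "(f \<circ> inv_chart d) differentiable (at (snd d p))"
  shows "((f \<circ> inv_chart c) has_derivative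
    (\<lambda>v. dir_deriv (f \<circ> inv_chart d) (snd d p) (dir_deriv (snd d \<circ> inv_chart c) (snd c p) v))) (at (snd c p))"
proof (rule has_derivative_transform_within_open[OF _ open_overlap[OF c(1) d(1)]])
  have t: "(snd d \<circ> inv_chart c) differentiable (at (snd c p))"
    using smooth_on_imp_differentiable[OF smooth_transition[OF c(1) d(1)]] c d by blast
  have e: "snd d p = (snd d \<circ> inv_chart c) (snd c p)"
    using c by (simp add: inv_chart_chart)
  show "((\<lambda>x. (f \<circ> inv_chart d) ((snd d \<circ> inv_chart c) x)) has_derivative
    (\<lambda>v. dir_deriv (f \<circ> inv_chart d) (snd d p) (dir_deriv (snd d \<circ> inv_chart c) (snd c p) v))) (at (snd c p))"
    by (rule has_derivative_compose[OF has_dir_deriv[OF t]])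
      (use f has_dir_deriv in \<open>unfold e[symmetric], blast\<close>)
qed (use c d inv_chart_chart in auto)

lemma chart_differentiable:
  assumes "c \<in> atl" "p \<in> fst c" "d \<in> atl" "p \<in> fst d"
  shows "(snd d \<circ> inv_chart c) differentiable (at (snd c p))"
  using smooth_on_imp_differentiable[OF smooth_transition[OF assms(1,3)]] assms by blast

lemma transition_compose:
  assumes "c \<in> atl" "p \<in> fst c" "d \<in> atl" "p \<in> fst d" "e \<in> atl" "p \<in> fst e"
  shows "dir_deriv (snd e \<circ> inv_chart c) (snd c p) v
    = dir_deriv (snd e \<circ> inv_chart d) (snd d p) (dir_deriv (snd d \<circ> inv_chart c) (snd c p) v)"
  using dir_deriv_eqI[OF change_chart[OF assms(1-4) chart_differentiable[OF assms(3-6)]]] by simp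

lemma transition_self:
  assumes "c \<in> atl" "p \<in> fst c"
  shows "dir_deriv (snd c \<circ> inv_chart c) (snd c p) v = v"
proof -
  have "dir_deriv (snd c \<circ> inv_chart c) (snd c p) v = dir_deriv (\<lambda>x. x) (snd c p) v"
    by (rule dir_deriv_cong[OF open_chart[OF assms(1)]]) (use assms in \<open>auto simp: inv_chart_chart\<close>)
  then show ?thesis by simp
qed

lemma linear_transition:
  assumes "c \<in> atl" "p \<in> fst c" "d \<in> atl" "p \<in> fst d"
  shows "linear (dir_deriv (snd d \<circ> inv_chart c) (snd c p))"
  by (rule linear_dir_deriv[OF chart_differentiable[OF assms]])

lemma tangent_spaceI:
  assumes "\<And>c. \<not> (c \<in> atl \<and> p \<in> fst c) \<Longrightarrow> v c = 0"
    and "\<And>c d. c \<in> atl \<Longrightarrow> p \<in> fst c \<Longrightarrow> d \<in> atl \<Longrightarrow> p \<in> fst d \<Longrightarrow>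
      v d = dir_deriv (snd d \<circ> inv_chart c) (snd c p) (v c)"
  shows "v \<in> tangent_space atl p"
  unfolding tangent_space_def using assms by blast

lemma tangent_outside: "v \<in> tangent_space atl p \<Longrightarrow> \<not> (c \<in> atl \<and> p \<in> fst c) \<Longrightarrow> v c = 0"
  unfolding tangent_space_def by blast

lemma tangent_transition:
  "v \<in> tangent_space atl p \<Longrightarrow> c \<in> atl \<Longrightarrow> p \<in> fst c \<Longrightarrow> d \<in> atl \<Longrightarrow> p \<in> fst d \<Longrightarrow>
    v d = dir_deriv (snd d \<circ> inv_chart c) (snd c p) (v c)"
  unfolding tangent_space_def by blast

lemma coord_vec_tangent:
  assumes "c \<in> atl" "p \<in> fst c"
  shows "coord_vec atl c e p \<in> tangent_space atl p"
proof (rule tangent_spaceI)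
  fix b d assume b: "b \<in> atl" "p \<in> fst b" and d: "d \<in> atl" "p \<in> fst d"
  show "coord_vec atl c e p d = dir_deriv (snd d \<circ> inv_chart b) (snd b p) (coord_vec atl c e p b)"
    using b d by (simp add: coord_vec_def transition_compose[OF assms b d, of e, symmetric])
qed (auto simp: coord_vec_def)

lemma coord_vec_self: "c \<in> atl \<Longrightarrow> p \<in> fst c \<Longrightarrow> coord_vec atl c e p c = e"
  by (simp add: coord_vec_def transition_self)

lemma tangent_eqI:
  assumes "v \<in> tangent_space atl p" "w \<in> tangent_space atl p" "c \<in> atl" "p \<in> fst c" "v c = w c"
  shows "v = w"
proof
  fix d show "v d = w d"
  proof (cases "d \<in> atl \<and> p \<in> fst d")
    case True
    then show ?thesis
      using tangent_transition[OF assms(1,3,4), of d] tangent_transition[OF assms(2,3,4), of d] assms(5)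
      by metis
  next
    case False
    then show ?thesis using tangent_outside assms(1,2) by metis
  qed
qed

lemma coord_vec_coords:
  assumes "v \<in> tangent_space atl p" "c \<in> atl" "p \<in> fst c"
  shows "coord_vec atl c (v c) p = v"
  using assms by (rule_tac tangent_eqI[of _ p v c]) (auto simp: coord_vec_tangent coord_vec_self)

lemma tangent_zero: "0 \<in> tangent_space atl p"
  by (rule tangent_spaceI) (simp_all add: linear_0[OF linear_transition])

lemma tangent_add:
  assumes "v \<in> tangent_space atl p" "w \<in> tangent_space atl p"
  shows "v + w \<in> tangent_space atl p"
proof (rule tangent_spaceI)
  fix c d assume c: "c \<in> atl" "p \<in> fst c" and d: "d \<in> atl" "p \<in> fst d"
  show "(v + w) d = dir_deriv (snd d \<circ> inv_chart c) (snd c p) ((v + w) c)"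
    using tangent_transition[OF assms(1) c d] tangent_transition[OF assms(2) c d]
    by (simp add: linear_add[OF linear_transition[OF c d]])
qed (use tangent_outside[OF assms(1)] tangent_outside[OF assms(2)] in simp)

lemma tangent_scaleR:
  assumes "v \<in> tangent_space atl p" shows "r *\<^sub>R v \<in> tangent_space atl p"
proof (rule tangent_spaceI)
  fix c d assume c: "c \<in> atl" "p \<in> fst c" and d: "d \<in> atl" "p \<in> fst d"
  show "(r *\<^sub>R v) d = dir_deriv (snd d \<circ> inv_chart c) (snd c p) ((r *\<^sub>R v) c)"
    using tangent_transition[OF assms c d]
    by (simp add: linear_cmul[OF linear_transition[OF c d]])
qed (use tangent_outside[OF assms] in simp)

lemma tangent_diff:
  "v \<in> tangent_space atl p \<Longrightarrow> w \<in> tangent_space atl p \<Longrightarrow> v - w \<in> tangent_space atl p"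
  using tangent_add[of v p "(-1) *\<^sub>R w"] tangent_scaleR[of w p "-1"] by simp

lemma coord_vec_add:
  "c \<in> atl \<Longrightarrow> p \<in> fst c \<Longrightarrow>
    coord_vec atl c (e + e') p = coord_vec atl c e p + coord_vec atl c e' p"
  by (rule tangent_eqI[of _ p _ c]) (simp_all add: coord_vec_tangent tangent_add coord_vec_self)

lemma coord_vec_scaleR:
  "c \<in> atl \<Longrightarrow> p \<in> fst c \<Longrightarrow> coord_vec atl c (r *\<^sub>R e) p = r *\<^sub>R coord_vec atl c e p"
  by (rule tangent_eqI[of _ p _ c]) (simp_all add: coord_vec_tangent tangent_scaleR coord_vec_self)

lemma chart_at: "c \<in> atl \<Longrightarrow> p \<in> fst c \<Longrightarrow> chart_at atl p \<in> atl \<and> p \<in> fst (chart_at atl p)"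
  unfolding chart_at_def by (rule someI[of _ c]) simp

lemma dfun_eq:
  assumes c: "c \<in> atl" "p \<in> fst c" and \<xi>: "\<xi> \<in> tangent_space atl p"
    and f: "(f \<circ> inv_chart c) differentiable (at (snd c p))"
  shows "dfun atl f p \<xi> = dir_deriv (f \<circ> inv_chart c) (snd c p) (\<xi> c)"
proof -
  let ?d = "chart_at atl p"
  have d: "?d \<in> atl" "p \<in> fst ?d" using chart_at[OF c] by auto
  show ?thesis
    unfolding dfun_def Let_def
    by (simp add: dir_deriv_eqI[OF change_chart[OF d c f]] tangent_transition[OF \<xi> d c])
qed

text \<open>The bracket is defined chart by chart, so its components must be shown to transform like
  a tangent vector. Differentiating the transformation law of a field produces a second derivative
  of the transition map; it is symmetric in X and Y and cancels in the bracket. Differentiability at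
  p suffices, which matters for horizontal lifts.\<close>

lemma lie_bracket_tangent:
  assumes X: "\<And>c q. c \<in> atl \<Longrightarrow> q \<in> fst c \<Longrightarrow> X q \<in> tangent_space atl q"
    and Y: "\<And>c q. c \<in> atl \<Longrightarrow> q \<in> fst c \<Longrightarrow> Y q \<in> tangent_space atl q"
    and dX: "\<And>c. c \<in> atl \<Longrightarrow> p \<in> fst c \<Longrightarrow> ((\<lambda>q. X q c) \<circ> inv_chart c) differentiable (at (snd c p))"
    and dY: "\<And>c. c \<in> atl \<Longrightarrow> p \<in> fst c \<Longrightarrow> ((\<lambda>q. Y q c) \<circ> inv_chart c) differentiable (at (snd c p))"
  shows "lie_bracket atl X Y p \<in> tangent_space atl p"
proof -
  have "lie_bracket atl X Y p d = dir_deriv (snd d \<circ> inv_chart c) (snd c p) (lie_bracket atl X Y p c)"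
    if c: "c \<in> atl" "p \<in> fst c" and d: "d \<in> atl" "p \<in> fst d" for c d
  proof -
    let ?t = "snd d \<circ> inv_chart c" and ?x = "snd c p"
    note ov = open_overlap[OF c(1) d(1)]
    have x: "?x \<in> snd c ` (fst c \<inter> fst d)" using c d by auto
    \<comment> \<open>The transformation law of a field, differentiated in direction e; the first
      summand is the second-derivative term.\<close>
    have *: "dir_deriv ((\<lambda>q. Z q d) \<circ> inv_chart d) (snd d p) (dir_deriv ?t ?x e)
       = dir_deriv (\<lambda>z. dir_deriv ?t z (Z p c)) ?x e
        + dir_deriv ?t ?x (dir_deriv ((\<lambda>q. Z q c) \<circ> inv_chart c) ?x e)"
      if Z: "\<And>c q. c \<in> atl \<Longrightarrow> q \<in> fst c \<Longrightarrow> Z q \<in> tangent_space atl q"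
        and dZ: "\<And>c. c \<in> atl \<Longrightarrow> p \<in> fst c \<Longrightarrow> ((\<lambda>q. Z q c) \<circ> inv_chart c) differentiable (at (snd c p))"
      for Z :: "'a \<Rightarrow> ('a, 'e) tvec" and e
    proof -
      let ?y = "(\<lambda>q. Z q c) \<circ> inv_chart c"
      have "dir_deriv ((\<lambda>q. Z q d) \<circ> inv_chart d) (snd d p) (dir_deriv ?t ?x e)
        = dir_deriv ((\<lambda>q. Z q d) \<circ> inv_chart c) ?x e"
        using dir_deriv_eqI[OF change_chart[OF c d dZ[OF d]]] by simp
      also have "\<dots> = dir_deriv (\<lambda>z. dir_deriv ?t z (?y z)) ?x e"
      proof (rule dir_deriv_cong[OF ov x])
        fix z assume "z \<in> snd c ` (fst c \<inter> fst d)"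
        then obtain q where q: "q \<in> fst c" "q \<in> fst d" "z = snd c q" by auto
        show "((\<lambda>q. Z q d) \<circ> inv_chart c) z = dir_deriv ?t z (?y z)"
          using tangent_transition[OF Z[OF c(1) q(1)] c(1) q(1) d(1) q(2)] q c
          by (simp add: inv_chart_chart)
      qed
      also have "\<dots> = dir_deriv (\<lambda>z. dir_deriv ?t z (?y ?x)) ?x e + dir_deriv ?t ?x (dir_deriv ?y ?x e)"
        by (subst dir_deriv_eqI[OF has_derivative_linear_family[OF ov x]])
          (use smooth_transition[OF c(1) d(1)] x in \<open>auto intro!: linear_dir_deriv dZ c
            intro: smooth_on_imp_differentiable smooth_on_imp_differentiable[OF smooth_on_dir_deriv]\<close>)
      finally show ?thesis using c by (simp add: inv_chart_chart)
    qed
    have "dir_deriv (\<lambda>z. dir_deriv ?t z (Y p c)) ?x (X p c) = dir_deriv (\<lambda>z. dir_deriv ?t z (X p c)) ?x (Y p c)"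
      by (rule dir_deriv_commute[OF smooth_transition[OF c(1) d(1)] ov x])
    moreover note *[of Y "X p c"] *[of X "Y p c"]
    ultimately show ?thesis
      using X Y dX dY c d
      by (simp add: lie_bracket_def linear_diff[OF linear_transition[OF c d]]
          tangent_transition[OF X[OF c] c d] tangent_transition[OF Y[OF c] c d])
  qed
  then show ?thesis
    by (rule_tac tangent_spaceI) (simp add: lie_bracket_def, blast)
qed

section \<open>Charts of the slit tangent bundle\<close>

lemma slit_chart_iff: "u \<in> fst (slit_chart atl c) \<longleftrightarrow> u \<in> slit atl \<and> fst u \<in> fst c"
  by (simp add: slit_chart_def)

lemma slit_chart_apply: "snd (slit_chart atl c) u = (snd c (fst u), snd u c)"
  by (simp add: slit_chart_def)

lemma slit_chart_tangent: "u \<in> fst (slit_chart atl c) \<Longrightarrow> snd u \<in> tangent_space atl (fst u)"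
  by (auto simp: slit_chart_iff slit_def tangent_bundle_def)

lemma slit_coords_nonzero:
  assumes "c \<in> atl" "u \<in> fst (slit_chart atl c)"
  shows "snd u c \<noteq> 0"
  using assms tangent_eqI[OF slit_chart_tangent[OF assms(2)] tangent_zero assms(1)]
  by (auto simp: slit_chart_iff slit_def)

lemma slit_chart_coord_vec:
  assumes "c \<in> atl" "p \<in> fst c" "y \<noteq> 0"
  shows "(p, coord_vec atl c y p) \<in> fst (slit_chart atl c)"
    "snd (slit_chart atl c) (p, coord_vec atl c y p) = (snd c p, y)"
  using assms coord_vec_self[OF assms(1,2), of y] coord_vec_tangent[OF assms(1,2)]
  by (auto simp: slit_chart_iff slit_chart_apply slit_def tangent_bundle_def)

lemma slit_chart_inj: assumes "c \<in> atl" shows "inj_on (snd (slit_chart atl c)) (fst (slit_chart atl c))"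
proof (rule inj_onI)
  fix u w assume u: "u \<in> fst (slit_chart atl c)" and w: "w \<in> fst (slit_chart atl c)"
    and eq: "snd (slit_chart atl c) u = snd (slit_chart atl c) w"
  have "fst u = fst w"
    using inj_onD[OF inj_chart[OF assms]] eq u w by (simp add: slit_chart_iff slit_chart_apply)
  moreover have "snd u = snd w"
    using tangent_eqI[OF slit_chart_tangent[OF u] _ assms, of "snd w"] slit_chart_tangent[OF w] eq u calculation
    by (simp add: slit_chart_iff slit_chart_apply)
  ultimately show "u = w" by (simp add: prod_eq_iff)
qed

lemma slit_inv_chart:
  assumes "c \<in> atl" "x \<in> snd c ` fst c" "y \<noteq> 0"
  shows "inv_chart (slit_chart atl c) (x, y) = (inv_chart c x, coord_vec atl c y (inv_chart c x))"
proof (rule inv_into_f_eq[OF slit_chart_inj[OF assms(1)]])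
  obtain p where p: "p \<in> fst c" "x = snd c p" using assms by auto
  show "(inv_chart c x, coord_vec atl c y (inv_chart c x)) \<in> fst (slit_chart atl c)"
    "snd (slit_chart atl c) (inv_chart c x, coord_vec atl c y (inv_chart c x)) = (x, y)"
    using slit_chart_coord_vec[OF assms(1) p(1) assms(3)] p assms(1) by (auto simp: inv_chart_chart)
qed

lemma slit_chart_image:
  assumes "c \<in> atl"
  shows "snd (slit_chart atl c) ` (fst (slit_chart atl c) \<inter> fst (slit_chart atl d))
    = snd c ` (fst c \<inter> fst d) \<times> (- {0})" (is "?l = ?r")
proof
  show "?l \<subseteq> ?r"
    using slit_coords_nonzero[OF assms] by (auto simp: slit_chart_apply slit_chart_iff)
  show "?r \<subseteq> ?l"
  proof
    fix z assume "z \<in> ?r"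
    then obtain p y where p: "p \<in> fst c" "p \<in> fst d" "y \<noteq> 0" "z = (snd c p, y)" by auto
    have "(p, coord_vec atl c y p) \<in> fst (slit_chart atl c) \<inter> fst (slit_chart atl d)"
      using slit_chart_coord_vec[OF assms p(1,3)] p by (simp add: slit_chart_iff)
    then show "z \<in> ?l" using slit_chart_coord_vec(2)[OF assms p(1,3)] p(4) by (metis image_eqI)
  qed
qed

lemma slit_chart_range: "c \<in> atl \<Longrightarrow> snd (slit_chart atl c) ` fst (slit_chart atl c) = snd c ` fst c \<times> (- {0})"
  using slit_chart_image[of c c] by simp

lemma slit_transition:
  assumes "c \<in> atl" "d \<in> atl" "x \<in> snd c ` (fst c \<inter> fst d)" "y \<noteq> 0"
  shows "(snd (slit_chart atl d) \<circ> inv_chart (slit_chart atl c)) (x, y)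
    = ((snd d \<circ> inv_chart c) x, dir_deriv (snd d \<circ> inv_chart c) x y)"
proof -
  obtain p where p: "p \<in> fst c" "p \<in> fst d" "x = snd c p" using assms by auto
  then show ?thesis
    using assms by (auto simp: slit_inv_chart slit_chart_apply inv_chart_chart coord_vec_def)
qed

lemma slit_overlap_open:
  "c \<in> atl \<Longrightarrow> d \<in> atl \<Longrightarrow> open (snd c ` (fst c \<inter> fst d) \<times> (- {0::'e}))"
  by (intro open_Times open_overlap) auto

text \<open>The transition maps send (x, y) to (t x, dt_x y). The second component is smooth
  because, in a basis, it is a sum of coordinates of y times derivatives of t in fixed
  directions.\<close>

lemma slit_atlas: "smooth_atlas (slit_atlas atl)"
proof
  fix c' assume "c' \<in> slit_atlas atl"
  then obtain c where c: "c \<in> atl" and c': "c' = slit_chart atl c" by (auto simp: slit_atlas_def)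
  show "inj_on (snd c') (fst c')" using slit_chart_inj c c' by simp
  fix d' assume "d' \<in> slit_atlas atl"
  then obtain d where d: "d \<in> atl" and d': "d' = slit_chart atl d" by (auto simp: slit_atlas_def)
  show "open (snd c' ` (fst c' \<inter> fst d'))"
    using slit_overlap_open c d by (simp add: c' d' slit_chart_image)
  let ?S = "snd c ` (fst c \<inter> fst d)" and ?t = "snd d \<circ> inv_chart c"
  have op: "open (?S \<times> (- {0::'e}))" using slit_overlap_open c d by blast
  note t = smooth_transition[OF c d]
  have "smooth_on (?S \<times> (- {0})) (\<lambda>z. (?t (fst z), \<Sum>b\<in>Basis. (snd z \<bullet> b) *\<^sub>R dir_deriv ?t (fst z) b))"
    by (intro smooth_on_Pair op smooth_on_sum smooth_on_bilinear[OF bounded_bilinear_scaleR]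
        smooth_on_bilinear[OF bounded_bilinear_inner] smooth_on_const
        smooth_on_compose[OF smooth_on_bounded_linear[OF bounded_linear_fst] t]
        smooth_on_compose[OF smooth_on_bounded_linear[OF bounded_linear_fst] smooth_on_dir_deriv[OF t]]
        smooth_on_bounded_linear[OF bounded_linear_snd] open_overlap c d) auto
  then have "smooth_on (?S \<times> (- {0})) (snd d' \<circ> inv_chart c')"
  proof (rule smooth_on_cong[OF op, rotated])
    fix z assume z: "z \<in> ?S \<times> (- {0::'e})"
    then have "(\<Sum>b\<in>Basis. (snd z \<bullet> b) *\<^sub>R dir_deriv ?t (fst z) b) = dir_deriv ?t (fst z) (snd z)"
      using linear_eq_sum_Basis[OF linear_dir_deriv[OF smooth_on_imp_differentiable[OF t]], of "fst z" "snd z"]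
      by auto
    then show "(?t (fst z), \<Sum>b\<in>Basis. (snd z \<bullet> b) *\<^sub>R dir_deriv ?t (fst z) b) = (snd d' \<circ> inv_chart c') z"
      using slit_transition[OF c d, of "fst z" "snd z"] z by (force simp: c' d')
  qed
  then show "smooth_on (snd c' ` (fst c' \<inter> fst d')) (snd d' \<circ> inv_chart c')"
    using c by (simp add: c' d' slit_chart_image)
qed

text \<open>The base part of a tangent vector transforms by dt alone, while its fibre part also
  picks up a second derivative of t applied to the base part. This is why \<open>rho\<close> and the
  vertical vectors make sense independently of charts, but a horizontal complement requires a
  connection.\<close>

lemma slit_transition_deriv:
  assumes c: "c \<in> atl" and d: "d \<in> atl" and x: "x \<in> snd c ` (fst c \<inter> fst d)" and y: "y \<noteq> 0"
  shows "dir_deriv (snd (slit_chart atl d) \<circ> inv_chart (slit_chart atl c)) (x, y) (a, b)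
    = (dir_deriv (snd d \<circ> inv_chart c) x a,
       dir_deriv (\<lambda>x. dir_deriv (snd d \<circ> inv_chart c) x y) x a + dir_deriv (snd d \<circ> inv_chart c) x b)"
proof -
  let ?S = "snd c ` (fst c \<inter> fst d)" and ?t = "snd d \<circ> inv_chart c"
  note t = smooth_transition[OF c d]
  have z: "(x, y) \<in> ?S \<times> (- {0})" using x y by auto
  have t1: "?t differentiable (at (fst (x, y)))" using smooth_on_imp_differentiable[OF t x] by simp
  have t2: "(\<lambda>x. dir_deriv ?t x b) differentiable (at (fst (x, y)))" for b
    using smooth_on_imp_differentiable[OF smooth_on_dir_deriv[OF t] x] by simp
  have f: "(fst :: 'e \<times> 'e \<Rightarrow> 'e) differentiable at (x, y)" "(snd :: 'e \<times> 'e \<Rightarrow> 'e) differentiable at (x, y)"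
    by (auto intro!: bounded_linear_imp_differentiable bounded_linear_fst bounded_linear_snd)
  have df: "dir_deriv (fst :: 'e \<times> 'e \<Rightarrow> 'e) (x, y) = fst" "dir_deriv (snd :: 'e \<times> 'e \<Rightarrow> 'e) (x, y) = snd"
    by (auto intro!: dir_deriv_eqI bounded_linear_imp_has_derivative bounded_linear_fst bounded_linear_snd)
  have d1: "((\<lambda>z. ?t (fst z)) has_derivative (\<lambda>v. dir_deriv ?t x (fst v))) (at (x, y))"
    using has_derivative_compose[OF has_dir_deriv[OF f(1)] has_dir_deriv[OF t1]] by (simp add: df)
  have d2: "dir_deriv (\<lambda>z. dir_deriv ?t (fst z) w) (x, y) v = dir_deriv (\<lambda>x. dir_deriv ?t x w) x (fst v)" for v w
    using dir_deriv_compose[OF f(1) t2] by (simp add: df)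
  have d3: "((\<lambda>z. dir_deriv ?t (fst z) (snd z)) has_derivative
      (\<lambda>v. dir_deriv (\<lambda>x. dir_deriv ?t x y) x (fst v) + dir_deriv ?t x (snd v))) (at (x, y))"
  proof -
    have lin: "linear (dir_deriv ?t (fst z))" if "z \<in> ?S \<times> (- {0::'e})" for z
      using that by (intro linear_dir_deriv smooth_on_imp_differentiable[OF t]) auto
    have "(\<lambda>z. dir_deriv ?t (fst z) b) differentiable (at (x, y))" for b
      using differentiable_chain_at[OF f(1) t2] by (simp only: o_def)
    from has_derivative_linear_family[OF slit_overlap_open[OF c d] z lin this f(2)]
    show ?thesis by (simp only: df d2 fst_conv snd_conv)
  qed
  have "((\<lambda>z. (?t (fst z), dir_deriv ?t (fst z) (snd z))) has_derivative
      (\<lambda>v. (dir_deriv ?t x (fst v), dir_deriv (\<lambda>x. dir_deriv ?t x y) x (fst v) + dir_deriv ?t x (snd v)))) (at (x, y))"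
    by (rule has_derivative_Pair[OF d1 d3])
  then have "((snd (slit_chart atl d) \<circ> inv_chart (slit_chart atl c)) has_derivative
      (\<lambda>v. (dir_deriv ?t x (fst v), dir_deriv (\<lambda>x. dir_deriv ?t x y) x (fst v) + dir_deriv ?t x (snd v)))) (at (x, y))"
    by (rule has_derivative_transform_within_open[OF _ slit_overlap_open[OF c d] z])
      (use slit_transition[OF c d, of "fst z" "snd z" for z] in force)
  then show ?thesis by (simp add: dir_deriv_eqI)
qed

end

locale manifold_atlas =
  fixes M :: "'a topology" and atl :: "('a, 'e::euclidean_space) chart set"
  assumes manifold: "smooth_manifold M atl"

sublocale manifold_atlas \<subseteq> smooth_atlas atl
proof
  fix c assume c: "c \<in> atl"
  have U: "openin M (fst c)" and h: "homeomorphic_map (subtopology M (fst c)) (top_of_set (snd c ` fst c)) (snd c)"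
    and op: "open (snd c ` fst c)"
    using manifold c by (auto simp: smooth_manifold_def)
  have top: "topspace (subtopology M (fst c)) = fst c" using openin_subset[OF U] by auto
  show "inj_on (snd c) (fst c)" using homeomorphic_imp_injective_map[OF h] top by simp
  fix d assume d: "d \<in> atl"
  have "openin M (fst d)" using manifold d by (auto simp: smooth_manifold_def)
  then have "openin (subtopology M (fst c)) (fst c \<inter> fst d)"
    by (auto simp: openin_subtopology)
  then have "openin (top_of_set (snd c ` fst c)) (snd c ` (fst c \<inter> fst d))"
    using homeomorphic_imp_open_map[OF h] by (simp add: open_map_def)
  then show "open (snd c ` (fst c \<inter> fst d))" using op openin_open_trans by blast
  show "smooth_on (snd c ` (fst c \<inter> fst d)) (snd d \<circ> inv_chart c)"
    using manifold c d by (auto simp: smooth_manifold_def)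
qed

sublocale manifold_atlas \<subseteq> slit: smooth_atlas "slit_atlas atl"
  by (rule slit_atlas)

section \<open>Vertical lift, projection and J in coordinates\<close>

context manifold_atlas
begin

lemma slit_chart_in: "c \<in> atl \<Longrightarrow> slit_chart atl c \<in> slit_atlas atl"
  by (simp add: slit_atlas_def)

lemma slit_tangentI:
  assumes "\<And>c'. c' \<notin> slit_atlas atl \<or> u \<notin> fst c' \<Longrightarrow> \<xi> c' = 0"
    and "\<And>c d. c \<in> atl \<Longrightarrow> d \<in> atl \<Longrightarrow> u \<in> fst (slit_chart atl c) \<Longrightarrow> u \<in> fst (slit_chart atl d) \<Longrightarrow>
      \<xi> (slit_chart atl d) = dir_deriv (snd (slit_chart atl d) \<circ> inv_chart (slit_chart atl c))
        (snd (slit_chart atl c) u) (\<xi> (slit_chart atl c))"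
  shows "\<xi> \<in> tangent_space (slit_atlas atl) u"
proof (rule slit.tangent_spaceI)
  show "\<xi> c = 0" if "\<not> (c \<in> slit_atlas atl \<and> u \<in> fst c)" for c
    using assms(1)[of c] that by auto
  fix c d assume "c \<in> slit_atlas atl" "u \<in> fst c" "d \<in> slit_atlas atl" "u \<in> fst d"
  then obtain c0 d0 where "c0 \<in> atl" "d0 \<in> atl" "c = slit_chart atl c0" "d = slit_chart atl d0"
    "u \<in> fst c" "u \<in> fst d"
    by (auto simp: slit_atlas_def)
  then show "\<xi> d = dir_deriv (snd d \<circ> inv_chart c) (snd c u) (\<xi> c)"
    using assms(2)[of c0 d0] by simp
qed

lemma slit_transition_deriv':
  assumes "c \<in> atl" "d \<in> atl" "u \<in> fst (slit_chart atl c)" "u \<in> fst (slit_chart atl d)"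
  shows "dir_deriv (snd (slit_chart atl d) \<circ> inv_chart (slit_chart atl c)) (snd (slit_chart atl c) u) (a, b)
    = (dir_deriv (snd d \<circ> inv_chart c) (snd c (fst u)) a,
       dir_deriv (\<lambda>x. dir_deriv (snd d \<circ> inv_chart c) x (snd u c)) (snd c (fst u)) a
       + dir_deriv (snd d \<circ> inv_chart c) (snd c (fst u)) b)"
  using slit_transition_deriv[OF assms(1,2), of "snd c (fst u)" "snd u c"]
    assms slit_coords_nonzero[OF assms(1,3)]
  by (auto simp: slit_chart_apply slit_chart_iff)

lemma gam_coords:
  assumes "c \<in> atl" "u \<in> fst (slit_chart atl c)"
  shows "gam atl u v (slit_chart atl c) = (0, v c)"
proof -
  have "((snd (slit_chart atl c) \<circ> (\<lambda>t. (fst u, snd u + t *\<^sub>R v))) has_vector_derivative (0, v c)) (at 0)"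
    unfolding has_vector_derivative_def o_def slit_chart_apply
    by (auto intro!: derivative_eq_intros)
  then show ?thesis
    using assms by (simp add: gam_def velocity_def slit_chart_in vector_derivative_at)
qed

lemma gam_tangent:
  assumes "u \<in> slit atl" "v \<in> tangent_space atl (fst u)"
  shows "gam atl u v \<in> tangent_space (slit_atlas atl) u"
proof (rule slit_tangentI)
  show "gam atl u v c' = 0" if "c' \<notin> slit_atlas atl \<or> u \<notin> fst c'" for c'
    using that by (auto simp: gam_def velocity_def)
  fix c d assume c: "c \<in> atl" "u \<in> fst (slit_chart atl c)" and d: "d \<in> atl" "u \<in> fst (slit_chart atl d)"
  have p: "fst u \<in> fst c" "fst u \<in> fst d" using c d by (auto simp: slit_chart_iff)
  \<comment> \<open>For a vertical vector the second-derivative term of the transition is evaluated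
    at the base part 0 and vanishes.\<close>
  show "gam atl u v (slit_chart atl d) = dir_deriv (snd (slit_chart atl d) \<circ> inv_chart (slit_chart atl c))
        (snd (slit_chart atl c) u) (gam atl u v (slit_chart atl c))"
    unfolding gam_coords[OF c] gam_coords[OF d] slit_transition_deriv'[OF c(1) d(1) c(2) d(2)]
    using linear_0[OF linear_dir_deriv[OF smooth_on_imp_differentiable[OF smooth_on_dir_deriv[OF smooth_transition[OF c(1) d(1)]]]],
        of "snd c (fst u)" "snd u c"]
      linear_0[OF linear_transition[OF c(1) p(1) d(1) p(2)]] tangent_transition[OF assms(2) c(1) p(1) d(1) p(2)] p
    by auto
qed

lemma rho_coords:
  assumes c: "c \<in> atl" "u \<in> fst (slit_chart atl c)" and \<xi>: "\<xi> \<in> tangent_space (slit_atlas atl) u"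
  shows "rho atl u \<xi> c = fst (\<xi> (slit_chart atl c))"
proof -
  define b' where "b' = chart_at (slit_atlas atl) u"
  have b': "b' \<in> slit_atlas atl" "u \<in> fst b'"
    using slit.chart_at[OF slit_chart_in[OF c(1)] c(2)] by (auto simp: b'_def)
  then obtain b where b: "b \<in> atl" "b' = slit_chart atl b" by (auto simp: slit_atlas_def)
  have ub: "u \<in> fst (slit_chart atl b)" using b' b by simp
  have p: "fst u \<in> fst c" "fst u \<in> fst b" using c ub by (auto simp: slit_chart_iff)
  obtain a1 a2 where a: "\<xi> b' = (a1, a2)" by (cases "\<xi> b'")
  let ?t = "snd (slit_chart atl c) \<circ> inv_chart b'"
  have "rho atl u \<xi> c = dir_deriv (snd c \<circ> fst \<circ> inv_chart b') (snd b' u) (\<xi> b')"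
    using c p by (simp add: rho_def tangent_map_def b'_def Let_def)
  \<comment> \<open>\<open>tangent_map\<close> works in an unspecified chart b'. Read through b',
    the base coordinate in c is the first component of a transition map of the slit bundle, and that
    map carries \<xi> to the chart of c.\<close>
  also have "snd c \<circ> fst \<circ> inv_chart b' = (\<lambda>z. fst (?t z))"
    by (simp add: o_def slit_chart_apply)
  also have "dir_deriv \<dots> (snd b' u) (\<xi> b') = fst (dir_deriv ?t (snd b' u) (\<xi> b'))"
    by (rule dir_deriv_linear[OF bounded_linear_fst slit.chart_differentiable[OF b' slit_chart_in[OF c(1)] c(2)]])
  also have "\<dots> = fst (\<xi> (slit_chart atl c))"
    using slit.tangent_transition[OF \<xi> b' slit_chart_in[OF c(1)] c(2)] by simp
  finally show ?thesis .
qed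

lemma slit_chart_obtain:
  assumes "u \<in> slit atl" obtains c where "c \<in> atl" "u \<in> fst (slit_chart atl c)"
  using assms by (auto simp: slit_def tangent_bundle_def slit_chart_iff)

lemma rho_tangent:
  assumes "u \<in> slit atl" "\<xi> \<in> tangent_space (slit_atlas atl) u"
  shows "rho atl u \<xi> \<in> tangent_space atl (fst u)"
proof -
  have "rho atl u \<xi> d = dir_deriv (snd d \<circ> inv_chart c) (snd c (fst u)) (rho atl u \<xi> c)"
    if "c \<in> atl" "d \<in> atl" "fst u \<in> fst c" "fst u \<in> fst d" for c d
  proof -
    have u: "u \<in> fst (slit_chart atl c)" "u \<in> fst (slit_chart atl d)"
      using that assms by (auto simp: slit_chart_iff)
    obtain a b where ab: "\<xi> (slit_chart atl c) = (a, b)" by (cases "\<xi> (slit_chart atl c)")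
    show ?thesis
      using slit.tangent_transition[OF assms(2) slit_chart_in[OF that(1)] u(1) slit_chart_in[OF that(2)] u(2)]
      unfolding rho_coords[OF that(1) u(1) assms(2)] rho_coords[OF that(2) u(2) assms(2)] ab
        slit_transition_deriv'[OF that(1,2) u] by simp
  qed
  then show ?thesis
    by (rule_tac tangent_spaceI) (simp add: rho_def tangent_map_def, blast)
qed

lemma JJ_coords:
  assumes "c \<in> atl" "u \<in> fst (slit_chart atl c)" "\<xi> \<in> tangent_space (slit_atlas atl) u"
  shows "JJ atl u \<xi> (slit_chart atl c) = (0, fst (\<xi> (slit_chart atl c)))"
  using assms by (simp add: JJ_def gam_coords rho_coords)

lemma JJ_tangent:
  "u \<in> slit atl \<Longrightarrow> \<xi> \<in> tangent_space (slit_atlas atl) u \<Longrightarrow> JJ atl u \<xi> \<in> tangent_space (slit_atlas atl) u"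
  by (simp add: JJ_def gam_tangent rho_tangent)

end

context smooth_atlas
begin

lemma smooth_in_chart_change:
  assumes "c \<in> atl" "d \<in> atl" "smooth_in_chart c f"
  shows "smooth_on (snd d ` (fst c \<inter> fst d)) (f \<circ> inv_chart d)"
proof (rule smooth_on_cong)
  have sw: "fst c \<inter> fst d = fst d \<inter> fst c" by auto
  show "open (snd d ` (fst c \<inter> fst d))" unfolding sw by (rule open_overlap[OF assms(2,1)])
  show "smooth_on (snd d ` (fst c \<inter> fst d)) (\<lambda>x. (f \<circ> inv_chart c) ((snd c \<circ> inv_chart d) x))"
    unfolding sw
    by (rule smooth_on_compose[OF smooth_transition[OF assms(2,1)] _ open_overlap[OF assms(2,1)] open_chart[OF assms(1)]])
      (use assms in \<open>auto simp: smooth_in_chart_def inv_chart_chart o_def\<close>)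
qed (use assms in \<open>auto simp: inv_chart_chart\<close>)

lemma smooth_coord_vec:
  assumes "c \<in> atl" "d \<in> atl"
  shows "smooth_on (snd d ` (fst c \<inter> fst d)) ((\<lambda>p. coord_vec atl c e p d) \<circ> inv_chart d)"
proof (rule smooth_on_cong)
  have sw: "fst c \<inter> fst d = fst d \<inter> fst c" by auto
  show "open (snd d ` (fst c \<inter> fst d))" unfolding sw by (rule open_overlap[OF assms(2,1)])
  show "smooth_on (snd d ` (fst c \<inter> fst d)) (\<lambda>x. dir_deriv (snd d \<circ> inv_chart c) ((snd c \<circ> inv_chart d) x) e)"
    unfolding sw
    by (rule smooth_on_compose[OF smooth_transition[OF assms(2,1)] smooth_on_dir_deriv[OF smooth_transition[OF assms]]
          open_overlap[OF assms(2,1)] open_overlap[OF assms]])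
      (use assms in \<open>auto simp: inv_chart_chart\<close>)
qed (use assms in \<open>auto simp: inv_chart_chart coord_vec_def\<close>)

end

context manifold_atlas
begin

section \<open>Cutoff functions\<close>

lemma chart_image_open:
  assumes "c \<in> atl" "openin M W" "W \<subseteq> fst c"
  shows "open (snd c ` W)"
proof -
  have h: "homeomorphic_map (subtopology M (fst c)) (top_of_set (snd c ` fst c)) (snd c)"
    using manifold assms by (auto simp: smooth_manifold_def)
  have "openin (subtopology M (fst c)) W"
    using assms by (auto simp: openin_subtopology)
  then have "openin (top_of_set (snd c ` fst c)) (snd c ` W)"
    using homeomorphic_imp_open_map[OF h] by (simp add: open_map_def)
  then show ?thesis using open_chart[OF assms(1)] openin_open_trans by blast
qed

text \<open>B is the base region over which the function is 1. The last clause asks for more than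
  vanishing outside the chart: around each such point the function is 0 on an open set, which is
  expressed in coordinates for want of a topology on the slit bundle. This is what makes extension
  by zero smooth.\<close>

definition cutoff :: "('a, 'e) chart \<Rightarrow> 'e set \<Rightarrow> (('a, 'e) tpoint \<Rightarrow> real) \<Rightarrow> bool" where
  "cutoff c B \<phi> \<longleftrightarrow> open B \<and> B \<subseteq> snd c ` fst c \<and>
     (\<forall>u. u \<notin> fst (slit_chart atl c) \<longrightarrow> \<phi> u = 0) \<and>
     (\<forall>u\<in>fst (slit_chart atl c). snd c (fst u) \<in> B \<longrightarrow> \<phi> u = 1) \<and>
     (\<forall>d\<in>atl. smooth_on (snd (slit_chart atl d) ` (fst (slit_chart atl c) \<inter> fst (slit_chart atl d)))
          (\<phi> \<circ> inv_chart (slit_chart atl d)) \<and>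
        (\<forall>u\<in>fst (slit_chart atl d) - fst (slit_chart atl c). \<exists>T. open T \<and> snd (slit_chart atl d) u \<in> T \<and>
          (\<forall>w\<in>fst (slit_chart atl d). snd (slit_chart atl d) w \<in> T \<longrightarrow> \<phi> w = 0)))"

lemma cutoff_outside: "cutoff c B \<phi> \<Longrightarrow> u \<notin> fst (slit_chart atl c) \<Longrightarrow> \<phi> u = 0"
  unfolding cutoff_def by blast

text \<open>A plateau function is pulled back from the base along the chart. It vanishes off the
  preimage K of a closed ball; K is compact, hence closed in the Hausdorff space M, so a point
  outside the chart has a neighbourhood that avoids K.\<close>

lemma cutoff_exists:
  assumes c: "c \<in> atl" "p \<in> fst c"
  obtains B \<phi> where "cutoff c B \<phi>" "snd c p \<in> B"
proof -
  let ?V = "snd c ` fst c"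
  obtain r0 where r0: "r0 > 0" "ball (snd c p) r0 \<subseteq> ?V"
    using open_contains_ball open_chart[OF c(1)] c(2) by blast
  \<comment> \<open>The closed ball of radius 2r, outside of which the plateau function vanishes,
    then still fits into the chart.\<close>
  define r where "r = r0 / 3"
  have r: "r > 0" "cball (snd c p) (2 * r) \<subseteq> ?V" "ball (snd c p) r \<subseteq> ?V"
    using r0 by (auto simp: r_def subset_iff)
  obtain f where f: "smooth_on UNIV f" "\<And>y. dist y (snd c p) < r \<Longrightarrow> f y = (1::real)"
    "\<And>y. dist y (snd c p) \<ge> 2 * r \<Longrightarrow> f y = 0"
    using plateau_function[OF r(1)] by blast
  define \<phi> where "\<phi> u = (if u \<in> fst (slit_chart atl c) then f (snd c (fst u)) else 0)" for u
  define K where "K = inv_chart c ` cball (snd c p) (2 * r)"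
  have K: "K \<subseteq> fst c" "snd c ` K = cball (snd c p) (2 * r)"
    using r(2) by (auto simp: K_def inv_into_into f_inv_into_f image_image subset_iff)
  have U: "openin M (fst c)" and h: "homeomorphic_map (subtopology M (fst c)) (top_of_set ?V) (snd c)"
    using manifold c by (auto simp: smooth_manifold_def)
  have "compactin (top_of_set ?V) (snd c ` K)"
    using K r by (simp add: compactin_subtopology)
  then have "compactin (subtopology M (fst c)) K"
    using homeomorphic_map_compactness[OF h, of K] K openin_subset[OF U] by auto
  then have "compactin M K" by (simp add: compactin_subtopology)
  then have closed: "closedin M K"
    using manifold by (auto simp: smooth_manifold_def compactin_imp_closedin)
  have out: "f (snd c q) = 0" if "q \<in> fst c" "q \<notin> K" for q
  proof (rule f(3), rule ccontr)
    assume "\<not> 2 * r \<le> dist (snd c q) (snd c p)"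
    then have "snd c q \<in> cball (snd c p) (2 * r)" by (simp add: dist_commute)
    then have "q \<in> K" unfolding K_def using inv_chart_chart[OF c(1) that(1)] by (metis image_eqI)
    then show False using that by simp
  qed
  have smooth: "smooth_on (snd (slit_chart atl d) ` (fst (slit_chart atl c) \<inter> fst (slit_chart atl d)))
          (\<phi> \<circ> inv_chart (slit_chart atl d))" if d: "d \<in> atl" for d
  proof -
    let ?S = "snd d ` (fst d \<inter> fst c)"
    have im: "snd (slit_chart atl d) ` (fst (slit_chart atl c) \<inter> fst (slit_chart atl d)) = ?S \<times> (- {0})"
      using slit_chart_image[OF d, of c] by (simp add: Int_commute)
    have "smooth_on (?S \<times> (- {0::'e})) (\<lambda>z. (snd c \<circ> inv_chart d) (fst z))"
      by (rule smooth_on_compose[OF smooth_on_bounded_linear[OF bounded_linear_fst] smooth_transition[OF d c(1)]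
            slit_overlap_open[OF d c(1)] open_overlap[OF d c(1)]]) auto
    then have "smooth_on (?S \<times> (- {0::'e})) (\<lambda>z. f ((snd c \<circ> inv_chart d) (fst z)))"
      by (rule smooth_on_compose[OF _ f(1) slit_overlap_open[OF d c(1)]]) auto
    then show ?thesis unfolding im
    proof (rule smooth_on_cong[OF slit_overlap_open[OF d c(1)], rotated])
      fix z assume "z \<in> ?S \<times> (- {0::'e})"
      then obtain q y where q: "q \<in> fst d" "q \<in> fst c" "y \<noteq> 0" "z = (snd d q, y)" by auto
      then show "f ((snd c \<circ> inv_chart d) (fst z)) = (\<phi> \<circ> inv_chart (slit_chart atl d)) z"
        using d slit_chart_coord_vec(1)[OF d q(1) q(3)]
        by (simp add: \<phi>_def slit_inv_chart inv_chart_chart slit_chart_iff)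
    qed
  qed
  have zero: "\<exists>T. open T \<and> snd (slit_chart atl d) u \<in> T \<and>
          (\<forall>w\<in>fst (slit_chart atl d). snd (slit_chart atl d) w \<in> T \<longrightarrow> \<phi> w = 0)"
    if d: "d \<in> atl" and u: "u \<in> fst (slit_chart atl d)" "u \<notin> fst (slit_chart atl c)" for d u
  proof (intro exI conjI ballI impI)
    have "openin M (fst d)" using manifold d by (auto simp: smooth_manifold_def)
    then show "open (snd d ` (fst d - K) \<times> (UNIV :: 'e set))"
      using closed by (intro open_Times chart_image_open[OF d] openin_diff) auto
    show "snd (slit_chart atl d) u \<in> snd d ` (fst d - K) \<times> UNIV"
      using u K(1) by (auto simp: slit_chart_apply slit_chart_iff)
    fix w assume w: "w \<in> fst (slit_chart atl d)" "snd (slit_chart atl d) w \<in> snd d ` (fst d - K) \<times> UNIV"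
    then obtain q where "q \<in> fst d" "q \<notin> K" "snd d (fst w) = snd d q"
      by (auto simp: slit_chart_apply)
    then have "fst w \<notin> K"
      using inj_onD[OF inj_chart[OF d]] w by (auto simp: slit_chart_iff)
    then show "\<phi> w = 0" using out by (auto simp: \<phi>_def slit_chart_iff)
  qed
  have "cutoff c (ball (snd c p) r) \<phi>"
    unfolding cutoff_def using r(3) smooth zero f(2)
    by (auto simp: \<phi>_def dist_commute)
  then show ?thesis using that r(1) by force
qed

text \<open>Extension by zero of a map that is only known to be smooth over c. Over the overlap it
  is a product of smooth maps, and near any other point the cutoff is identically 0.\<close>

lemma cutoff_extend:
  assumes \<phi>: "cutoff c B \<phi>" and c: "c \<in> atl" and d: "d \<in> atl"
    and f: "smooth_on (snd (slit_chart atl d) ` (fst (slit_chart atl c) \<inter> fst (slit_chart atl d)))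
      (f \<circ> inv_chart (slit_chart atl d))"
  shows "smooth_in_chart (slit_chart atl d) (\<lambda>w. \<phi> w *\<^sub>R f w)"
  unfolding smooth_in_chart_def
proof (rule smooth_on_local)
  let ?d = "slit_chart atl d" and ?O = "snd (slit_chart atl d) ` (fst (slit_chart atl c) \<inter> fst (slit_chart atl d))"
  have opO: "open ?O"
    using slit.open_overlap[OF slit_chart_in[OF d] slit_chart_in[OF c]] by (simp add: Int_commute)
  have opd: "open (snd ?d ` fst ?d)" by (rule slit.open_chart[OF slit_chart_in[OF d]])
  fix z assume "z \<in> snd ?d ` fst ?d"
  then obtain u where u: "u \<in> fst ?d" "z = snd ?d u" by auto
  show "\<exists>T. open T \<and> z \<in> T \<and> smooth_on T ((\<lambda>w. \<phi> w *\<^sub>R f w) \<circ> inv_chart ?d)"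
  proof (cases "u \<in> fst (slit_chart atl c)")
    case True
    have "smooth_on ?O (\<lambda>z. (\<phi> \<circ> inv_chart ?d) z *\<^sub>R (f \<circ> inv_chart ?d) z)"
      using \<phi> d by (intro smooth_on_bilinear[OF bounded_bilinear_scaleR _ f opO]) (auto simp: cutoff_def o_def)
    moreover have "z \<in> ?O" using True u by simp
    ultimately show ?thesis using opO by (intro exI[of _ ?O]) (simp add: o_def)
  next
    case False
    then have "u \<in> fst ?d - fst (slit_chart atl c)" using u by simp
    moreover have "\<forall>u\<in>fst ?d - fst (slit_chart atl c). \<exists>T. open T \<and> snd ?d u \<in> T \<and>
          (\<forall>w\<in>fst ?d. snd ?d w \<in> T \<longrightarrow> \<phi> w = 0)"
      using \<phi> d unfolding cutoff_def by simp
    ultimately obtain T where T: "open T" "snd ?d u \<in> T" "\<forall>w\<in>fst ?d. snd ?d w \<in> T \<longrightarrow> \<phi> w = 0"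
      by blast
    have "smooth_on (T \<inter> snd ?d ` fst ?d) ((\<lambda>w. \<phi> w *\<^sub>R f w) \<circ> inv_chart ?d)"
      by (rule smooth_on_cong[OF _ _ smooth_on_const[of _ 0]])
        (use T opd slit.inv_chart_chart[OF slit_chart_in[OF d]] in auto)
    then show ?thesis using T opd u by (intro exI[of _ "T \<inter> snd ?d ` fst ?d"]) auto
  qed
qed

lemma cutoff_smooth:
  assumes "cutoff c B \<phi>" "c \<in> atl" shows "smooth_fun (slit_atlas atl) \<phi>"
  using cutoff_extend[OF assms, of _ "\<lambda>_. 1::real"] smooth_on_const[of _ "1::real"]
  by (auto simp: smooth_fun_def slit_atlas_def o_def)

text \<open>The coordinate frame of c made global, because a connection accepts only fields on the
  whole slit bundle.\<close>

definition frame_field :: "('a, 'e) chart \<Rightarrow> (('a, 'e) tpoint \<Rightarrow> real) \<Rightarrow> 'e \<Rightarrow> ('a, 'e) tpoint \<Rightarrow> ('a, 'e) tvec" where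
  "frame_field c \<phi> e = (\<lambda>w. \<phi> w *\<^sub>R coord_vec atl c e (fst w))"

lemma frame_field_pi_field:
  assumes \<phi>: "cutoff c B \<phi>" and c: "c \<in> atl"
  shows "pi_field atl (frame_field c \<phi> e)"
  unfolding pi_field_def
proof (intro conjI ballI)
  fix u assume "u \<in> slit atl"
  show "frame_field c \<phi> e u \<in> tangent_space atl (fst u)"
  proof (cases "u \<in> fst (slit_chart atl c)")
    case True
    then show ?thesis using c
      by (auto simp: frame_field_def slit_chart_iff intro!: tangent_scaleR coord_vec_tangent)
  next
    case False
    then show ?thesis using cutoff_outside[OF \<phi>] tangent_zero by (simp add: frame_field_def)
  qed
next
  fix d assume d: "d \<in> atl"
  let ?S = "snd d ` (fst c \<inter> fst d)"
  have opS: "open (?S \<times> (- {0::'e}))" "open ?S"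
    using slit_overlap_open[OF d c] open_overlap[OF d c] by (simp_all add: Int_commute)
  have im: "snd (slit_chart atl d) ` (fst (slit_chart atl c) \<inter> fst (slit_chart atl d)) = ?S \<times> (- {0})"
    using slit_chart_image[OF d, of c] by (simp add: Int_commute)
  have "smooth_on (?S \<times> (- {0::'e})) (\<lambda>z. ((\<lambda>p. coord_vec atl c e p d) \<circ> inv_chart d) (fst z))"
    by (rule smooth_on_compose[OF smooth_on_bounded_linear[OF bounded_linear_fst] smooth_coord_vec[OF c d] opS]) auto
  then have "smooth_on (?S \<times> (- {0})) ((\<lambda>w. coord_vec atl c e (fst w) d) \<circ> inv_chart (slit_chart atl d))"
  proof (rule smooth_on_cong[OF opS(1), rotated])
    fix z assume "z \<in> ?S \<times> (- {0::'e})"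
    then obtain q y where "q \<in> fst d" "y \<noteq> 0" "z = (snd d q, y)" by auto
    then show "((\<lambda>p. coord_vec atl c e p d) \<circ> inv_chart d) (fst z)
        = ((\<lambda>w. coord_vec atl c e (fst w) d) \<circ> inv_chart (slit_chart atl d)) z"
      using d by (simp add: slit_inv_chart)
  qed
  from cutoff_extend[OF \<phi> c d this[folded im]]
  show "smooth_in_chart (slit_chart atl d) (\<lambda>u. frame_field c \<phi> e u d)"
    by (simp add: frame_field_def)
qed

lemma frame_field_coords:
  assumes "cutoff c B \<phi>" "c \<in> atl" "u \<in> fst (slit_chart atl c)" "snd c (fst u) \<in> B"
  shows "frame_field c \<phi> e u c = e"
  using assms by (auto simp: frame_field_def cutoff_def coord_vec_self slit_chart_iff)

text \<open>The defining conditions of sprays and connections quantify over fields, while the proof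
  tests them on single tangent vectors; this lemma and the next one bridge the gap.\<close>

lemma vector_field_extend:
  assumes u: "u \<in> slit atl" and \<xi>: "\<xi> \<in> tangent_space (slit_atlas atl) u"
  obtains X where "vector_field (slit_atlas atl) X" "X u = \<xi>"
proof -
  obtain c where c: "c \<in> atl" "u \<in> fst (slit_chart atl c)" using slit_chart_obtain[OF u] .
  let ?c = "slit_chart atl c"
  obtain B \<phi> where \<phi>: "cutoff c B \<phi>" "snd c (fst u) \<in> B"
    using cutoff_exists[OF c(1)] c(2) by (auto simp: slit_chart_iff)
  let ?X = "\<lambda>w. \<phi> w *\<^sub>R coord_vec (slit_atlas atl) ?c (\<xi> ?c) w"
  have tan: "?X w \<in> tangent_space (slit_atlas atl) w" for w
  proof (cases "w \<in> fst (slit_chart atl c)")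
    case True
    then show ?thesis by (intro slit.tangent_scaleR slit.coord_vec_tangent slit_chart_in c)
  next
    case False
    then show ?thesis using cutoff_outside[OF \<phi>(1)] slit.tangent_zero by simp
  qed
  have "smooth_in_chart (slit_chart atl d) (\<lambda>w. ?X w (slit_chart atl d))" if "d \<in> atl" for d
    using cutoff_extend[OF \<phi>(1) c(1) that slit.smooth_coord_vec[OF slit_chart_in[OF c(1)] slit_chart_in[OF that]]]
    by simp
  then have "vector_field (slit_atlas atl) ?X"
    using tan by (auto simp: vector_field_def slit_atlas_def)
  moreover have "?X u = \<xi>"
    using slit.coord_vec_coords[OF \<xi> slit_chart_in[OF c(1)] c(2)] \<phi> c by (auto simp: cutoff_def)
  ultimately show ?thesis using that by blast
qed

lemma pi_field_extend:
  assumes u: "u \<in> slit atl" and v: "v \<in> tangent_space atl (fst u)"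
  obtains Y where "pi_field atl Y" "Y u = v"
proof -
  obtain c where c: "c \<in> atl" "u \<in> fst (slit_chart atl c)" using slit_chart_obtain[OF u] .
  obtain B \<phi> where \<phi>: "cutoff c B \<phi>" "snd c (fst u) \<in> B"
    using cutoff_exists[OF c(1)] c(2) by (auto simp: slit_chart_iff)
  have "frame_field c \<phi> (v c) u = v"
    using coord_vec_coords[OF v c(1)] \<phi> c by (auto simp: frame_field_def cutoff_def slit_chart_iff)
  then show ?thesis using that frame_field_pi_field[OF \<phi>(1) c(1)] by blast
qed

section \<open>Linear connections in coordinates\<close>

lemma smooth_fun_chart: "smooth_fun (slit_atlas atl) f \<Longrightarrow> d \<in> atl \<Longrightarrow> smooth_in_chart (slit_chart atl d) f"
  by (simp add: smooth_fun_def slit_chart_in)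

lemma pi_field_smooth:
  "pi_field atl Y \<Longrightarrow> c \<in> atl \<Longrightarrow> smooth_on (snd c ` fst c \<times> (- {0})) ((\<lambda>u. Y u c) \<circ> inv_chart (slit_chart atl c))"
  by (simp add: pi_field_def smooth_in_chart_def slit_chart_range)

lemma pi_field_tangent: "pi_field atl Y \<Longrightarrow> u \<in> slit atl \<Longrightarrow> Y u \<in> tangent_space atl (fst u)"
  by (simp add: pi_field_def)

lemma open_slit_range: "c \<in> atl \<Longrightarrow> open (snd c ` fst c \<times> (- {0::'e}))"
  using slit_overlap_open[of c c] by simp

lemma pi_field_zero: "pi_field atl (\<lambda>w. 0)"
  by (simp add: pi_field_def tangent_zero smooth_in_chart_def o_def smooth_on_const)

lemma pi_field_add: "pi_field atl Y \<Longrightarrow> pi_field atl Z \<Longrightarrow> pi_field atl (\<lambda>w. Y w + Z w)"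
  using smooth_on_add[OF pi_field_smooth pi_field_smooth open_slit_range]
  by (auto simp: pi_field_def tangent_add smooth_in_chart_def slit_chart_range o_def)

lemma pi_field_scale:
  assumes f: "smooth_fun (slit_atlas atl) f" and Y: "pi_field atl Y"
  shows "pi_field atl (\<lambda>w. f w *\<^sub>R Y w)"
  unfolding pi_field_def
proof (intro conjI ballI)
  show "f u *\<^sub>R Y u \<in> tangent_space atl (fst u)" if "u \<in> slit atl" for u
    by (rule tangent_scaleR[OF pi_field_tangent[OF Y that]])
  fix c assume c: "c \<in> atl"
  have "smooth_on (snd c ` fst c \<times> (- {0})) (f \<circ> inv_chart (slit_chart atl c))"
    using smooth_fun_chart[OF f c] by (simp add: smooth_in_chart_def slit_chart_range[OF c])
  from smooth_on_bilinear[OF bounded_bilinear_scaleR this pi_field_smooth[OF Y c] open_slit_range[OF c]]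
  show "smooth_in_chart (slit_chart atl c) (\<lambda>u. (f u *\<^sub>R Y u) c)"
    by (simp add: smooth_in_chart_def slit_chart_range[OF c] o_def)
qed

lemma pi_field_sum:
  "(\<And>i. i \<in> I \<Longrightarrow> pi_field atl (F i)) \<Longrightarrow> pi_field atl (\<lambda>w. \<Sum>i\<in>I. F i w)"
  by (induction I rule: infinite_finite_induct) (auto simp: pi_field_zero pi_field_add)

context
  fixes D :: "('a, 'e) pi_conn"
  assumes D: "linear_connection atl D"
begin

lemma conn_add:
  "pi_field atl Y \<Longrightarrow> pi_field atl Z \<Longrightarrow> u \<in> slit atl \<Longrightarrow> \<xi> \<in> tangent_space (slit_atlas atl) u \<Longrightarrow>
    D u \<xi> (\<lambda>w. Y w + Z w) = D u \<xi> Y + D u \<xi> Z"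
  using D unfolding linear_connection_def by blast

lemma conn_scale:
  "smooth_fun (slit_atlas atl) f \<Longrightarrow> pi_field atl Y \<Longrightarrow> u \<in> slit atl \<Longrightarrow> \<xi> \<in> tangent_space (slit_atlas atl) u \<Longrightarrow>
    D u \<xi> (\<lambda>w. f w *\<^sub>R Y w) = dfun (slit_atlas atl) f u \<xi> *\<^sub>R Y u + f u *\<^sub>R D u \<xi> Y"
  using D unfolding linear_connection_def by blast

lemma conn_tangent:
  "pi_field atl Y \<Longrightarrow> u \<in> slit atl \<Longrightarrow> \<xi> \<in> tangent_space (slit_atlas atl) u \<Longrightarrow> D u \<xi> Y \<in> tangent_space atl (fst u)"
  using D unfolding linear_connection_def by blast

lemma conn_linear:
  "pi_field atl Y \<Longrightarrow> u \<in> slit atl \<Longrightarrow> linear_on_fibre (tangent_space (slit_atlas atl) u) (\<lambda>\<xi>. D u \<xi> Y)"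
  using D unfolding linear_connection_def by blast

lemma conn_smooth:
  "pi_field atl Y \<Longrightarrow> c \<in> atl \<Longrightarrow> smooth_in_chart (slit_chart atl c)
     (\<lambda>u. D u (coord_vec (slit_atlas atl) (slit_chart atl c) e u) Y c)"
  using D unfolding linear_connection_def by blast

lemma conn_zero:
  assumes "u \<in> slit atl" "\<xi> \<in> tangent_space (slit_atlas atl) u"
  shows "D u \<xi> (\<lambda>w. 0) = 0"
  using conn_add[OF pi_field_zero pi_field_zero assms] by simp

lemma conn_sum:
  assumes u: "u \<in> slit atl" "\<xi> \<in> tangent_space (slit_atlas atl) u"
  shows "(\<And>i. i \<in> I \<Longrightarrow> pi_field atl (F i)) \<Longrightarrow> D u \<xi> (\<lambda>w. \<Sum>i\<in>I. F i w) = (\<Sum>i\<in>I. D u \<xi> (F i))"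
  by (induction I rule: infinite_finite_induct) (auto simp: conn_zero[OF u] conn_add[OF _ _ u] pi_field_sum)

text \<open>With \<phi> the cutoff, \<phi>^2 Y is globally the sum of the coefficients \<phi> Y^b
  times the frame fields \<phi> e_b: one factor makes the coefficient global, the other the frame.
  Near u the cutoff is 1, so D does not distinguish \<phi>^2 Y from Y there, and the Leibniz rule on
  the sum gives the formula.\<close>

lemma conn_coords:
  assumes c: "c \<in> atl" and \<phi>: "cutoff c B \<phi>" and u: "u \<in> fst (slit_chart atl c)" "snd c (fst u) \<in> B"
    and Y: "pi_field atl Y" and \<xi>: "\<xi> \<in> tangent_space (slit_atlas atl) u"
  shows "D u \<xi> Y c = dir_deriv ((\<lambda>w. Y w c) \<circ> inv_chart (slit_chart atl c)) (snd (slit_chart atl c) u) (\<xi> (slit_chart atl c))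
    + (\<Sum>b\<in>Basis. (Y u c \<bullet> b) *\<^sub>R D u \<xi> (frame_field c \<phi> b) c)"
proof -
  let ?c = "slit_chart atl c" and ?z = "snd (slit_chart atl c) u"
  let ?f = "\<lambda>b w. \<phi> w *\<^sub>R (Y w c \<bullet> b)" and ?y = "(\<lambda>w. Y w c) \<circ> inv_chart (slit_chart atl c)"
  have slit: "u \<in> slit atl" using u by (simp add: slit_chart_iff)
  have N: "open (B \<times> (- {0::'e}))" "?z \<in> B \<times> (- {0})"
    using \<phi> u slit_coords_nonzero[OF c u(1)] by (auto simp: cutoff_def slit_chart_apply intro!: open_Times)
  have one: "\<phi> (inv_chart ?c z) = 1" if z: "z \<in> B \<times> (- {0})" for z
  proof -
    have "z \<in> snd ?c ` fst ?c" using z \<phi> unfolding slit_chart_range[OF c] by (auto simp: cutoff_def)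
    then obtain w where w: "w \<in> fst ?c" "z = snd ?c w" by auto
    then show ?thesis
      using \<phi> z slit.inv_chart_chart[OF slit_chart_in[OF c] w(1)] by (auto simp: cutoff_def slit_chart_apply)
  qed
  have \<phi>u: "\<phi> u = 1" using \<phi> u by (auto simp: cutoff_def)
  have dy: "?y differentiable (at ?z)"
    using smooth_on_imp_differentiable[OF pi_field_smooth[OF Y c], of ?z] slit_chart_range[OF c] u(1) by blast
  have smoothY: "smooth_in_chart ?c (\<lambda>w. Y w c \<bullet> b)" for b
    using smooth_on_compose_linear[OF bounded_linear_inner_left pi_field_smooth[OF Y c] open_slit_range[OF c]]
    by (simp add: smooth_in_chart_def slit_chart_range[OF c] o_def)
  have smooth_f: "smooth_fun (slit_atlas atl) (?f b)" for b
    using cutoff_extend[OF \<phi> c _ slit.smooth_in_chart_change[OF slit_chart_in[OF c] slit_chart_in smoothY]]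
    by (auto simp: smooth_fun_def slit_atlas_def)
  have d: "dfun (slit_atlas atl) g u \<xi> = dir_deriv (g \<circ> inv_chart ?c) ?z (\<xi> ?c)"
    if "smooth_fun (slit_atlas atl) g" for g
  proof (rule slit.dfun_eq[OF slit_chart_in[OF c] u(1) \<xi>])
    show "(g \<circ> inv_chart ?c) differentiable (at ?z)"
      using smooth_fun_chart[OF that c] u(1) by (auto simp: smooth_in_chart_def intro: smooth_on_imp_differentiable)
  qed
  \<comment> \<open>The cutoff is constant near u, so the Leibniz rule produces no extra
    term.\<close>
  have dphi: "dfun (slit_atlas atl) \<phi> u \<xi> = 0"
    unfolding d[OF cutoff_smooth[OF \<phi> c]]
    using dir_deriv_cong[OF N, of "\<phi> \<circ> inv_chart ?c" "\<lambda>_. 1" "\<xi> ?c"] one by simp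
  have df: "dfun (slit_atlas atl) (?f b) u \<xi> = dir_deriv ?y ?z (\<xi> ?c) \<bullet> b" for b
    unfolding d[OF smooth_f] dir_deriv_linear[OF bounded_linear_inner_left dy, symmetric]
    by (rule dir_deriv_cong[OF N]) (use one in auto)
  have expand: "(\<lambda>w. \<Sum>b\<in>Basis. ?f b w *\<^sub>R frame_field c \<phi> b w) = (\<lambda>w. \<phi> w *\<^sub>R (\<phi> w *\<^sub>R Y w))"
  proof
    fix w
    show "(\<Sum>b\<in>Basis. ?f b w *\<^sub>R frame_field c \<phi> b w) = \<phi> w *\<^sub>R (\<phi> w *\<^sub>R Y w)"
    proof (cases "w \<in> fst ?c")
      case True
      then have w: "fst w \<in> fst c" "w \<in> slit atl" by (auto simp: slit_chart_iff)
      have "linear (\<lambda>e. coord_vec atl c e (fst w))"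
        using coord_vec_add[OF c w(1)] coord_vec_scaleR[OF c w(1)] by (rule linearI)
      from linear_eq_sum_Basis[OF this, of "Y w c"]
      have "Y w = (\<Sum>b\<in>Basis. (Y w c \<bullet> b) *\<^sub>R coord_vec atl c b (fst w))"
        using coord_vec_coords[OF pi_field_tangent[OF Y w(2)] c w(1)] by simp
      then have "\<phi> w *\<^sub>R (\<phi> w *\<^sub>R Y w) = \<phi> w *\<^sub>R (\<phi> w *\<^sub>R (\<Sum>b\<in>Basis. (Y w c \<bullet> b) *\<^sub>R coord_vec atl c b (fst w)))"
        by simp
      then show ?thesis by (simp add: frame_field_def scaleR_sum_right mult_ac)
    next
      case False
      then show ?thesis using cutoff_outside[OF \<phi>] by (simp add: frame_field_def)
    qed
  qed
  have "D u \<xi> Y = D u \<xi> (\<lambda>w. \<phi> w *\<^sub>R (\<phi> w *\<^sub>R Y w))"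
    using conn_scale[OF cutoff_smooth[OF \<phi> c] pi_field_scale[OF cutoff_smooth[OF \<phi> c] Y] slit \<xi>]
      conn_scale[OF cutoff_smooth[OF \<phi> c] Y slit \<xi>] by (simp add: dphi \<phi>u)
  also have "\<dots> = (\<Sum>b\<in>Basis. D u \<xi> (\<lambda>w. ?f b w *\<^sub>R frame_field c \<phi> b w))"
    unfolding expand[symmetric]
    by (rule conn_sum[OF slit \<xi>]) (rule pi_field_scale[OF smooth_f frame_field_pi_field[OF \<phi> c]])
  also have "\<dots> = (\<Sum>b\<in>Basis. (dir_deriv ?y ?z (\<xi> ?c) \<bullet> b) *\<^sub>R frame_field c \<phi> b u
      + (Y u c \<bullet> b) *\<^sub>R D u \<xi> (frame_field c \<phi> b))"
    using conn_scale[OF smooth_f frame_field_pi_field[OF \<phi> c] slit \<xi>] by (simp add: df[unfolded real_scaleR_def] \<phi>u)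
  finally have "D u \<xi> Y = (\<Sum>b\<in>Basis. (dir_deriv ?y ?z (\<xi> ?c) \<bullet> b) *\<^sub>R frame_field c \<phi> b u
      + (Y u c \<bullet> b) *\<^sub>R D u \<xi> (frame_field c \<phi> b))" .
  then have "D u \<xi> Y c = (\<Sum>b\<in>Basis. (dir_deriv ?y ?z (\<xi> ?c) \<bullet> b) *\<^sub>R frame_field c \<phi> b u c
      + (Y u c \<bullet> b) *\<^sub>R D u \<xi> (frame_field c \<phi> b) c)"
    by (simp add: sum_fun_value)
  then show ?thesis
    by (simp add: frame_field_coords[OF \<phi> c u] sum.distrib euclidean_representation)
qed

end

section \<open>Fields, Lie brackets and horizontal lifts on the slit bundle\<close>

lemma slit_range_eq:
  assumes "c \<in> atl" "z \<in> snd c ` fst c \<times> (- {0})"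
  shows "inv_chart (slit_chart atl c) z \<in> fst (slit_chart atl c)"
    "snd (slit_chart atl c) (inv_chart (slit_chart atl c) z) = z"
  using assms by (auto simp: slit_chart_range[symmetric] inv_into_into f_inv_into_f simp del: slit_chart_range)

lemma slit_range_mem: "c \<in> atl \<Longrightarrow> u \<in> fst (slit_chart atl c) \<Longrightarrow>
    snd (slit_chart atl c) u \<in> snd c ` fst c \<times> (- {0})"
  using slit_chart_range by blast

lemma slit_inv_chart_chart: "c \<in> atl \<Longrightarrow> u \<in> fst (slit_chart atl c) \<Longrightarrow>
    inv_chart (slit_chart atl c) (snd (slit_chart atl c) u) = u"
  by (rule slit.inv_chart_chart[OF slit_chart_in])

lemma dir_deriv_slit_cong:
  assumes "c \<in> atl" "u \<in> fst (slit_chart atl c)"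
    and "\<And>w. w \<in> fst (slit_chart atl c) \<Longrightarrow> f w = g (snd (slit_chart atl c) w)"
  shows "dir_deriv (f \<circ> inv_chart (slit_chart atl c)) (snd (slit_chart atl c) u) v
    = dir_deriv g (snd (slit_chart atl c) u) v"
  by (rule dir_deriv_cong[OF open_slit_range[OF assms(1)] slit_range_mem[OF assms(1,2)]])
    (simp add: assms(3) slit_range_eq[OF assms(1)])

lemma differentiable_slit_cong:
  assumes "c \<in> atl" "u \<in> fst (slit_chart atl c)"
    and "\<And>w. w \<in> fst (slit_chart atl c) \<Longrightarrow> f w = g (snd (slit_chart atl c) w)"
    and "g differentiable (at (snd (slit_chart atl c) u))"
  shows "(f \<circ> inv_chart (slit_chart atl c)) differentiable (at (snd (slit_chart atl c) u))"
  by (rule differentiable_cong_open[OF open_slit_range[OF assms(1)] slit_range_mem[OF assms(1,2)] _ assms(4)])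
    (simp add: assms(3) slit_range_eq[OF assms(1)])

lemma pi_field_cong:
  assumes "pi_field atl Y" "\<And>u. u \<in> slit atl \<Longrightarrow> Y u = Z u"
  shows "pi_field atl Z"
  unfolding pi_field_def
proof (intro conjI ballI)
  show "Z u \<in> tangent_space atl (fst u)" if "u \<in> slit atl" for u
    using pi_field_tangent[OF assms(1) that] assms(2)[OF that] by simp
  fix c assume c: "c \<in> atl"
  show "smooth_in_chart (slit_chart atl c) (\<lambda>u. Z u c)"
    unfolding smooth_in_chart_def slit_chart_range[OF c]
    by (rule smooth_on_cong[OF open_slit_range[OF c] _ pi_field_smooth[OF assms(1) c]])
      (use slit_range_eq(1)[OF c] assms(2) in \<open>auto simp: slit_chart_iff\<close>)
qed

lemma eta_pi_field: "pi_field atl eta"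
  unfolding pi_field_def
proof (intro conjI ballI)
  show "eta u \<in> tangent_space atl (fst u)" if "u \<in> slit atl" for u
    using that by (auto simp: eta_def slit_def tangent_bundle_def)
  fix c assume c: "c \<in> atl"
  have "smooth_on (snd c ` fst c \<times> (- {0::'e})) snd"
    by (rule smooth_on_bounded_linear[OF bounded_linear_snd])
  then show "smooth_in_chart (slit_chart atl c) (\<lambda>u. eta u c)"
    unfolding smooth_in_chart_def slit_chart_range[OF c]
  proof (rule smooth_on_cong[OF open_slit_range[OF c], rotated])
    fix z assume "z \<in> snd c ` fst c \<times> (- {0::'e})"
    from slit_range_eq(2)[OF c this]
    show "snd z = ((\<lambda>u. eta u c) \<circ> inv_chart (slit_chart atl c)) z"
      by (metis comp_apply eta_def slit_chart_apply snd_conv)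
  qed
qed

lemma pi_field_differentiable:
  "pi_field atl Y \<Longrightarrow> c \<in> atl \<Longrightarrow> u \<in> fst (slit_chart atl c) \<Longrightarrow>
    ((\<lambda>w. Y w c) \<circ> inv_chart (slit_chart atl c)) differentiable (at (snd (slit_chart atl c) u))"
  using smooth_on_imp_differentiable[OF pi_field_smooth] slit_range_mem by blast

text \<open>The regularity needed of the fields entering a Lie bracket: horizontal lifts are only known
  to be differentiable.\<close>

definition diff_field :: "(('a, 'e) tpoint \<Rightarrow> ('a, 'e) ttvec) \<Rightarrow> ('a, 'e) tpoint \<Rightarrow> bool" where
  "diff_field F u \<longleftrightarrow> (\<forall>w\<in>slit atl. F w \<in> tangent_space (slit_atlas atl) w) \<and>
     (\<forall>c\<in>atl. u \<in> fst (slit_chart atl c) \<longrightarrow>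
        ((\<lambda>w. F w (slit_chart atl c)) \<circ> inv_chart (slit_chart atl c)) differentiable (at (snd (slit_chart atl c) u)))"

lemma vector_field_diff_field:
  assumes "vector_field (slit_atlas atl) X" shows "diff_field X u"
  unfolding diff_field_def
proof (intro conjI ballI impI)
  show "X w \<in> tangent_space (slit_atlas atl) w" if "w \<in> slit atl" for w
    using slit_chart_obtain[OF that] assms slit_chart_in unfolding vector_field_def by metis
  fix c assume c: "c \<in> atl" "u \<in> fst (slit_chart atl c)"
  have "smooth_in_chart (slit_chart atl c) (\<lambda>p. X p (slit_chart atl c))"
    using assms slit_chart_in[OF c(1)] by (simp add: vector_field_def)
  then show "((\<lambda>w. X w (slit_chart atl c)) \<circ> inv_chart (slit_chart atl c)) differentiable (at (snd (slit_chart atl c) u))"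
    using c(2) by (auto simp: smooth_in_chart_def intro: smooth_on_imp_differentiable)
qed

lemma gam_diff_field:
  assumes X: "pi_field atl X" shows "diff_field (\<lambda>w. gam atl w (X w)) u"
  unfolding diff_field_def
proof (intro conjI ballI impI)
  show "gam atl w (X w) \<in> tangent_space (slit_atlas atl) w" if "w \<in> slit atl" for w
    by (rule gam_tangent[OF that pi_field_tangent[OF X that]])
  fix c assume c: "c \<in> atl" "u \<in> fst (slit_chart atl c)"
  show "((\<lambda>w. gam atl w (X w) (slit_chart atl c)) \<circ> inv_chart (slit_chart atl c)) differentiable (at (snd (slit_chart atl c) u))"
  proof (rule differentiable_slit_cong[OF c])
    show "(\<lambda>z. (0, ((\<lambda>w. X w c) \<circ> inv_chart (slit_chart atl c)) z)) differentiable (at (snd (slit_chart atl c) u))"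
      using has_derivative_Pair[OF has_derivative_const has_dir_deriv[OF pi_field_differentiable[OF X c]]]
      by (rule differentiableI)
  qed (simp add: gam_coords[OF c(1)] slit_inv_chart_chart[OF c(1)])
qed

lemma diff_field_tangent: "diff_field F u \<Longrightarrow> w \<in> slit atl \<Longrightarrow> F w \<in> tangent_space (slit_atlas atl) w"
  by (simp add: diff_field_def)

lemma diff_field_differentiable: "diff_field F u \<Longrightarrow> c \<in> atl \<Longrightarrow> u \<in> fst (slit_chart atl c) \<Longrightarrow>
    ((\<lambda>w. F w (slit_chart atl c)) \<circ> inv_chart (slit_chart atl c)) differentiable (at (snd (slit_chart atl c) u))"
  by (simp add: diff_field_def)

lemma slit_lie_bracket_tangent:
  assumes "u \<in> slit atl" "diff_field F u" "diff_field H u"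
  shows "lie_bracket (slit_atlas atl) F H u \<in> tangent_space (slit_atlas atl) u"
  by (rule slit.lie_bracket_tangent)
    (use assms in \<open>auto simp: slit_atlas_def slit_chart_iff diff_field_def\<close>)

lemma lie_bracket_coords:
  assumes "c \<in> atl" "u \<in> fst (slit_chart atl c)"
  shows "lie_bracket (slit_atlas atl) F H u (slit_chart atl c) =
     dir_deriv ((\<lambda>w. H w (slit_chart atl c)) \<circ> inv_chart (slit_chart atl c)) (snd (slit_chart atl c) u) (F u (slit_chart atl c))
   - dir_deriv ((\<lambda>w. F w (slit_chart atl c)) \<circ> inv_chart (slit_chart atl c)) (snd (slit_chart atl c) u) (H u (slit_chart atl c))"
  using assms by (simp add: lie_bracket_def slit_chart_in)

lemma rho_dir_deriv:
  assumes c: "c \<in> atl" "u \<in> fst (slit_chart atl c)" and F: "diff_field F u"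
  shows "fst (dir_deriv ((\<lambda>w. F w (slit_chart atl c)) \<circ> inv_chart (slit_chart atl c)) (snd (slit_chart atl c) u) v)
    = dir_deriv ((\<lambda>w. rho atl w (F w) c) \<circ> inv_chart (slit_chart atl c)) (snd (slit_chart atl c) u) v"
  unfolding dir_deriv_linear[OF bounded_linear_fst diff_field_differentiable[OF F c], symmetric]
  by (rule dir_deriv_slit_cong[OF c, symmetric])
    (use rho_coords[OF c(1) _ diff_field_tangent[OF F]] in \<open>auto simp: slit_inv_chart_chart[OF c(1)] slit_chart_iff\<close>)

text \<open>In a chart the base part of a field is its image under \<open>rho\<close>, so the
  projected bracket only involves derivatives of the projected fields. The same derivatives come
  from the two covariant derivatives in the torsion.\<close>

lemma rho_lie_bracket:
  assumes c: "c \<in> atl" "u \<in> fst (slit_chart atl c)" and F: "diff_field F u" and H: "diff_field H u"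
  shows "rho atl u (lie_bracket (slit_atlas atl) F H u) c =
     dir_deriv ((\<lambda>w. rho atl w (H w) c) \<circ> inv_chart (slit_chart atl c)) (snd (slit_chart atl c) u) (F u (slit_chart atl c))
   - dir_deriv ((\<lambda>w. rho atl w (F w) c) \<circ> inv_chart (slit_chart atl c)) (snd (slit_chart atl c) u) (H u (slit_chart atl c))"
proof -
  have u: "u \<in> slit atl" using c by (simp add: slit_chart_iff)
  show ?thesis
    unfolding rho_coords[OF c slit_lie_bracket_tangent[OF u F H]] lie_bracket_coords[OF c]
    by (simp add: rho_dir_deriv[OF c F] rho_dir_deriv[OF c H])
qed

lemma rho_gam: "u \<in> slit atl \<Longrightarrow> v \<in> tangent_space atl (fst u) \<Longrightarrow> rho atl u (gam atl u v) = 0"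
proof -
  assume u: "u \<in> slit atl" and v: "v \<in> tangent_space atl (fst u)"
  obtain c where c: "c \<in> atl" "u \<in> fst (slit_chart atl c)" using slit_chart_obtain[OF u] .
  show ?thesis
    by (rule tangent_eqI[OF rho_tangent[OF u gam_tangent[OF u v]] tangent_zero c(1)])
      (use c in \<open>auto simp: slit_chart_iff rho_coords[OF c gam_tangent[OF u v]] gam_coords[OF c]\<close>)
qed

lemma rho_add:
  assumes u: "u \<in> slit atl" and \<xi>: "\<xi> \<in> tangent_space (slit_atlas atl) u" and \<zeta>: "\<zeta> \<in> tangent_space (slit_atlas atl) u"
  shows "rho atl u (\<xi> + \<zeta>) = rho atl u \<xi> + rho atl u \<zeta>"
proof -
  obtain c where c: "c \<in> atl" "u \<in> fst (slit_chart atl c)" using slit_chart_obtain[OF u] .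
  show ?thesis
    by (rule tangent_eqI[OF rho_tangent[OF u slit.tangent_add[OF \<xi> \<zeta>]] tangent_add[OF rho_tangent[OF u \<xi>] rho_tangent[OF u \<zeta>]] c(1)])
      (use c in \<open>auto simp: slit_chart_iff rho_coords[OF c] \<xi> \<zeta> slit.tangent_add\<close>)
qed

text \<open>Since \<open>hor_map\<close> is an \<open>inv_into\<close>, surjectivity of
  \<open>rho\<close> on the horizontal space is what is at stake. Any vector above v splits by
  regularity into a vertical and a horizontal part, and \<open>rho\<close> kills the vertical
  one.\<close>

lemma hor_map_in:
  assumes D: "regular_connection atl D" and u: "u \<in> slit atl" and v: "v \<in> tangent_space atl (fst u)"
  shows "hor_map atl D u v \<in> hor_space atl D u" "rho atl u (hor_map atl D u v) = v"
proof -
  obtain c where c: "c \<in> atl" "u \<in> fst (slit_chart atl c)" using slit_chart_obtain[OF u] .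
  let ?\<xi> = "coord_vec (slit_atlas atl) (slit_chart atl c) (v c, 0) u"
  have \<xi>: "?\<xi> \<in> tangent_space (slit_atlas atl) u" by (rule slit.coord_vec_tangent[OF slit_chart_in[OF c(1)] c(2)])
  have r\<xi>: "rho atl u ?\<xi> = v"
    by (rule tangent_eqI[OF rho_tangent[OF u \<xi>] v c(1)])
      (use c in \<open>auto simp: slit_chart_iff rho_coords[OF c \<xi>] slit.coord_vec_self[OF slit_chart_in[OF c(1)] c(2)]\<close>)
  have "?\<xi> \<in> {v + h |v h. v \<in> ver_space atl u \<and> h \<in> hor_space atl D u}"
    using D u \<xi> unfolding regular_connection_def by blast
  then obtain w h where wh: "?\<xi> = w + h" "w \<in> ver_space atl u" "h \<in> hor_space atl D u" by blast
  have "rho atl u h = v"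
    using rho_add[OF u, of w h] wh r\<xi> by (auto simp: ver_space_def hor_space_def)
  then have "v \<in> rho atl u ` hor_space atl D u" using wh by blast
  then show "hor_map atl D u v \<in> hor_space atl D u" "rho atl u (hor_map atl D u v) = v"
    unfolding hor_map_def by (rule inv_into_into, rule f_inv_into_f)
qed

lemma hor_map_tangent:
  assumes "regular_connection atl D" "u \<in> slit atl" "v \<in> tangent_space atl (fst u)"
  shows "hor_map atl D u v \<in> tangent_space (slit_atlas atl) u"
  using hor_map_in(1)[OF assms] by (simp add: hor_space_def)

end

section \<open>Christoffel symbols of a connection over a chart\<close>

locale chart_connection = manifold_atlas M atl
  for M :: "'a topology" and atl :: "('a, 'e::euclidean_space) chart set" +
  fixes D :: "('a, 'e) pi_conn" and c :: "('a, 'e) chart" and B :: "'e set"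
    and \<Gamma> :: "'e \<times> 'e \<Rightarrow> 'e \<times> 'e \<Rightarrow> 'e \<Rightarrow> 'e"
  assumes c: "c \<in> atl" and B: "open B" "B \<subseteq> snd c ` fst c"
    and linear1: "\<And>z e. z \<in> B \<times> (- {0}) \<Longrightarrow> linear (\<lambda>\<zeta>. \<Gamma> z \<zeta> e)"
    and linear2: "\<And>z \<zeta>. z \<in> B \<times> (- {0}) \<Longrightarrow> linear (\<Gamma> z \<zeta>)"
    and smooth_\<Gamma>: "\<And>\<zeta> e. smooth_on (B \<times> (- {0})) (\<lambda>z. \<Gamma> z \<zeta> e)"
    and coords: "\<And>u Y \<xi>. u \<in> fst (slit_chart atl c) \<Longrightarrow> snd c (fst u) \<in> B \<Longrightarrow> pi_field atl Y \<Longrightarrow>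
      \<xi> \<in> tangent_space (slit_atlas atl) u \<Longrightarrow>
      D u \<xi> Y c = dir_deriv ((\<lambda>w. Y w c) \<circ> inv_chart (slit_chart atl c)) (snd (slit_chart atl c) u) (\<xi> (slit_chart atl c))
        + \<Gamma> (snd (slit_chart atl c) u) (\<xi> (slit_chart atl c)) (Y u c)"

text \<open>The symbols are the covariant derivatives of the cut-off frame, for all directions of
  the slit bundle at once: in \<open>\<Gamma> z \<zeta> e\<close> the pair \<zeta> has a base and a
  fibre part. The locale retains only linearity, smoothness and the formula for D, so later
  computations no longer see the cutoff.\<close>

lemma (in manifold_atlas) chart_connection_exists:
  assumes D: "linear_connection atl D" and c: "c \<in> atl" "p \<in> fst c"
  obtains B \<Gamma> where "chart_connection M atl D c B \<Gamma>" "snd c p \<in> B"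
proof -
  obtain B \<phi> where \<phi>: "cutoff c B \<phi>" and p: "snd c p \<in> B" using cutoff_exists[OF c] .
  let ?c = "slit_chart atl c"
  let ?X = "\<lambda>\<zeta> u. coord_vec (slit_atlas atl) ?c \<zeta> u"
  define \<Gamma> where "\<Gamma> z \<zeta> e = (\<Sum>b\<in>Basis. (e \<bullet> b) *\<^sub>R D (inv_chart ?c z) (?X \<zeta> (inv_chart ?c z)) (frame_field c \<phi> b) c)"
    for z \<zeta> e
  have B: "open B" "B \<subseteq> snd c ` fst c" using \<phi> by (auto simp: cutoff_def)
  have inr: "z \<in> snd c ` fst c \<times> (- {0})" if "z \<in> B \<times> (- {0})" for z using that B by auto
  note sc = slit_chart_in[OF c(1)] and ff = frame_field_pi_field[OF \<phi> c(1)]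
  have "chart_connection M atl D c B \<Gamma>"
  proof (rule chart_connection.intro[OF manifold_atlas_axioms], rule chart_connection_axioms.intro)
    show "linear (\<lambda>\<zeta>. \<Gamma> z \<zeta> e)" if z: "z \<in> B \<times> (- {0})" for z e
    proof -
      let ?u = "inv_chart ?c z"
      have u: "?u \<in> fst ?c" "?u \<in> slit atl" using slit_range_eq(1)[OF c(1) inr[OF z]] by (auto simp: slit_chart_iff)
      have t: "?X \<zeta> ?u \<in> tangent_space (slit_atlas atl) ?u" for \<zeta> by (rule slit.coord_vec_tangent[OF sc u(1)])
      note lin = conn_linear[OF D ff u(2), unfolded linear_on_fibre_def]
      show ?thesis
        using lin t unfolding \<Gamma>_def
        by (intro linearI) (simp_all add: slit.coord_vec_add[OF sc u(1)] slit.coord_vec_scaleR[OF sc u(1)]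
            scaleR_add_right sum.distrib scaleR_sum_right mult.commute)
    qed
    show "linear (\<Gamma> z \<zeta>)" for z \<zeta>
      unfolding \<Gamma>_def
      by (intro linearI) (simp_all add: inner_add_left scaleR_add_left sum.distrib scaleR_sum_right)
    show "smooth_on (B \<times> (- {0})) (\<lambda>z. \<Gamma> z \<zeta> e)" for \<zeta> e
    proof -
      have "smooth_on (B \<times> (- {0})) (\<lambda>z. D (inv_chart ?c z) (?X \<zeta> (inv_chart ?c z)) (frame_field c \<phi> b) c)" for b
        using conn_smooth[OF D ff c(1)] unfolding smooth_in_chart_def slit_chart_range[OF c(1)] o_def
        by (rule smooth_on_subset) (use B in auto)
      then show ?thesis
        unfolding \<Gamma>_def using B
        by (intro smooth_on_sum smooth_on_bilinear[OF bounded_bilinear_scaleR] smooth_on_const open_Times) auto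
    qed
    show "D u \<xi> Y c = dir_deriv ((\<lambda>w. Y w c) \<circ> inv_chart ?c) (snd ?c u) (\<xi> ?c) + \<Gamma> (snd ?c u) (\<xi> ?c) (Y u c)"
      if "u \<in> fst ?c" "snd c (fst u) \<in> B" "pi_field atl Y" "\<xi> \<in> tangent_space (slit_atlas atl) u" for u Y \<xi>
      unfolding \<Gamma>_def slit_inv_chart_chart[OF c(1) that(1)] slit.coord_vec_coords[OF that(4) sc that(1)]
      by (rule conn_coords[OF D c(1) \<phi> that])
  qed (use c B in auto)
  then show ?thesis using that p by blast
qed

context chart_connection
begin

lemma base_open: "open (B \<times> (- {0::'e}))"
  using B by (intro open_Times) auto

lemma base_mem: "u \<in> fst (slit_chart atl c) \<Longrightarrow> snd c (fst u) \<in> B \<Longrightarrow> snd (slit_chart atl c) u \<in> B \<times> (- {0})"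
  using slit_range_mem[OF c] by (auto simp: slit_chart_apply)

lemma base_range: "z \<in> B \<times> (- {0}) \<Longrightarrow> inv_chart (slit_chart atl c) z \<in> fst (slit_chart atl c) \<and>
    snd c (fst (inv_chart (slit_chart atl c) z)) = fst z \<and> snd (inv_chart (slit_chart atl c) z) c = snd z \<and>
    snd (slit_chart atl c) (inv_chart (slit_chart atl c) z) = z"
  using slit_range_eq[OF c, of z] B(2) by (auto simp: slit_chart_apply prod_eq_iff subset_iff)

lemma connection_map_coords:
  assumes u: "u \<in> fst (slit_chart atl c)" "snd c (fst u) \<in> B" and \<xi>: "\<xi> \<in> tangent_space (slit_atlas atl) u"
  shows "connection_map D u \<xi> c = snd (\<xi> (slit_chart atl c)) + \<Gamma> (snd (slit_chart atl c) u) (\<xi> (slit_chart atl c)) (snd u c)"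
proof -
  have "dir_deriv ((\<lambda>w. eta w c) \<circ> inv_chart (slit_chart atl c)) (snd (slit_chart atl c) u) v = snd v" for v
  proof -
    have "dir_deriv (snd :: 'e \<times> 'e \<Rightarrow> 'e) (snd (slit_chart atl c) u) = snd"
      by (intro dir_deriv_eqI bounded_linear_imp_has_derivative bounded_linear_snd)
    then show ?thesis
      using dir_deriv_slit_cong[OF c u(1), of "\<lambda>w. eta w c" snd] by (simp add: eta_def slit_chart_apply)
  qed
  then show ?thesis
    unfolding connection_map_def coords[OF u eta_pi_field \<xi>] by (simp add: eta_def)
qed

text \<open>The derivatives of components in D_F (rho H) - D_H (rho F) are exactly the projected
  bracket, so only Christoffel terms survive. Differentiability of F and H at u is what gives access
  to the bracket.\<close>

lemma torsion_coords:
  assumes u: "u \<in> fst (slit_chart atl c)" "snd c (fst u) \<in> B"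
    and F: "diff_field F u" and H: "diff_field H u" and X: "pi_field atl X" and Y: "pi_field atl Y"
    and FX: "\<And>w. w \<in> slit atl \<Longrightarrow> rho atl w (F w) = X w" and HY: "\<And>w. w \<in> slit atl \<Longrightarrow> rho atl w (H w) = Y w"
  shows "torsion atl D F H u c = \<Gamma> (snd (slit_chart atl c) u) (F u (slit_chart atl c)) (Y u c)
    - \<Gamma> (snd (slit_chart atl c) u) (H u (slit_chart atl c)) (X u c)"
proof -
  have s: "u \<in> slit atl" using u by (simp add: slit_chart_iff)
  have p: "pi_field atl (\<lambda>w. rho atl w (F w))" "pi_field atl (\<lambda>w. rho atl w (H w))"
    by (rule pi_field_cong[OF X]) (simp add: FX, rule pi_field_cong[OF Y], simp add: HY)
  show ?thesis
    using coords[OF u p(2) diff_field_tangent[OF F s]] coords[OF u p(1) diff_field_tangent[OF H s]]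
      rho_lie_bracket[OF c u(1) F H] FX[OF s] HY[OF s]
    by (simp add: torsion_def)
qed

context
  assumes reg: "regular_connection atl D"
begin

lemma hor_map_coords:
  assumes u: "u \<in> fst (slit_chart atl c)" "snd c (fst u) \<in> B" and v: "v \<in> tangent_space atl (fst u)"
  shows "fst (hor_map atl D u v (slit_chart atl c)) = v c"
    "snd (hor_map atl D u v (slit_chart atl c)) + \<Gamma> (snd (slit_chart atl c) u) (hor_map atl D u v (slit_chart atl c)) (snd u c) = 0"
proof -
  have s: "u \<in> slit atl" using u by (simp add: slit_chart_iff)
  note t = hor_map_tangent[OF reg s v]
  show "fst (hor_map atl D u v (slit_chart atl c)) = v c"
    using rho_coords[OF c u(1) t] hor_map_in(2)[OF reg s v] by simp
  have "connection_map D u (hor_map atl D u v) = 0"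
    using hor_map_in(1)[OF reg s v] by (simp add: hor_space_def)
  then show "snd (hor_map atl D u v (slit_chart atl c)) + \<Gamma> (snd (slit_chart atl c) u) (hor_map atl D u v (slit_chart atl c)) (snd u c) = 0"
    using connection_map_coords[OF u t] by simp
qed

text \<open>A nonzero solution w would give a vector (0, w) that is both vertical and horizontal,
  contrary to regularity. This is the invertibility of the linear system for the fibre part of a
  lift.\<close>

lemma vertical_injective:
  assumes u: "u \<in> fst (slit_chart atl c)" "snd c (fst u) \<in> B"
    and w: "w + \<Gamma> (snd (slit_chart atl c) u) (0, w) (snd u c) = 0"
  shows "w = 0"
proof -
  let ?c = "slit_chart atl c"
  have s: "u \<in> slit atl" "fst u \<in> fst c" using u by (auto simp: slit_chart_iff)
  let ?\<xi> = "coord_vec (slit_atlas atl) ?c (0, w) u"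
  note sc = slit_chart_in[OF c]
  have \<xi>: "?\<xi> \<in> tangent_space (slit_atlas atl) u" by (rule slit.coord_vec_tangent[OF sc u(1)])
  have \<xi>c: "?\<xi> ?c = (0, w)" by (rule slit.coord_vec_self[OF sc u(1)])
  have D: "linear_connection atl D" using reg by (simp add: regular_connection_def)
  have "connection_map D u ?\<xi> = 0"
    by (rule tangent_eqI[OF _ tangent_zero c s(2)])
      (use conn_tangent[OF D eta_pi_field s(1) \<xi>] connection_map_coords[OF u \<xi>] \<xi>c w in \<open>auto simp: connection_map_def\<close>)
  moreover have "rho atl u ?\<xi> = 0"
    by (rule tangent_eqI[OF rho_tangent[OF s(1) \<xi>] tangent_zero c s(2)])
      (simp add: rho_coords[OF c u(1) \<xi>] \<xi>c)
  ultimately have "?\<xi> \<in> ver_space atl u \<inter> hor_space atl D u"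
    using \<xi> by (simp add: ver_space_def hor_space_def)
  then have "?\<xi> = 0" using reg s(1) unfolding regular_connection_def by blast
  then show ?thesis using \<xi>c by (metis snd_conv snd_zero zero_fun_apply)
qed

text \<open>Horizontality says that the fibre part n of the lift of X solves n + \<Gamma>(0, n) y =
  - \<Gamma>(X, 0) y. Both sides have differentiable coefficients and the map on the left is
  injective, so n depends differentiably on the point although \<open>hor_map\<close> is a pointwise
  choice.\<close>

lemma hor_map_differentiable:
  assumes u: "u \<in> fst (slit_chart atl c)" "snd c (fst u) \<in> B" and X: "pi_field atl X"
  shows "((\<lambda>w. hor_map atl D w (X w) (slit_chart atl c)) \<circ> inv_chart (slit_chart atl c))
    differentiable (at (snd (slit_chart atl c) u))"
proof -
  let ?c = "slit_chart atl c" and ?z = "snd (slit_chart atl c) u"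
  let ?S = "B \<times> (- {0::'e})"
  let ?x = "(\<lambda>w. X w c) \<circ> inv_chart ?c"
  define h where "h = (\<lambda>w. hor_map atl D w (X w) ?c) \<circ> inv_chart ?c"
  note z = base_mem[OF u]
  have x: "?x differentiable (at ?z)" by (rule pi_field_differentiable[OF X c u(1)])
  have sn: "snd differentiable (at ?z)" by (rule bounded_linear_imp_differentiable[OF bounded_linear_snd])
  have dG: "(\<lambda>z. \<Gamma> z \<zeta> e) differentiable (at ?z)" for \<zeta> e
    by (rule smooth_on_imp_differentiable[OF smooth_\<Gamma> z])
  have h: "fst (h z) = ?x z" "snd (h z) + \<Gamma> z (h z) (snd z) = 0" if "z \<in> ?S" for z
  proof -
    note b = base_range[OF that]
    have "X (inv_chart ?c z) \<in> tangent_space atl (fst (inv_chart ?c z))"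
      using pi_field_tangent[OF X] b by (simp add: slit_chart_iff)
    from hor_map_coords[OF _ _ this] b that
    show "fst (h z) = ?x z" "snd (h z) + \<Gamma> z (h z) (snd z) = 0" by (auto simp: h_def)
  qed
  have lin2: "linear (\<lambda>a. \<Gamma> z (a, 0) e)" "linear (\<lambda>w. \<Gamma> z (0, w) e)" if "z \<in> ?S" for z e
    using linear_compose[OF _ linear1[OF that], of "\<lambda>a. (a, 0)" e] linear_compose[OF _ linear1[OF that], of "\<lambda>a. (0, a)" e]
    by (auto simp: o_def linear_iff)
  have dx: "(\<lambda>z. \<Gamma> z (?x z, 0) e) differentiable (at ?z)" for e
    using has_derivative_linear_family[OF base_open z lin2(1) dG x] by (rule differentiableI)
  have "(\<lambda>z. \<Gamma> z (?x z, 0) (snd z)) differentiable (at ?z)"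
    using has_derivative_linear_family[where B = "\<lambda>z. \<Gamma> z (?x z, 0)", OF base_open z linear2 dx sn]
    by (rule differentiableI)
  then have r: "(\<lambda>z. - \<Gamma> z (?x z, 0) (snd z)) differentiable (at ?z)"
    by (rule differentiable_minus)
  have "(\<lambda>z. snd (h z)) differentiable (at ?z)"
  proof (rule linear_solution_differentiable[OF base_open z _ _ _ r])
    show lin: "linear (\<lambda>w. w + \<Gamma> z (0, w) (snd z))" if "z \<in> ?S" for z
      using lin2(2)[OF that] by (intro linear_compose_add linear_id[unfolded id_def])
    show "inj (\<lambda>w. w + \<Gamma> ?z (0, w) (snd ?z))"
      unfolding linear_inj_iff_eq_0[OF lin[OF z]]
    proof (intro allI impI)
      fix w assume "w + \<Gamma> ?z (0, w) (snd ?z) = 0"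
      then show "w = 0" by (rule_tac vertical_injective[OF u]) (simp add: slit_chart_apply)
    qed
    show "(\<lambda>z. b + \<Gamma> z (0, b) (snd z)) differentiable (at ?z)" for b
      using has_derivative_linear_family[OF base_open z linear2 dG sn]
      by (intro differentiable_add differentiable_const) (rule differentiableI)
    show "snd (h z) + \<Gamma> z (0, snd (h z)) (snd z) = - \<Gamma> z (?x z, 0) (snd z)" if "z \<in> ?S" for z
    proof -
      have "h z = (?x z, 0) + (0, snd (h z))" using h(1)[OF that] by (simp add: prod_eq_iff)
      then have "\<Gamma> z (h z) (snd z) = \<Gamma> z (?x z, 0) (snd z) + \<Gamma> z (0, snd (h z)) (snd z)"
        using linear_add[OF linear1[OF that]] by metis
      then show ?thesis using h(2)[OF that] by (simp add: eq_neg_iff_add_eq_0 ac_simps)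
    qed
  qed
  from has_derivative_Pair[OF has_dir_deriv[OF x] has_dir_deriv[OF this]]
  have "(\<lambda>z. (?x z, snd (h z))) differentiable (at ?z)" by (rule differentiableI)
  then have "h differentiable (at ?z)"
    by (rule differentiable_cong_open[OF base_open z, rotated]) (use h(1) in \<open>simp add: prod_eq_iff\<close>)
  then show ?thesis by (simp add: h_def)
qed

end

end

context manifold_atlas
begin

lemma hor_map_diff_field:
  assumes D: "regular_connection atl D" and X: "pi_field atl X"
  shows "diff_field (\<lambda>w. hor_map atl D w (X w)) u"
  unfolding diff_field_def
proof (intro conjI ballI impI)
  show "hor_map atl D w (X w) \<in> tangent_space (slit_atlas atl) w" if "w \<in> slit atl" for w
    by (rule hor_map_tangent[OF D that pi_field_tangent[OF X that]])
  fix c assume c: "c \<in> atl" "u \<in> fst (slit_chart atl c)"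
  have "linear_connection atl D" "fst u \<in> fst c" using D c by (auto simp: regular_connection_def slit_chart_iff)
  then obtain B \<Gamma> where "chart_connection M atl D c B \<Gamma>" "snd c (fst u) \<in> B"
    using chart_connection_exists c by metis
  then show "((\<lambda>w. hor_map atl D w (X w) (slit_chart atl c)) \<circ> inv_chart (slit_chart atl c))
      differentiable (at (snd (slit_chart atl c) u))"
    using chart_connection.hor_map_differentiable D c X by blast
qed

end

context chart_connection
begin

lemma h_torsion_coords:
  assumes reg: "regular_connection atl D" and u: "u \<in> fst (slit_chart atl c)" "snd c (fst u) \<in> B"
    and X: "pi_field atl X" and Y: "pi_field atl Y"
  shows "h_torsion atl D X Y u c
    = \<Gamma> (snd (slit_chart atl c) u) (hor_map atl D u (X u) (slit_chart atl c)) (Y u c)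
    - \<Gamma> (snd (slit_chart atl c) u) (hor_map atl D u (Y u) (slit_chart atl c)) (X u c)"
  unfolding h_torsion_def
  by (rule torsion_coords[OF u hor_map_diff_field[OF reg X] hor_map_diff_field[OF reg Y] X Y])
    (simp_all add: hor_map_in[OF reg] pi_field_tangent X Y)

text \<open>The vertical lift of X projects to 0, which removes the second Christoffel term of the
  torsion; the lift of Y therefore does not enter the result.\<close>

lemma hv_torsion_coords:
  assumes reg: "regular_connection atl D" and u: "u \<in> fst (slit_chart atl c)" "snd c (fst u) \<in> B"
    and X: "pi_field atl X" and Y: "pi_field atl Y"
  shows "hv_torsion atl D X Y u c = \<Gamma> (snd (slit_chart atl c) u) (0, X u c) (Y u c)"
proof -
  have "hv_torsion atl D X Y u c = \<Gamma> (snd (slit_chart atl c) u) (gam atl u (X u) (slit_chart atl c)) (Y u c)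
      - \<Gamma> (snd (slit_chart atl c) u) (hor_map atl D u (Y u) (slit_chart atl c)) (0 c)"
    unfolding hv_torsion_def
    by (rule torsion_coords[OF u gam_diff_field[OF X] hor_map_diff_field[OF reg Y] pi_field_zero Y])
      (simp_all add: hor_map_in[OF reg] pi_field_tangent X Y rho_gam)
  then show ?thesis
    using linear_0[OF linear2[OF base_mem[OF u]]] by (simp add: gam_coords[OF c u(1)])
qed

end

section \<open>Finsler geometry in coordinates\<close>

text \<open>\<open>E\<close> is the coordinate expression of \<open>L\<^sup>2/2\<close> on the slit tangent bundle over a chart.\<close>

locale finsler_coordinates =
  fixes W :: "('e::euclidean_space \<times> 'e) set" and E :: "'e \<times> 'e \<Rightarrow> real"
  assumes W: "open W" and smooth_E: "smooth_on W E"
    and cone: "\<And>x y r. (x, y) \<in> W \<Longrightarrow> r > 0 \<Longrightarrow> (x, r *\<^sub>R y) \<in> W \<and> E (x, r *\<^sub>R y) = r\<^sup>2 * E (x, y)"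
begin

text \<open>The Legendre transform of z, paired with w; it is the form d_J E in coordinates.\<close>

definition momentum :: "'e \<times> 'e \<Rightarrow> 'e \<Rightarrow> real" where "momentum z w = dir_deriv E z (0, w)"

definition metric :: "'e \<times> 'e \<Rightarrow> 'e \<Rightarrow> 'e \<Rightarrow> real" where
  "metric z v w = dir_deriv (\<lambda>z. momentum z w) z (0, v)"

text \<open>The vectors v and w are held constant. For \<zeta> = (0, u) this is twice the Cartan
  tensor.\<close>

definition dmetric :: "'e \<times> 'e \<Rightarrow> 'e \<times> 'e \<Rightarrow> 'e \<Rightarrow> 'e \<Rightarrow> real" where
  "dmetric z \<zeta> v w = dir_deriv (\<lambda>z. metric z v w) z \<zeta>"

lemma smooth_momentum: "smooth_on W (\<lambda>z. momentum z w)"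
  unfolding momentum_def by (rule smooth_on_dir_deriv[OF smooth_E])

lemma smooth_metric: "smooth_on W (\<lambda>z. metric z v w)"
  unfolding metric_def by (rule smooth_on_dir_deriv[OF smooth_momentum])

lemma metric_differentiable: "z \<in> W \<Longrightarrow> (\<lambda>z. metric z v w) differentiable (at z)"
  by (rule smooth_on_imp_differentiable[OF smooth_metric])

lemma linear_momentum: "z \<in> W \<Longrightarrow> linear (momentum z)"
  using linear_compose[OF _ linear_dir_deriv[OF smooth_on_imp_differentiable[OF smooth_E]], of "\<lambda>w. (0, w)" z]
  by (auto simp: momentum_def[abs_def] o_def linear_iff)

lemma metric_sym: "z \<in> W \<Longrightarrow> metric z v w = metric z w v"
  unfolding metric_def momentum_def by (rule dir_deriv_commute[OF smooth_E W])

lemma linear_metric_left: "z \<in> W \<Longrightarrow> linear (\<lambda>v. metric z v w)"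
  using linear_compose[OF _ linear_dir_deriv[OF smooth_on_imp_differentiable[OF smooth_momentum]], of "\<lambda>v. (0, v)" z w]
  by (auto simp: metric_def o_def linear_iff)

lemma linear_metric_right:
  assumes "z \<in> W" shows "linear (metric z v)"
proof -
  have "metric z v = (\<lambda>w. metric z w v)" using metric_sym[OF assms] by (rule ext)
  then show ?thesis using linear_metric_left[OF assms, of v] by simp
qed

lemma linear_dmetric: "z \<in> W \<Longrightarrow> linear (\<lambda>\<zeta>. dmetric z \<zeta> v w)"
  unfolding dmetric_def by (rule linear_dir_deriv[OF metric_differentiable])

lemma dmetric_sym: "z \<in> W \<Longrightarrow> dmetric z \<zeta> v w = dmetric z \<zeta> w v"
  unfolding dmetric_def by (rule dir_deriv_cong[OF W]) (auto simp: metric_sym)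

lemma has_derivative_metric:
  assumes z: "z \<in> W" and y: "y differentiable (at z)"
  shows "((\<lambda>z. metric z (y z) w) has_derivative (\<lambda>\<zeta>. dmetric z \<zeta> (y z) w + metric z (dir_deriv y z \<zeta>) w)) (at z)"
  unfolding dmetric_def
  by (rule has_derivative_linear_family[OF W z linear_metric_left metric_differentiable[OF z] y])

lemma snd_derivative: "(snd :: 'e \<times> 'e \<Rightarrow> 'e) differentiable (at z)" "dir_deriv (snd :: 'e \<times> 'e \<Rightarrow> 'e) z = snd"
  by (auto intro: bounded_linear_imp_differentiable bounded_linear_snd dir_deriv_eqI bounded_linear_imp_has_derivative)

text \<open>Euler's relation for degree 2: differentiate E (x, (1 + t) y) = (1 + t)^2 E (x, y) at t
  = 0.\<close>

lemma euler_momentum_self: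
  assumes "z \<in> W" shows "momentum z (snd z) = 2 * E z"
proof -
  obtain x y where z: "z = (x, y)" by (cases z)
  have c: "((\<lambda>t::real. (x, (1 + t) *\<^sub>R y)) has_derivative (\<lambda>t. (0, t *\<^sub>R y))) (at 0)"
    by (auto intro!: derivative_eq_intros)
  have "(E has_derivative dir_deriv E z) (at ((\<lambda>t::real. (x, (1 + t) *\<^sub>R y)) 0))"
    using has_dir_deriv[OF smooth_on_imp_differentiable[OF smooth_E assms]] by (simp add: z)
  from has_derivative_compose[OF c this]
  have 1: "((\<lambda>t::real. E (x, (1 + t) *\<^sub>R y)) has_derivative (\<lambda>t. dir_deriv E z (0, t *\<^sub>R y))) (at 0)" .
  have "((\<lambda>t::real. (1 + t)\<^sup>2 * E z) has_derivative (\<lambda>t. 2 * t * E z)) (at 0)"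
    by (auto intro!: derivative_eq_intros)
  then have "((\<lambda>t::real. E (x, (1 + t) *\<^sub>R y)) has_derivative (\<lambda>t. 2 * t * E z)) (at 0)"
    \<comment> \<open>Homogeneity is only positive, so t stays above -1.\<close>
    by (rule has_derivative_transform_within_open[of _ _ _ _ "{-1<..}"])
      (use cone[of x y] assms z in auto)
  from fun_cong[OF has_derivative_unique[OF 1 this], of 1] show ?thesis by (simp add: momentum_def z)
qed

text \<open>Differentiating Euler's relation along w gives g(w, y) plus the momentum of w on one
  side and twice that momentum on the other.\<close>

lemma metric_self:
  assumes z: "z \<in> W" shows "metric z (snd z) w = momentum z w"
proof -
  have "((\<lambda>z. momentum z (snd z)) has_derivative
      (\<lambda>\<zeta>. dir_deriv (\<lambda>z'. momentum z' (snd z)) z \<zeta> + momentum z (snd \<zeta>))) (at z)"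
    using has_derivative_linear_family[OF W z linear_momentum smooth_on_imp_differentiable[OF smooth_momentum z] snd_derivative(1)]
    by (simp add: snd_derivative)
  then have "dir_deriv (\<lambda>z. momentum z (snd z)) z (0, w) = metric z w (snd z) + momentum z w"
    by (simp add: dir_deriv_eqI metric_def)
  moreover have "dir_deriv (\<lambda>z. momentum z (snd z)) z (0, w) = dir_deriv (\<lambda>z. 2 * E z) z (0, w)"
    by (rule dir_deriv_cong[OF W z]) (rule euler_momentum_self)
  moreover have "dir_deriv (\<lambda>z. 2 * E z) z (0, w) = 2 * momentum z w"
    using dir_deriv_linear[OF bounded_linear_mult_right smooth_on_imp_differentiable[OF smooth_E z]]
    by (simp add: momentum_def)
  ultimately show ?thesis using metric_sym[OF z] by simp
qed

text \<open>The derivative of \<open>metric_self\<close> in an arbitrary direction; the second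
  summand appears because y itself varies with the fibre part of \<zeta>.\<close>

lemma dmetric_self:
  assumes z: "z \<in> W"
  shows "dmetric z \<zeta> (snd z) w + metric z (snd \<zeta>) w = dir_deriv (\<lambda>z. momentum z w) z \<zeta>"
proof -
  have "dir_deriv (\<lambda>z. momentum z w) z \<zeta> = dir_deriv (\<lambda>z. metric z (snd z) w) z \<zeta>"
    by (rule dir_deriv_cong[OF W z]) (simp add: metric_self)
  then show ?thesis
    using dir_deriv_eqI[OF has_derivative_metric[OF z snd_derivative(1)]] by (simp add: snd_derivative)
qed

text \<open>Third fibre derivatives of the 2-homogeneous E vanish when contracted with y. By total
  symmetry this holds for y in any of the three slots, which is what removes the unknown vertical
  terms later.\<close>

lemma dmetric_vertical_self: "z \<in> W \<Longrightarrow> dmetric z (0, v) (snd z) w = 0"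
  using dmetric_self[of z "(0, v)" w] by (simp add: metric_def)

lemma dmetric_horizontal_self: "z \<in> W \<Longrightarrow> dmetric z (v, 0) (snd z) w = dir_deriv (\<lambda>z. momentum z w) z (v, 0)"
  using dmetric_self[of z "(v, 0)" w] by (simp add: linear_0[OF linear_metric_left])

lemma dmetric_horizontal_self_self:
  assumes z: "z \<in> W" shows "dmetric z (v, 0) (snd z) (snd z) = 2 * dir_deriv E z (v, 0)"
proof -
  have "((\<lambda>z. momentum z (snd z)) has_derivative
      (\<lambda>\<zeta>. dir_deriv (\<lambda>z'. momentum z' (snd z)) z \<zeta> + momentum z (snd \<zeta>))) (at z)"
    using has_derivative_linear_family[OF W z linear_momentum smooth_on_imp_differentiable[OF smooth_momentum z] snd_derivative(1)]
    by (simp add: snd_derivative)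
  then have "dir_deriv (\<lambda>z. momentum z (snd z)) z (v, 0) = dmetric z (v, 0) (snd z) (snd z)"
    by (simp add: dir_deriv_eqI dmetric_horizontal_self[OF z] linear_0[OF linear_momentum[OF z]])
  moreover have "dir_deriv (\<lambda>z. momentum z (snd z)) z (v, 0) = dir_deriv (\<lambda>z. 2 * E z) z (v, 0)"
    by (rule dir_deriv_cong[OF W z]) (rule euler_momentum_self)
  moreover have "dir_deriv (\<lambda>z. 2 * E z) z (v, 0) = 2 * dir_deriv E z (v, 0)"
    using dir_deriv_linear[OF bounded_linear_mult_right smooth_on_imp_differentiable[OF smooth_E z]] by simp
  ultimately show ?thesis by simp
qed

lemma dmetric_vertical_total_sym: "z \<in> W \<Longrightarrow> dmetric z (0, u) v w = dmetric z (0, v) u w"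
  unfolding dmetric_def metric_def by (rule dir_deriv_commute[OF smooth_momentum W])

text \<open>The Euler-Lagrange equation of the energy: along x' = y, y' = g2 the momentum of w
  changes at the rate d_w E.\<close>

definition spray_eq :: "('e \<times> 'e \<Rightarrow> 'e) \<Rightarrow> 'e \<times> 'e \<Rightarrow> bool" where
  "spray_eq g2 z \<longleftrightarrow> (\<forall>w. metric z (g2 z) w = dir_deriv E z (w, 0) - dir_deriv (\<lambda>z. momentum z w) z (snd z, 0))"

text \<open>The fibre derivative of the Euler-Lagrange equation. Exchanging mixed derivatives turns
  every second derivative into \<open>dmetric\<close>; the term with (v, 0) comes from varying y in
  the direction (y, 0), and the last one from the product rule on g(g2, w).\<close>

lemma spray_derivative:
  assumes z: "z \<in> W" and g2: "\<And>z. z \<in> W \<Longrightarrow> spray_eq g2 z" and d: "g2 differentiable (at z)"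
  shows "metric z (dir_deriv g2 z (0, v)) w
    = dmetric z (w, 0) (snd z) v - dmetric z (v, 0) (snd z) w - dmetric z (snd z, 0) v w - dmetric z (0, v) (g2 z) w"
proof -
  let ?p = "\<lambda>z. momentum z w" and ?y = "snd z"
  have dE: "(\<lambda>z. dir_deriv E z (w, 0)) differentiable (at z)"
    by (rule smooth_on_imp_differentiable[OF smooth_on_dir_deriv[OF smooth_E] z])
  have dp: "(\<lambda>z. dir_deriv ?p z (b, 0)) differentiable (at z)" for b
    by (rule smooth_on_imp_differentiable[OF smooth_on_dir_deriv[OF smooth_momentum] z])
  have lin: "linear (\<lambda>b. dir_deriv ?p z (b, 0))" if "z \<in> W" for z
    using linear_compose[OF _ linear_dir_deriv[OF smooth_on_imp_differentiable[OF smooth_momentum[of w] that]], of "\<lambda>b. (b, 0)"]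
    by (auto simp: o_def linear_iff)
  have "((\<lambda>z. dir_deriv ?p z (snd z, 0)) has_derivative
      (\<lambda>\<zeta>. dir_deriv (\<lambda>z'. dir_deriv ?p z' (?y, 0)) z \<zeta> + dir_deriv ?p z (snd \<zeta>, 0))) (at z)"
    using has_derivative_linear_family[OF W z lin dp snd_derivative(1)] by (simp add: snd_derivative)
  from has_derivative_diff[OF has_dir_deriv[OF dE] this]
  have 1: "dir_deriv (\<lambda>z. dir_deriv E z (w, 0) - dir_deriv ?p z (snd z, 0)) z (0, v)
    = dir_deriv (\<lambda>z. dir_deriv E z (w, 0)) z (0, v)
      - (dir_deriv (\<lambda>z'. dir_deriv ?p z' (?y, 0)) z (0, v) + dir_deriv ?p z (v, 0))"
    by (simp add: dir_deriv_eqI)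
  have 2: "dir_deriv (\<lambda>z. metric z (g2 z) w) z (0, v) = dir_deriv (\<lambda>z. dir_deriv E z (w, 0) - dir_deriv ?p z (snd z, 0)) z (0, v)"
    by (rule dir_deriv_cong[OF W z]) (use g2 in \<open>simp add: spray_eq_def\<close>)
  have 3: "dir_deriv (\<lambda>z. metric z (g2 z) w) z (0, v) = dmetric z (0, v) (g2 z) w + metric z (dir_deriv g2 z (0, v)) w"
    using dir_deriv_eqI[OF has_derivative_metric[OF z d]] by simp
  have 4: "dir_deriv (\<lambda>z. dir_deriv E z (w, 0)) z (0, v) = dmetric z (w, 0) ?y v"
    unfolding dmetric_horizontal_self[OF z] momentum_def by (rule dir_deriv_commute[OF smooth_E W z])
  have 5: "dir_deriv (\<lambda>z'. dir_deriv ?p z' (?y, 0)) z (0, v) = dmetric z (?y, 0) v w"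
    unfolding dmetric_def metric_def by (rule dir_deriv_commute[OF smooth_momentum W z])
  show ?thesis using 1 2 3 4 5 dmetric_horizontal_self[OF z, of v w] by simp
qed

text \<open>\<open>S\<close> are the horizontal Christoffel symbols of the
  recurrent connection, \<open>N\<close> its nonlinear part, \<open>T\<close> the (h)hv-torsion in the direction of \<open>a\<close>. Koszul's
  trick expresses \<open>S\<close> by the metric; contracting with \<open>snd z\<close> once gives \<open>N\<close>, twice the spray.\<close>

lemma koszul_comparison:
  assumes z: "z \<in> W" and pos: "\<And>v. v \<noteq> 0 \<Longrightarrow> metric z v v > 0"
    and g2: "\<And>z. z \<in> W \<Longrightarrow> spray_eq g2 z" and dg2: "g2 differentiable (at z)"
    and S_sym: "\<And>v w. S v w = S w v" and S_N: "\<And>v. S v (snd z) = N v"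
    and S_metric: "\<And>v w k. dmetric z (v, - N v) w k - metric z (S v w) k - metric z w (S v k) = \<alpha> v * metric z w k"
    and a: "\<And>v. metric z a v = \<alpha> v"
    and T: "\<And>v k. metric z (T v) k = dmetric z (0, a) v k / 2"
  shows "- N (snd z) = g2 z + \<alpha> (snd z) *\<^sub>R snd z - E z *\<^sub>R a"
    and "- (2 *\<^sub>R N v) = dir_deriv g2 z (0, v) + \<alpha> v *\<^sub>R snd z + \<alpha> (snd z) *\<^sub>R v - metric z v (snd z) *\<^sub>R a + (2 * E z) *\<^sub>R T v"
proof -
  let ?y = "snd z"
  note sym = metric_sym[OF z]
  have eqI: "v = w" if "\<And>k. metric z v k = metric z w k" for v w
  proof (rule ccontr)
    assume "v \<noteq> w"
    then have "metric z (v - w) (v - w) > 0" by (intro pos) simp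
    moreover have "metric z (v - w) (v - w) = 0"
      using that[of "v - w"] by (simp add: linear_diff[OF linear_metric_left[OF z]])
    ultimately show False by simp
  qed
  have ml: "metric z (v + w) k = metric z v k + metric z w k" "metric z (v - w) k = metric z v k - metric z w k"
    "metric z (r *\<^sub>R v) k = r * metric z v k" "metric z (- v) k = - metric z v k" for v w k r
    using linear_add[OF linear_metric_left[OF z]] linear_diff[OF linear_metric_left[OF z]]
      linear_cmul[OF linear_metric_left[OF z]] linear_neg[OF linear_metric_left[OF z]]
    by auto
  have dl: "dmetric z (v, - n) w k = dmetric z (v, 0) w k - dmetric z (0, n) w k" for v n w k
    using linear_diff[OF linear_dmetric[OF z], of "(v, 0)" "(0, n)" w k] by simp
  have lv: "linear (\<lambda>n. dmetric z (0, n) w k)" for w k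
    using linear_compose[OF _ linear_dmetric[OF z], of "\<lambda>n. (0, n)" w k] by (auto simp: o_def linear_iff)
  have y0: "dmetric z (0, n) ?y k = 0" "dmetric z (0, n) k ?y = 0" "dmetric z (0, ?y) k l = 0" for n k l
    using dmetric_vertical_self[OF z] dmetric_sym[OF z] dmetric_vertical_total_sym[OF z] by metis+
  \<comment> \<open>Koszul: the metric equations for (v, w, k) and (w, v, k) minus the one for (k,
    v, w). By the symmetry of S all terms cancel but those with S v w.\<close>
  have K: "2 * metric z (S v w) k = (dmetric z (v, - N v) w k - \<alpha> v * metric z w k)
      + (dmetric z (w, - N w) v k - \<alpha> w * metric z v k) - (dmetric z (k, - N k) v w - \<alpha> k * metric z v w)" for v w k
    using S_metric[of v w k] S_metric[of w v k] S_metric[of k v w] S_sym[of v w] S_sym[of v k] S_sym[of w k]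
      sym[of w "S v k"] sym[of v "S w k"] sym[of "S k v" w]
    by (simp add: sym)
  \<comment> \<open>K with w = y. Euler's relation kills every vertical derivative except the one
    along N y, so the only unknown left on the right is N y.\<close>
  have N: "2 * metric z (N v) k = dmetric z (v, 0) ?y k - \<alpha> v * metric z ?y k + dmetric z (?y, 0) v k
      - dmetric z (0, N ?y) v k - \<alpha> ?y * metric z v k - dmetric z (k, 0) v ?y + \<alpha> k * metric z v ?y" for v k
    using K[of v ?y k] unfolding S_N dl y0 by simp
  have myy: "metric z ?y ?y = 2 * E z" by (simp add: metric_self[OF z] euler_momentum_self[OF z])
  show spray: "- N ?y = g2 z + \<alpha> ?y *\<^sub>R ?y - E z *\<^sub>R a"
  proof (rule eqI)
    fix k
    have "2 * metric z (N ?y) k = 2 * dmetric z (?y, 0) ?y k - 2 * \<alpha> ?y * metric z ?y k - dmetric z (k, 0) ?y ?y + \<alpha> k * (2 * E z)"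
      using N[of ?y k] by (simp add: y0 myy)
    then show "metric z (- N ?y) k = metric z (g2 z + \<alpha> ?y *\<^sub>R ?y - E z *\<^sub>R a) k"
      using g2[OF z, unfolded spray_eq_def, rule_format, of k] dmetric_horizontal_self[OF z, of ?y k]
        dmetric_horizontal_self_self[OF z, of k]
      by (simp add: ml a algebra_simps)
  qed
  have "N ?y = - (g2 z + \<alpha> ?y *\<^sub>R ?y - E z *\<^sub>R a)" by (simp flip: spray)
  \<comment> \<open>Substituting the spray for N y: its component along y drops out by Euler's
    relation.\<close>
  then have dN: "dmetric z (0, N ?y) v k = - dmetric z (0, g2 z) v k + E z * dmetric z (0, a) v k" for v k
    by (simp add: linear_add[OF lv] linear_diff[OF lv] linear_cmul[OF lv] linear_neg[OF lv] y0)
  show "- (2 *\<^sub>R N v) = dir_deriv g2 z (0, v) + \<alpha> v *\<^sub>R ?y + \<alpha> ?y *\<^sub>R v - metric z v ?y *\<^sub>R a + (2 * E z) *\<^sub>R T v"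
  proof (rule eqI)
    fix k
    \<comment> \<open>Total symmetry rewrites the derivative of g along v, applied to g2 and k, as
      one along g2. This is the term that N y contributes, so the two cancel in the
      comparison.\<close>
    have "metric z (dir_deriv g2 z (0, v)) k = dmetric z (k, 0) ?y v - dmetric z (v, 0) ?y k - dmetric z (?y, 0) v k - dmetric z (0, g2 z) v k"
      using spray_derivative[OF z g2 dg2, of v k] dmetric_vertical_total_sym[OF z, of v "g2 z" k] by simp
    then show "metric z (- (2 *\<^sub>R N v)) k
        = metric z (dir_deriv g2 z (0, v) + \<alpha> v *\<^sub>R ?y + \<alpha> ?y *\<^sub>R v - metric z v ?y *\<^sub>R a + (2 * E z) *\<^sub>R T v) k"
      using N[of v k] dN[of v k] dmetric_sym[OF z, of "(k, 0)" ?y v] by (simp add: ml a T)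
  qed
qed

end

lemma deriv_along_fibre:
  fixes f :: "'e::euclidean_space \<times> 'e \<Rightarrow> real"
  assumes "f differentiable (at (x, y))"
  shows "deriv (\<lambda>t. r * f (x, y + t *\<^sub>R w)) 0 = r * dir_deriv f (x, y) (0, w)"
proof -
  have c: "((\<lambda>t::real. (x, y + t *\<^sub>R w)) has_derivative (\<lambda>t. (0, t *\<^sub>R w))) (at 0)"
    by (auto intro!: derivative_eq_intros)
  have "(f has_derivative dir_deriv f (x, y)) (at ((\<lambda>t::real. (x, y + t *\<^sub>R w)) 0))"
    using has_dir_deriv[OF assms] by simp
  from has_derivative_compose[OF c this]
  have "((\<lambda>t::real. f (x, y + t *\<^sub>R w)) has_derivative (\<lambda>t. dir_deriv f (x, y) (0, t *\<^sub>R w))) (at 0)" .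
  moreover have "(\<lambda>t. dir_deriv f (x, y) (0, t *\<^sub>R w)) = (*) (dir_deriv f (x, y) (0, w))"
    using linear_cmul[OF linear_dir_deriv[OF assms], of _ "(0, w)"] by (auto simp: mult.commute)
  ultimately have "((\<lambda>t::real. f (x, y + t *\<^sub>R w)) has_real_derivative dir_deriv f (x, y) (0, w)) (at 0)"
    by (simp add: has_field_derivative_def)
  then show ?thesis by (intro DERIV_imp_deriv DERIV_cmult)
qed

section \<open>The Barthel connection in a chart\<close>

context manifold_atlas
begin

lemma pi_field_rho:
  assumes X: "vector_field (slit_atlas atl) X" shows "pi_field atl (\<lambda>w. rho atl w (X w))"
  unfolding pi_field_def
proof (intro conjI ballI)
  note t = diff_field_tangent[OF vector_field_diff_field[OF X]]
  show "rho atl u (X u) \<in> tangent_space atl (fst u)" if "u \<in> slit atl" for u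
    by (rule rho_tangent[OF that t[OF that]])
  fix c assume c: "c \<in> atl"
  have "smooth_in_chart (slit_chart atl c) (\<lambda>p. X p (slit_chart atl c))"
    using X slit_chart_in[OF c] by (simp add: vector_field_def)
  from smooth_on_fst[OF this[unfolded smooth_in_chart_def slit_chart_range[OF c]] open_slit_range[OF c]]
  show "smooth_in_chart (slit_chart atl c) (\<lambda>u. rho atl u (X u) c)"
    unfolding smooth_in_chart_def slit_chart_range[OF c]
    by (rule smooth_on_cong[OF open_slit_range[OF c], rotated])
      (use slit_range_eq(1)[OF c] rho_coords[OF c _ t] in \<open>auto simp: slit_chart_iff\<close>)
qed

text \<open>With G = (y, G2), both [JX, G] and J[X, G] contain the derivative of the base part of X
  along G; it cancels in their difference, and the result depends on X only through its value at
  u.\<close>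

lemma barthel_coords:
  assumes c: "c \<in> atl" "u \<in> fst (slit_chart atl c)"
    and X: "vector_field (slit_atlas atl) X" and G: "vector_field (slit_atlas atl) G"
    and semispray: "\<And>w. w \<in> slit atl \<Longrightarrow> rho atl w (G w) = eta w"
  shows "barthel atl G X u (slit_chart atl c) = (fst (X u (slit_chart atl c)),
     dir_deriv ((\<lambda>w. snd (G w (slit_chart atl c))) \<circ> inv_chart (slit_chart atl c)) (snd (slit_chart atl c) u)
       (0, fst (X u (slit_chart atl c))) - snd (X u (slit_chart atl c)))"
proof -
  let ?c = "slit_chart atl c" and ?z = "snd (slit_chart atl c) u"
  let ?X = "X u (slit_chart atl c)" and ?G = "(\<lambda>w. G w (slit_chart atl c)) \<circ> inv_chart (slit_chart atl c)"
  let ?x = "(\<lambda>w. rho atl w (X w) c) \<circ> inv_chart ?c"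
  have s: "u \<in> slit atl" using c by (simp add: slit_chart_iff)
  note dX = vector_field_diff_field[OF X] and dG = vector_field_diff_field[OF G]
  note pX = pi_field_rho[OF X]
  have JX: "JJ atl w (X w) = gam atl w (rho atl w (X w))" for w by (simp add: JJ_def)
  have dirJ: "dir_deriv ((\<lambda>w. JJ atl w (X w) ?c) \<circ> inv_chart ?c) ?z v = (0, dir_deriv ?x ?z v)" for v
  proof -
    have "dir_deriv ((\<lambda>w. JJ atl w (X w) ?c) \<circ> inv_chart ?c) ?z v = dir_deriv (\<lambda>z. (0, ?x z)) ?z v"
      by (rule dir_deriv_slit_cong[OF c]) (simp add: JX gam_coords[OF c(1)] slit_inv_chart_chart[OF c(1)])
    then show ?thesis
      using dir_deriv_eqI[OF has_derivative_Pair[OF has_derivative_const[of "0::'e"] has_dir_deriv[OF pi_field_differentiable[OF pX c]]]]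
      by simp
  qed
  have rG: "dir_deriv ((\<lambda>w. rho atl w (G w) c) \<circ> inv_chart ?c) ?z v = snd v" for v
    using dir_deriv_slit_cong[OF c, of "\<lambda>w. rho atl w (G w) c" snd] semispray
      dir_deriv_eqI[OF bounded_linear_imp_has_derivative[OF bounded_linear_snd], of ?z]
    by (simp add: slit_chart_iff eta_def slit_chart_apply)
  have fG: "fst (dir_deriv ?G ?z v) = snd v" for v
    unfolding rho_dir_deriv[OF c dG] by (rule rG)
  have sG: "snd (dir_deriv ?G ?z v) = dir_deriv ((\<lambda>w. snd (G w ?c)) \<circ> inv_chart ?c) ?z v" for v
    using dir_deriv_linear[OF bounded_linear_snd diff_field_differentiable[OF dG c], of v] by (simp add: o_def)
  have JXc: "JJ atl u (X u) ?c = (0, fst ?X)"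
    by (rule JJ_coords[OF c diff_field_tangent[OF dX s]])
  show ?thesis
    unfolding barthel_def
    using rho_lie_bracket[OF c dX dG]
    by (simp add: lie_bracket_coords[OF c] JJ_def[of atl u "lie_bracket _ _ _ _"] gam_coords[OF c]
        dirJ JXc rG prod_eq_iff fG sG)
qed

end

section \<open>Energy, metric and canonical spray of a Finsler manifold in a chart\<close>

locale finsler_chart = manifold_atlas M atl
  for M :: "'a topology" and atl :: "('a, 'e::euclidean_space) chart set" +
  fixes L :: "('a, 'e) tpoint \<Rightarrow> real" and c :: "('a, 'e) chart"
  assumes finsler: "finsler_structure atl L" and c: "c \<in> atl"
begin

abbreviation sc :: "(('a, 'e) tpoint, 'e \<times> 'e) chart" where "sc \<equiv> slit_chart atl c"

abbreviation W :: "('e \<times> 'e) set" where "W \<equiv> snd c ` fst c \<times> (- {0})"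

definition E :: "'e \<times> 'e \<Rightarrow> real" where "E = energy L \<circ> inv_chart sc"

lemma E_chart: "u \<in> fst sc \<Longrightarrow> E (snd sc u) = (1/2) * (L u)\<^sup>2"
  using slit_inv_chart_chart[OF c] by (simp add: E_def energy_def)

lemma smooth_E: "smooth_on W E"
proof -
  have "smooth_on W (L \<circ> inv_chart sc)"
    using finsler slit_chart_in[OF c] slit_chart_range[OF c]
    by (auto simp: finsler_structure_def smooth_fun_def smooth_in_chart_def)
  then have "smooth_on W (\<lambda>z. (1/2) * ((L \<circ> inv_chart sc) z * (L \<circ> inv_chart sc) z))"
    by (intro smooth_on_bilinear[OF bounded_bilinear_mult] smooth_on_const open_slit_range c)
  then show ?thesis by (simp add: E_def o_def energy_def[abs_def] power2_eq_square)
qed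

end

sublocale finsler_chart \<subseteq> fc: finsler_coordinates W E
proof
  show "open W" by (rule open_slit_range[OF c])
  show "smooth_on W E" by (rule smooth_E)
  fix x y and r :: real assume xy: "(x, y) \<in> W" and r: "r > 0"
  then obtain p where p: "p \<in> fst c" "x = snd c p" "y \<noteq> 0" by auto
  let ?v = "coord_vec atl c y p"
  have "L (p, r *\<^sub>R ?v) = r * L (p, ?v)"
  proof -
    have "(p, ?v) \<in> tangent_bundle atl" using p c coord_vec_tangent by (auto simp: tangent_bundle_def)
    then show ?thesis using finsler r unfolding finsler_structure_def by force
  qed
  then show "(x, r *\<^sub>R y) \<in> W \<and> E (x, r *\<^sub>R y) = r\<^sup>2 * E (x, y)"
    using p r c by (simp add: E_def energy_def slit_inv_chart inv_chart_chart coord_vec_scaleR power_mult_distrib)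
qed

context finsler_chart
begin

lemma slit_fibre:
  assumes u: "u \<in> fst sc" and v: "v \<in> tangent_space atl (fst u)" and nz: "snd u c + v c \<noteq> 0"
  shows "(fst u, snd u + v) \<in> fst sc" "snd sc (fst u, snd u + v) = (snd c (fst u), snd u c + v c)"
proof -
  have "snd u + v \<noteq> 0" using nz by (metis plus_fun_apply zero_fun_apply)
  then show "(fst u, snd u + v) \<in> fst sc"
    using u v tangent_add[OF slit_chart_tangent[OF u] v]
    by (auto simp: slit_chart_iff slit_def tangent_bundle_def intro!: bexI[OF _ c])
qed (simp add: slit_chart_apply)

text \<open>The vectors in the defining formula may hit zero, where the chart gives no expression
  for L. They are nonzero for s and t near 0, and \<open>deriv\<close> depends only on the values
  there. The factor 2 of L^2 = 2E absorbs the 1/2 of the definition.\<close>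

lemma finsler_metric_coords:
  assumes u: "u \<in> fst sc" and v: "v \<in> tangent_space atl (fst u)" and w: "w \<in> tangent_space atl (fst u)"
  shows "finsler_metric L u v w = fc.metric (snd sc u) (v c) (w c)"
proof -
  let ?x = "snd c (fst u)" and ?y = "snd u c"
  have L: "(L (fst u, snd u + s *\<^sub>R v + t *\<^sub>R w))\<^sup>2 = 2 * E (?x, ?y + s *\<^sub>R v c + t *\<^sub>R w c)"
    if nz: "?y + s *\<^sub>R v c + t *\<^sub>R w c \<noteq> 0" for s t
  proof -
    have t: "s *\<^sub>R v + t *\<^sub>R w \<in> tangent_space atl (fst u)" by (intro tangent_add tangent_scaleR v w)
    have nz': "snd u c + (s *\<^sub>R v + t *\<^sub>R w) c \<noteq> 0" using nz by (simp add: add.assoc)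
    show ?thesis
      using E_chart[OF slit_fibre(1)[of u "s *\<^sub>R v + t *\<^sub>R w", OF u t nz']]
      unfolding slit_fibre(2)[of u "s *\<^sub>R v + t *\<^sub>R w", OF u t nz'] by (simp add: add.assoc)
  qed
  have ev: "eventually (\<lambda>t. y + t *\<^sub>R e \<noteq> 0) (nhds 0)" if "y \<noteq> 0" for y e :: 'e
  proof -
    have "open {t. y + t *\<^sub>R e \<noteq> 0}" by (intro open_Collect_neq continuous_intros)
    from eventually_nhds_in_open[OF this, of 0] show ?thesis using that by simp
  qed
  have y: "?y \<noteq> 0" by (rule slit_coords_nonzero[OF c u])
  have x: "?x \<in> snd c ` fst c" using u by (auto simp: slit_chart_iff)
  have inner: "deriv (\<lambda>t. (L (fst u, snd u + s *\<^sub>R v + t *\<^sub>R w))\<^sup>2) 0 = 2 * fc.momentum (?x, ?y + s *\<^sub>R v c) (w c)"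
    if nz: "?y + s *\<^sub>R v c \<noteq> 0" for s
  proof -
    have "deriv (\<lambda>t. (L (fst u, snd u + s *\<^sub>R v + t *\<^sub>R w))\<^sup>2) 0
        = deriv (\<lambda>t. 2 * E (?x, ?y + s *\<^sub>R v c + t *\<^sub>R w c)) 0"
      by (rule deriv_cong_ev[OF eventually_mono[OF ev[OF nz, of "w c"]]]) (auto simp: L)
    also have "\<dots> = 2 * dir_deriv E (?x, ?y + s *\<^sub>R v c) (0, w c)"
      by (rule deriv_along_fibre, rule smooth_on_imp_differentiable[OF smooth_E]) (use x nz in simp)
    finally show ?thesis by (simp add: fc.momentum_def)
  qed
  have "deriv (\<lambda>s. deriv (\<lambda>t. (L (fst u, snd u + s *\<^sub>R v + t *\<^sub>R w))\<^sup>2) 0) 0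
      = deriv (\<lambda>s. 2 * fc.momentum (?x, ?y + s *\<^sub>R v c) (w c)) 0"
    by (rule deriv_cong_ev[OF eventually_mono[OF ev[OF y, of "v c"]]]) (auto simp: inner)
  also have "\<dots> = 2 * fc.metric (?x, ?y) (v c) (w c)"
    unfolding fc.metric_def
    by (rule deriv_along_fibre, rule smooth_on_imp_differentiable[OF fc.smooth_momentum]) (use x y in simp)
  finally show ?thesis by (simp add: finsler_metric_def slit_chart_apply)
qed

lemma slit_dfun:
  assumes u: "u \<in> fst sc" and \<xi>: "\<xi> \<in> tangent_space (slit_atlas atl) u"
    and f: "\<And>w. w \<in> fst sc \<Longrightarrow> f w = g (snd sc w)" and g: "g differentiable (at (snd sc u))"
  shows "dfun (slit_atlas atl) f u \<xi> = dir_deriv g (snd sc u) (\<xi> sc)"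
  using slit.dfun_eq[OF slit_chart_in[OF c] u \<xi> differentiable_slit_cong[OF c u f g]]
    dir_deriv_slit_cong[OF c u, of f g] f by simp

lemma dfun_energy:
  assumes u: "u \<in> fst sc" and \<xi>: "\<xi> \<in> tangent_space (slit_atlas atl) u"
  shows "dfun (slit_atlas atl) (energy L) u \<xi> = dir_deriv E (snd sc u) (\<xi> sc)"
  by (rule slit_dfun[OF u \<xi>])
    (use smooth_on_imp_differentiable[OF smooth_E slit_range_mem[OF c u]] slit_inv_chart_chart[OF c] in \<open>auto simp: E_def\<close>)

lemma dJ_energy_coords:
  assumes u: "u \<in> fst sc" and \<xi>: "\<xi> \<in> tangent_space (slit_atlas atl) u"
  shows "dJ_energy atl L u \<xi> = fc.momentum (snd sc u) (fst (\<xi> sc))"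
proof -
  have "u \<in> slit atl" using u by (simp add: slit_chart_iff)
  then show ?thesis
    using dfun_energy[OF u JJ_tangent[OF _ \<xi>]] JJ_coords[OF c u \<xi>]
    by (simp add: dJ_energy_def fc.momentum_def)
qed

lemma dfun_dJ_energy:
  assumes u: "u \<in> fst sc" and \<xi>: "\<xi> \<in> tangent_space (slit_atlas atl) u" and F: "diff_field F u"
  shows "dfun (slit_atlas atl) (\<lambda>w. dJ_energy atl L w (F w)) u \<xi>
    = dir_deriv (\<lambda>z. fc.momentum z (fst (F u sc))) (snd sc u) (\<xi> sc)
      + fc.momentum (snd sc u) (fst (dir_deriv ((\<lambda>w. F w sc) \<circ> inv_chart sc) (snd sc u) (\<xi> sc)))"
proof -
  let ?F = "(\<lambda>w. F w sc) \<circ> inv_chart sc" and ?z = "snd sc u"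
  note z = slit_range_mem[OF c u]
  note dF = diff_field_differentiable[OF F c u]
  have f: "((\<lambda>z. fst (?F z)) has_derivative (\<lambda>v. fst (dir_deriv ?F ?z v))) (at ?z)"
    by (rule has_derivative_fst[OF has_dir_deriv[OF dF]])
  have H: "((\<lambda>z. fc.momentum z (fst (?F z))) has_derivative
      (\<lambda>v. dir_deriv (\<lambda>z. fc.momentum z (fst (?F ?z))) ?z v + fc.momentum ?z (fst (dir_deriv ?F ?z v)))) (at ?z)"
    using has_derivative_linear_family[OF fc.W z fc.linear_momentum
        smooth_on_imp_differentiable[OF fc.smooth_momentum z] differentiableI[OF f]]
    unfolding dir_deriv_eqI[OF f] .
  have "dfun (slit_atlas atl) (\<lambda>w. dJ_energy atl L w (F w)) u \<xi> = dir_deriv (\<lambda>z. fc.momentum z (fst (?F z))) ?z (\<xi> sc)"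
    by (rule slit_dfun[OF u \<xi> _ differentiableI[OF H]])
      (use dJ_energy_coords diff_field_tangent[OF F] in \<open>auto simp: slit_inv_chart_chart[OF c] slit_chart_iff\<close>)
  then show ?thesis
    unfolding dir_deriv_eqI[OF H] by (simp add: slit_inv_chart_chart[OF c u])
qed

lemma metric_pos:
  assumes u: "u \<in> fst sc" and "v \<noteq> 0" shows "fc.metric (snd sc u) v v > 0"
proof -
  have p: "fst u \<in> fst c" "u \<in> slit atl" using u by (auto simp: slit_chart_iff)
  let ?v = "coord_vec atl c v (fst u)"
  have t: "?v \<in> tangent_space atl (fst u)" by (rule coord_vec_tangent[OF c p(1)])
  have vc: "?v c = v" by (rule coord_vec_self[OF c p(1)])
  then have "?v \<noteq> 0" using assms by auto
  then have "finsler_metric L u ?v ?v > 0"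
    using finsler p t unfolding finsler_structure_def pi_metric_def by blast
  then show ?thesis using finsler_metric_coords[OF u t t] vc by simp
qed

lemma metric_nondegenerate:
  assumes u: "u \<in> fst sc" and eq: "\<And>k. fc.metric (snd sc u) v k = fc.metric (snd sc u) w k"
  shows "v = w"
proof (rule ccontr)
  assume "v \<noteq> w"
  then have "fc.metric (snd sc u) (v - w) (v - w) > 0" by (intro metric_pos[OF u]) simp
  moreover have "fc.metric (snd sc u) (v - w) (v - w) = 0"
    using eq[of "v - w"] linear_diff[OF fc.linear_metric_left[OF slit_range_mem[OF c u]]] by simp
  ultimately show False by simp
qed

text \<open>\<eta> is extended to a field X. The derivatives of X and G from the outer terms of
  \<open>ext_deriv\<close> cancel against the bracket term, which leaves \<Omega>(G, X) = - dE(X) as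
  an equation between values at u.\<close>

lemma canonical_spray_eq:
  assumes G: "canonical_spray atl L G" and u: "u \<in> fst sc"
  shows "dir_deriv (\<lambda>z. fc.momentum z (fst \<eta>)) (snd sc u) (G u sc)
    - dir_deriv (\<lambda>z. fc.momentum z (fst (G u sc))) (snd sc u) \<eta> = - dir_deriv E (snd sc u) \<eta>"
proof -
  have s: "u \<in> slit atl" using u by (simp add: slit_chart_iff)
  have vG: "vector_field (slit_atlas atl) G" using G by (simp add: canonical_spray_def)
  note dG = vector_field_diff_field[OF vG, of u]
  have t: "coord_vec (slit_atlas atl) sc \<eta> u \<in> tangent_space (slit_atlas atl) u"
    by (rule slit.coord_vec_tangent[OF slit_chart_in[OF c] u])
  obtain X where X: "vector_field (slit_atlas atl) X" "X u = coord_vec (slit_atlas atl) sc \<eta> u"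
    using vector_field_extend[OF s t] .
  have Xc: "X u sc = \<eta>" unfolding X(2) by (rule slit.coord_vec_self[OF slit_chart_in[OF c] u])
  note dX = vector_field_diff_field[OF X(1), of u]
  note tG = diff_field_tangent[OF dG s] and tX = diff_field_tangent[OF dX s]
  have "ext_deriv (slit_atlas atl) (dJ_energy atl L) G X u = - dfun (slit_atlas atl) (energy L) u (X u)"
    using G X(1) s by (simp add: canonical_spray_def)
  then show ?thesis
    unfolding ext_deriv_def dfun_dJ_energy[OF u tG dX] dfun_dJ_energy[OF u tX dG] dfun_energy[OF u tX]
      dJ_energy_coords[OF u slit_lie_bracket_tangent[OF s dG dX]] lie_bracket_coords[OF c u]
    by (simp add: Xc linear_diff[OF fc.linear_momentum[OF slit_range_mem[OF c u]]])
qed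

text \<open>Vertical test directions (0, w) determine the base part of G, by Euler's relation and
  nondegeneracy of g; base directions (w, 0) give the Euler-Lagrange equation.\<close>

lemma canonical_spray_coords:
  assumes G: "canonical_spray atl L G" and u: "u \<in> fst sc"
  shows "fst (G u sc) = snd u c"
    and "fc.spray_eq (\<lambda>z. snd (G (inv_chart sc z) sc)) (snd sc u)"
proof -
  let ?z = "snd sc u"
  note z = slit_range_mem[OF c u]
  have y: "snd ?z = snd u c" by (simp add: slit_chart_apply)
  have lin: "linear (dir_deriv (\<lambda>z. fc.momentum z w) ?z)" for w
    by (rule linear_dir_deriv[OF smooth_on_imp_differentiable[OF fc.smooth_momentum z]])
  have m0: "dir_deriv (\<lambda>z. fc.momentum z 0) ?z v = 0" for v
    using dir_deriv_cong[OF fc.W z, of "\<lambda>z. fc.momentum z 0" "\<lambda>_. 0" v] linear_0[OF fc.linear_momentum] by simp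
  show G1: "fst (G u sc) = snd u c"
  proof (rule metric_nondegenerate[OF u])
    fix w
    have "fc.metric ?z w (fst (G u sc)) = fc.momentum ?z w"
      using canonical_spray_eq[OF G u, of "(0, w)"] by (simp add: m0 fc.metric_def fc.momentum_def[of _ w])
    then show "fc.metric ?z (fst (G u sc)) w = fc.metric ?z (snd u c) w"
      using fc.metric_self[OF z] fc.metric_sym[OF z] y by simp
  qed
  have Gu: "G u sc = (snd ?z, 0) + (0, snd (G u sc))" using G1 by (simp add: prod_eq_iff y)
  have "fc.metric ?z (snd (G u sc)) w = dir_deriv E ?z (w, 0) - dir_deriv (\<lambda>z. fc.momentum z w) ?z (snd ?z, 0)" for w
  proof -
    have "dir_deriv (\<lambda>z. fc.momentum z w) ?z (G u sc)
        = dir_deriv (\<lambda>z. fc.momentum z w) ?z (snd ?z, 0) + fc.metric ?z (snd (G u sc)) w"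
      by (subst Gu) (simp only: linear_add[OF lin] fc.metric_def)
    \<comment> \<open>With the vector held at y, Euler's relation makes this term twice d_w E, which
      turns the -d_w E of the spray equation into +d_w E.\<close>
    moreover have "dir_deriv (\<lambda>z. fc.momentum z (snd u c)) ?z (w, 0) = 2 * dir_deriv E ?z (w, 0)"
      using fc.dmetric_horizontal_self[OF z, of w "snd ?z"] fc.dmetric_horizontal_self_self[OF z, of w] y by simp
    ultimately show ?thesis
      using canonical_spray_eq[OF G u, of "(w, 0)"] by (simp add: G1)
  qed
  then show "fc.spray_eq (\<lambda>z. snd (G (inv_chart sc z) sc)) ?z"
    by (simp add: fc.spray_eq_def slit_inv_chart_chart[OF c u])
qed

text \<open>The derivatives of the components of Y and Z cancel between the derivative of g(Y, Z)
  and the two covariant derivatives, so the result is algebraic in the values at u.\<close>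

lemma cov_metric_coords:
  assumes "chart_connection M atl D c B \<Gamma>" and uB: "snd c (fst u) \<in> B" and D: "linear_connection atl D"
    and u: "u \<in> fst sc" and \<xi>: "\<xi> \<in> tangent_space (slit_atlas atl) u"
    and Y: "pi_field atl Y" and Z: "pi_field atl Z"
  shows "cov_metric atl D (finsler_metric L) u \<xi> Y Z = fc.dmetric (snd sc u) (\<xi> sc) (Y u c) (Z u c)
    - fc.metric (snd sc u) (\<Gamma> (snd sc u) (\<xi> sc) (Y u c)) (Z u c)
    - fc.metric (snd sc u) (Y u c) (\<Gamma> (snd sc u) (\<xi> sc) (Z u c))"
proof -
  interpret chart_connection M atl D c B \<Gamma> by fact
  let ?z = "snd sc u" and ?y = "(\<lambda>w. Y w c) \<circ> inv_chart sc" and ?x = "(\<lambda>w. Z w c) \<circ> inv_chart sc"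
  note z = slit_range_mem[OF c u]
  have s: "u \<in> slit atl" using u by (simp add: slit_chart_iff)
  have dy: "?y differentiable (at ?z)" by (rule pi_field_differentiable[OF Y c u])
  have dx: "?x differentiable (at ?z)" by (rule pi_field_differentiable[OF Z c u])
  note my = fc.has_derivative_metric[OF z dy]
  have H: "((\<lambda>z. fc.metric z (?y z) (?x z)) has_derivative
      (\<lambda>v. dir_deriv (\<lambda>z. fc.metric z (?y z) (?x ?z)) ?z v + fc.metric ?z (?y ?z) (dir_deriv ?x ?z v))) (at ?z)"
    using has_derivative_linear_family[where B = "\<lambda>z. fc.metric z (?y z)",
        OF fc.W z fc.linear_metric_right differentiableI[OF my] dx] .
  have "dfun (slit_atlas atl) (\<lambda>w. finsler_metric L w (Y w) (Z w)) u \<xi> = dir_deriv (\<lambda>z. fc.metric z (?y z) (?x z)) ?z (\<xi> sc)"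
    by (rule slit_dfun[OF u \<xi> _ differentiableI[OF H]])
      (use finsler_metric_coords pi_field_tangent[OF Y] pi_field_tangent[OF Z] in \<open>auto simp: slit_inv_chart_chart[OF c] slit_chart_iff\<close>)
  also have "\<dots> = fc.dmetric ?z (\<xi> sc) (Y u c) (Z u c) + fc.metric ?z (dir_deriv ?y ?z (\<xi> sc)) (Z u c)
      + fc.metric ?z (Y u c) (dir_deriv ?x ?z (\<xi> sc))"
    unfolding dir_deriv_eqI[OF H] dir_deriv_eqI[OF my] by (simp add: slit_inv_chart_chart[OF c u])
  finally show ?thesis
    unfolding cov_metric_def
    using finsler_metric_coords[OF u conn_tangent[OF D Y s \<xi>] pi_field_tangent[OF Z s]]
      finsler_metric_coords[OF u pi_field_tangent[OF Y s] conn_tangent[OF D Z s \<xi>]]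
      linear_add[OF fc.linear_metric_left[OF z]] linear_add[OF fc.linear_metric_right[OF z]]
    by (simp add: coords[OF u uB Y \<xi>] coords[OF u uB Z \<xi>])
qed

end

context manifold_atlas
begin

lemma hv_torsion_tangent:
  assumes D: "regular_connection atl D" and X: "pi_field atl X" and Y: "pi_field atl Y" and u: "u \<in> slit atl"
  shows "hv_torsion atl D X Y u \<in> tangent_space atl (fst u)"
proof -
  have lin: "linear_connection atl D" using D by (simp add: regular_connection_def)
  note dX = gam_diff_field[OF X, of u] and dY = hor_map_diff_field[OF D Y, of u]
  have pX: "pi_field atl (\<lambda>w. rho atl w (gam atl w (X w)))"
    by (rule pi_field_cong[OF pi_field_zero]) (simp add: rho_gam pi_field_tangent[OF X])
  have pY: "pi_field atl (\<lambda>w. rho atl w (hor_map atl D w (Y w)))"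
    by (rule pi_field_cong[OF Y]) (simp add: hor_map_in[OF D] pi_field_tangent[OF Y])
  show ?thesis
    unfolding hv_torsion_def torsion_def
    by (intro tangent_diff conn_tangent[OF lin] pX pY u diff_field_tangent[OF dX] diff_field_tangent[OF dY]
        rho_tangent slit_lie_bracket_tangent dX dY)
qed

lemma canonical_semispray:
  assumes L: "finsler_structure atl L" and G: "canonical_spray atl L G" and u: "u \<in> slit atl"
  shows "rho atl u (G u) = eta u"
proof -
  obtain c where cu: "c \<in> atl" "u \<in> fst (slit_chart atl c)" using slit_chart_obtain[OF u] .
  interpret finsler_chart M atl L c using L cu by unfold_locales auto
  have vG: "vector_field (slit_atlas atl) G" using G by (simp add: canonical_spray_def)
  note t = diff_field_tangent[OF vector_field_diff_field[OF vG] u]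
  show ?thesis
    by (rule tangent_eqI[OF rho_tangent[OF u t] pi_field_tangent[OF eta_pi_field u] cu(1)])
      (use cu canonical_spray_coords(1)[OF G cu(2)] in \<open>auto simp: slit_chart_iff rho_coords[OF cu t] eta_def\<close>)
qed

end

section \<open>Comparison of the connections in a chart\<close>

context finsler_chart
begin

lemma hrf_coords:
  assumes hrf: "hrf_connection atl L A D\<^sub>H" and cartan: "cartan_connection atl L D\<^sub>C"
    and G: "canonical_spray atl L G" and a: "pi_field atl a"
    and aA: "\<And>X u. pi_field atl X \<Longrightarrow> u \<in> slit atl \<Longrightarrow> finsler_metric L u (a u) (X u) = A u (X u)"
    and u: "u \<in> fst sc"
  shows "associated_spray atl D\<^sub>H u sc =
      (G u + A u (eta u) *\<^sub>R liouville atl u - ((1/2) * (L u)\<^sup>2) *\<^sub>R gam atl u (a u)) sc" (is ?spray)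
    and "vector_field (slit_atlas atl) X \<Longrightarrow> associated_nonlinear_connection atl D\<^sub>H X u sc =
      (barthel atl G X u + (A u (rho atl u (X u)) *\<^sub>R liouville atl u + A u (eta u) *\<^sub>R JJ atl u (X u)
        - finsler_metric L u (rho atl u (X u)) (eta u) *\<^sub>R gam atl u (a u)
        + (L u)\<^sup>2 *\<^sub>R gam atl u (hv_torsion atl D\<^sub>C a (\<lambda>w. rho atl w (X w)) u))) sc" (is "_ \<Longrightarrow> ?nonlinear")
proof -
  have regH: "regular_connection atl D\<^sub>H" and regC: "regular_connection atl D\<^sub>C"
    using hrf cartan by (auto simp: hrf_connection_def cartan_connection_def)
  have linH: "linear_connection atl D\<^sub>H" and linC: "linear_connection atl D\<^sub>C"
    using regH regC by (auto simp: regular_connection_def)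
  have s: "u \<in> slit atl" and p: "fst u \<in> fst c" using u by (auto simp: slit_chart_iff)
  obtain B\<^sub>H \<Gamma>\<^sub>H where ccH: "chart_connection M atl D\<^sub>H c B\<^sub>H \<Gamma>\<^sub>H" and uH: "snd c (fst u) \<in> B\<^sub>H"
    using chart_connection_exists[OF linH c p] .
  obtain B\<^sub>C \<Gamma>\<^sub>C where ccC: "chart_connection M atl D\<^sub>C c B\<^sub>C \<Gamma>\<^sub>C" and uC: "snd c (fst u) \<in> B\<^sub>C"
    using chart_connection_exists[OF linC c p] .
  interpret H: chart_connection M atl D\<^sub>H c B\<^sub>H \<Gamma>\<^sub>H by (rule ccH)
  interpret C: chart_connection M atl D\<^sub>C c B\<^sub>C \<Gamma>\<^sub>C by (rule ccC)
  let ?z = "snd sc u" and ?y = "snd u c"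
  note z = slit_range_mem[OF c u]
  have zy: "snd ?z = ?y" by (simp add: slit_chart_apply)
  define vec where "vec e = coord_vec atl c e (fst u)" for e
  have vec: "vec e \<in> tangent_space atl (fst u)" "vec e c = e" for e
    using c p by (simp_all add: vec_def coord_vec_tangent coord_vec_self)
  have vec_coords: "vec (v c) = v" if "v \<in> tangent_space atl (fst u)" for v
    unfolding vec_def by (rule coord_vec_coords[OF that c p])
  have "\<exists>Y. pi_field atl Y \<and> Y u = vec e" for e
    using pi_field_extend[OF s vec(1)] by metis
  \<comment> \<open>The axioms of the connections speak of fields, the comparison speaks of vectors
    at u. \<open>F e\<close> is a field through \<open>vec e\<close>; in the coordinate formulas
    only its value at u counts.\<close>
  then obtain F where F: "\<And>e. pi_field atl (F e)" and Fu: "\<And>e. F e u = vec e" by metis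
  have Fc: "F e u c = e" for e by (simp add: Fu vec)
  define h where "h e = hor_map atl D\<^sub>H u (vec e) sc" for e
  define N where "N e = - snd (h e)" for e
  define S where "S v w = \<Gamma>\<^sub>H ?z (v, - N v) w" for v w
  define \<alpha> where "\<alpha> e = A u (vec e)" for e
  define T where "T v = \<Gamma>\<^sub>C ?z (0, a u c) v" for v
  have h: "h e = (e, - N e)" for e
    using H.hor_map_coords(1)[OF regH u uH vec(1), of e] by (simp add: h_def N_def prod_eq_iff vec)
  have S_sym: "S v w = S w v" for v w
  proof -
    have "h_torsion atl D\<^sub>H (F v) (F w) u = 0" using hrf F s by (simp add: hrf_connection_def)
    then have "\<Gamma>\<^sub>H ?z (h v) w - \<Gamma>\<^sub>H ?z (h w) v = 0"
      using H.h_torsion_coords[OF regH u uH F F, of v w] by (simp add: Fu vec h_def)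
    then show ?thesis by (simp add: S_def h)
  qed
  have S_N: "S v (snd ?z) = N v" for v
  proof -
    have "- N v + \<Gamma>\<^sub>H ?z (h v) ?y = 0"
      using H.hor_map_coords(2)[OF regH u uH vec(1), of v] by (simp add: h_def[symmetric] h)
    then show ?thesis by (simp add: S_def h zy)
  qed
  have S_metric: "fc.dmetric ?z (v, - N v) w k - fc.metric ?z (S v w) k - fc.metric ?z w (S v k) = \<alpha> v * fc.metric ?z w k"
    for v w k
  proof -
    have "cov_metric atl D\<^sub>H (finsler_metric L) u (hor_map atl D\<^sub>H u (F v u)) (F w) (F k)
        = A u (F v u) * finsler_metric L u (F w u) (F k u)"
      using hrf F s unfolding hrf_connection_def by blast
    then show ?thesis
      using cov_metric_coords[OF ccH uH linH u hor_map_tangent[OF regH s vec(1)] F F, of v w k]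
        finsler_metric_coords[OF u vec(1) vec(1), of w k]
      by (simp add: Fu vec h_def[symmetric] h S_def \<alpha>_def)
  qed
  have a\<alpha>: "fc.metric ?z (a u c) v = \<alpha> v" for v
    using aA[OF F s, of v] finsler_metric_coords[OF u pi_field_tangent[OF a s] vec(1), of v]
    by (simp add: Fu vec \<alpha>_def)
  \<comment> \<open>Metricity in the direction of the vertical lift of a gives g(T v, k) + g(v, T k)
    as the derivative of g along a; the symmetry of the (h)hv-torsion makes the two summands equal,
    hence the division by 2.\<close>
  have T: "fc.metric ?z (T v) k = fc.dmetric ?z (0, a u c) v k / 2" for v k
  proof -
    have t: "gam atl u (a u) \<in> tangent_space (slit_atlas atl) u"
      by (rule gam_tangent[OF s pi_field_tangent[OF a s]])
    obtain Z where Z: "vector_field (slit_atlas atl) Z" "Z u = gam atl u (a u)"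
      using vector_field_extend[OF s t] .
    have "cov_metric atl D\<^sub>C (finsler_metric L) u (Z u) (F v) (F k) = 0"
      using cartan Z(1) F s unfolding cartan_connection_def by blast
    then have 1: "fc.dmetric ?z (0, a u c) v k - fc.metric ?z (T v) k - fc.metric ?z v (T k) = 0"
      using cov_metric_coords[OF ccC uC linC u t F F, of v k]
      by (simp add: Z(2) Fc gam_coords[OF c u] T_def)
    have "finsler_metric L u (hv_torsion atl D\<^sub>C a (F v) u) (F k u)
        = finsler_metric L u (hv_torsion atl D\<^sub>C a (F k) u) (F v u)"
      using cartan a F s unfolding cartan_connection_def hv_torsion_symmetric_def by blast
    then have "fc.metric ?z (T v) k = fc.metric ?z (T k) v"
      using finsler_metric_coords[OF u hv_torsion_tangent[OF regC a F s] vec(1)]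
        C.hv_torsion_coords[OF regC u uC a F]
      by (simp add: Fu vec T_def)
    then show ?thesis using 1 fc.metric_sym[OF z, of v "T k"] by simp
  qed
  let ?g = "(\<lambda>w. snd (G w sc)) \<circ> inv_chart sc"
  have vG: "vector_field (slit_atlas atl) G" using G by (simp add: canonical_spray_def)
  note dG = vector_field_diff_field[OF vG, of u]
  \<comment> \<open>Stated over the whole chart and not just at u, because the equation will be
    differentiated along the fibre.\<close>
  have g2: "fc.spray_eq ?g z'" if "z' \<in> W" for z'
    using canonical_spray_coords(2)[OF G slit_range_eq(1)[OF c that]] slit_range_eq(2)[OF c that]
    by (simp add: o_def)
  have dg2: "?g differentiable (at ?z)"
    using differentiableI[OF has_derivative_snd[OF has_dir_deriv[OF diff_field_differentiable[OF dG c u]]]]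
    by (simp add: o_def)
  note main = fc.koszul_comparison[OF z metric_pos[OF u] g2 dg2 S_sym S_N S_metric a\<alpha> T]
  have gz: "?g ?z = snd (G u sc)" by (simp add: slit_inv_chart_chart[OF c u])
  have eta: "eta u = vec ?y"
    using vec_coords[OF pi_field_tangent[OF eta_pi_field s]] by (simp add: eta_def)
  have liou: "liouville atl u sc = (0, ?y)" by (simp add: liouville_def gam_coords[OF c u] eta_def)
  show ?spray
    using main(1) canonical_spray_coords(1)[OF G u] gz E_chart[OF u]
    by (simp add: associated_spray_def eta h_def[symmetric] h liou gam_coords[OF c u] prod_eq_iff zy \<alpha>_def[symmetric])
  show ?nonlinear if X: "vector_field (slit_atlas atl) X"
  proof -
    let ?X = "fst (X u sc)"
    note tX = diff_field_tangent[OF vector_field_diff_field[OF X] s]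
    note trX = rho_tangent[OF s tX]
    have rX: "rho atl u (X u) c = ?X" by (rule rho_coords[OF c u tX])
    have rX': "rho atl u (X u) = vec ?X" using vec_coords[OF trX] by (simp add: rX)
    have g: "finsler_metric L u (rho atl u (X u)) (eta u) = fc.metric ?z ?X ?y"
      using finsler_metric_coords[OF u trX pi_field_tangent[OF eta_pi_field s]] by (simp add: rX eta_def)
    have t: "hv_torsion atl D\<^sub>C a (\<lambda>w. rho atl w (X w)) u c = T ?X"
      using C.hv_torsion_coords[OF regC u uC a pi_field_rho[OF X]] by (simp add: rX T_def)
    have b: "barthel atl G X u sc = (?X, dir_deriv ?g ?z (0, ?X) - snd (X u sc))"
      by (rule barthel_coords[OF c u X vG canonical_semispray[OF finsler G]])
    have l: "associated_nonlinear_connection atl D\<^sub>H X u sc = (?X, - (2 *\<^sub>R N ?X) - snd (X u sc))"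
      by (simp add: associated_nonlinear_connection_def rX' h_def[symmetric] h prod_eq_iff scaleR_2)
    have E: "(L u)\<^sup>2 = 2 * E ?z" using E_chart[OF u] by simp
    show ?thesis
      unfolding l plus_fun_apply b using main(2)[of ?X]
      by (simp add: rX' g[unfolded rX' eta] \<alpha>_def eta liou JJ_coords[OF c u tX] gam_coords[OF c u] t[unfolded rX'] E zy prod_eq_iff)
  qed
qed

end

theorem proposition3p7:
  fixes M :: "'a topology"
    and atl :: "('a, 'e::euclidean_space) chart set"
    and L :: "('a, 'e) tpoint \<Rightarrow> real"
    and A :: "('a, 'e) tpoint \<Rightarrow> ('a, 'e) tvec \<Rightarrow> real"
    and D\<^sub>H D\<^sub>C :: "('a, 'e) pi_conn"
    and a :: "('a, 'e) tpoint \<Rightarrow> ('a, 'e) tvec"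
    and G :: "('a, 'e) tpoint \<Rightarrow> ('a, 'e) ttvec"
  assumes "smooth_manifold M atl"
    and "finsler_structure atl L"
    and "pi_one_form atl A"
    and "hrf_connection atl L A D\<^sub>H"
    and "cartan_connection atl L D\<^sub>C"
    and "canonical_spray atl L G"
    and "pi_field atl a"
    and "\<And>X u. pi_field atl X \<Longrightarrow> u \<in> slit atl \<Longrightarrow> finsler_metric L u (a u) (X u) = A u (X u)"
  shows "(\<forall>u\<in>slit atl. associated_spray atl D\<^sub>H u =
           G u + A u (eta u) *\<^sub>R liouville atl u - ((1/2) * (L u)\<^sup>2) *\<^sub>R gam atl u (a u)) \<and>
         (\<forall>X. vector_field (slit_atlas atl) X \<longrightarrow> (\<forall>u\<in>slit atl.
           associated_nonlinear_connection atl D\<^sub>H X u =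
           barthel atl G X u +
           (A u (rho atl u (X u)) *\<^sub>R liouville atl u
            + A u (eta u) *\<^sub>R JJ atl u (X u)
            - finsler_metric L u (rho atl u (X u)) (eta u) *\<^sub>R gam atl u (a u)
            + (L u)\<^sup>2 *\<^sub>R gam atl u (hv_torsion atl D\<^sub>C a (\<lambda>w. rho atl w (X w)) u))))"
proof -
  interpret manifold_atlas M atl by unfold_locales (rule assms(1))
  have chart: "finsler_chart M atl L c" if "c \<in> atl" for c
    using assms(2) that by unfold_locales
  have reg: "regular_connection atl D\<^sub>H" using assms(4) by (simp add: hrf_connection_def)
  have vG: "vector_field (slit_atlas atl) G" using assms(6) by (simp add: canonical_spray_def)
  \<comment> \<open>Elements of type \<open>ttvec\<close> are families over all conceivable charts.
    Both identities are therefore compared component by component; in charts that do not contain u,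
    every term has to be seen to be 0.\<close>
  have gam0: "gam atl u v c' = 0" if "\<not> (c' \<in> slit_atlas atl \<and> u \<in> fst c')" for u v c'
    using that by (auto simp: gam_def velocity_def)
  have outside: "X u c' = 0" if "vector_field (slit_atlas atl) X" "u \<in> slit atl" "\<not> (c' \<in> slit_atlas atl \<and> u \<in> fst c')"
    for X u c'
    using slit.tangent_outside[OF diff_field_tangent[OF vector_field_diff_field[OF that(1)] that(2)] that(3)] .
  have hor0: "hor_map atl D\<^sub>H u v c' = 0"
    if "u \<in> slit atl" "v \<in> tangent_space atl (fst u)" "\<not> (c' \<in> slit_atlas atl \<and> u \<in> fst c')" for u v c'
    by (rule slit.tangent_outside[OF hor_map_tangent[OF reg that(1,2)] that(3)])
  show ?thesis
  proof (intro conjI ballI allI impI ext)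
    fix u c' assume u: "u \<in> slit atl"
    show "associated_spray atl D\<^sub>H u c' =
        (G u + A u (eta u) *\<^sub>R liouville atl u - ((1/2) * (L u)\<^sup>2) *\<^sub>R gam atl u (a u)) c'"
    proof (cases "c' \<in> slit_atlas atl \<and> u \<in> fst c'")
      case True
      then obtain c where c: "c \<in> atl" "c' = slit_chart atl c" "u \<in> fst (slit_chart atl c)"
        by (auto simp: slit_atlas_def)
      show ?thesis unfolding c(2)
        by (rule finsler_chart.hrf_coords(1)[OF chart[OF c(1)] assms(4-7) _ c(3)]) (rule assms(8))
    next
      case False
      then show ?thesis
        using hor0[OF u pi_field_tangent[OF eta_pi_field u]] outside[OF vG u]
        by (simp add: associated_spray_def liouville_def gam0)
    qed
    fix X assume X: "vector_field (slit_atlas atl) X"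
    show "associated_nonlinear_connection atl D\<^sub>H X u c' =
        (barthel atl G X u + (A u (rho atl u (X u)) *\<^sub>R liouville atl u + A u (eta u) *\<^sub>R JJ atl u (X u)
          - finsler_metric L u (rho atl u (X u)) (eta u) *\<^sub>R gam atl u (a u)
          + (L u)\<^sup>2 *\<^sub>R gam atl u (hv_torsion atl D\<^sub>C a (\<lambda>w. rho atl w (X w)) u))) c'"
    proof (cases "c' \<in> slit_atlas atl \<and> u \<in> fst c'")
      case True
      then obtain c where c: "c \<in> atl" "c' = slit_chart atl c" "u \<in> fst (slit_chart atl c)"
        by (auto simp: slit_atlas_def)
      show ?thesis unfolding c(2)
        by (rule finsler_chart.hrf_coords(2)[OF chart[OF c(1)] assms(4-7) _ c(3) X]) (rule assms(8))
    next
      case False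
      then show ?thesis
        using hor0[OF u rho_tangent[OF u diff_field_tangent[OF vector_field_diff_field[OF X] u]]] outside[OF X u]
        by (auto simp: associated_nonlinear_connection_def barthel_def lie_bracket_def liouville_def JJ_def gam0)
    qed
  qed
qed

end
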